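(* If $p\in\mathbb{R}[x,y]_a$ and $q\in\mathbb{R}[x,y]_b$ are Lorentzian (respectively, homogeneous stable) bivariate polynomials, then $p\bullet q$ is Lorentzian (respectively, homogeneous stable).
   Context: $\mathbb{R}[x,y]_d$ denotes the space of real homogeneous bivariate polynomials of degree $d$ and $\mathbb{R}_d[x]$ the univariate real polynomials of degree at most $d$. Let $T_d:\mathbb{R}_d[x]\to\mathbb{R}[x,y]_d$ be the linear bijection with $\binom{x+d-i}{d}\mapsto x^iy^{d-i}$ for $0\le i\le d$, and for $p\in\mathbb{R}[x,y]_a$, $q\in\mathbb{R}[x,y]_b$ set $p\bullet q=T_{a+b}(T_a^{-1}(p)\cdot T_b^{-1}(q))$. A polynomial is stable if it does not vanish when all variables lie in the open upper half-plane. Lorentzian polynomials in the sense of Brändén–Huh: homogeneous degree-$d$ polynomials in $n$ variables with nonnegative coefficients such that for $d\le2$ they are stable, and for $d>2$ they have M-convex support and all partial derivatives $\partial_if$ are Lorentzian (a set $J\subseteq\mathbb{N}^n$ is M-convex if for $\alpha,\beta\in J$ and $i$ with $\alpha_i>\beta_i$ there is $j$ with $\alpha_j<\beta_j$ and $\alpha-e_i+e_j\in J$). In the bivariate case, $f\in\mathbb{R}[x,y]_d$ with nonnegative coefficients is Lorentzian iff $f(x,1)$ is ultra log-concave of order $d$ with no internal zeros, and homogeneous stable with nonnegative coefficients iff $f(x,1)$ is real-rooted. *)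

theory Defs
  imports
    Complex_Main
    "HOL-Library.Poly_Mapping"
    "HOL-Library.Numeral_Type"
    "HOL-Computational_Algebra.Polynomial"
begin

abbreviation "lookup \<equiv> Poly_Mapping.lookup"
abbreviation "keys \<equiv> Poly_Mapping.keys"
abbreviation "single \<equiv> Poly_Mapping.single"

text \<open>Real polynomials in the variables \<open>x\<^sub>v\<close>, \<open>v :: 'v\<close>: finitely supported maps from exponent
  vectors to coefficients. Bivariate polynomials are the case \<open>'v = 2\<close>, with \<open>x = x\<^sub>1\<close>
  and \<open>y = x\<^sub>2\<close>.\<close>

type_synonym 'v rmpoly = "('v \<Rightarrow>\<^sub>0 nat) \<Rightarrow>\<^sub>0 real"

definition homogeneous :: "nat \<Rightarrow> 'v::finite rmpoly \<Rightarrow> bool" where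
  "homogeneous d f \<longleftrightarrow> (\<forall>\<alpha>\<in>keys f. (\<Sum>v\<in>UNIV. lookup \<alpha> v) = d)"

definition ceval :: "'v::finite rmpoly \<Rightarrow> ('v \<Rightarrow> complex) \<Rightarrow> complex" where
  "ceval f z = (\<Sum>\<alpha>\<in>keys f. complex_of_real (lookup f \<alpha>) * (\<Prod>v\<in>UNIV. z v ^ lookup \<alpha> v))"

definition stable_poly :: "'v::finite rmpoly \<Rightarrow> bool" where
  "stable_poly f \<longleftrightarrow> (\<forall>z. (\<forall>v. Im (z v) > 0) \<longrightarrow> ceval f z \<noteq> 0)"

definition partial_deriv :: "'v \<Rightarrow> 'v rmpoly \<Rightarrow> 'v rmpoly" where
  "partial_deriv v f =
     (\<Sum>\<alpha>\<in>keys f. single (\<alpha> - single v 1) (real (lookup \<alpha> v) * lookup f \<alpha>))"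

definition M_convex :: "('v \<Rightarrow>\<^sub>0 nat) set \<Rightarrow> bool" where
  "M_convex J \<longleftrightarrow>
     (\<forall>\<alpha>\<in>J. \<forall>\<beta>\<in>J. \<forall>i. lookup \<alpha> i > lookup \<beta> i \<longrightarrow>
        (\<exists>j. lookup \<alpha> j < lookup \<beta> j \<and>
             \<alpha> - single i 1 + single j 1 \<in> J))"

text \<open>The zero polynomial counts as Lorentzian in every degree, although \<^const>\<open>stable_poly\<close> excludes it;
  otherwise \<open>y\<^sup>3\<close>, whose derivative in \<open>x\<close> is zero, would fail to be Lorentzian.\<close>

function lorentzian :: "nat \<Rightarrow> 'v::finite rmpoly \<Rightarrow> bool" where
  "lorentzian d f \<longleftrightarrow>
     homogeneous d f \<and> (\<forall>\<alpha>. lookup f \<alpha> \<ge> 0) \<and>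
     (if d \<le> 2 then f = 0 \<or> stable_poly f
      else M_convex (keys f) \<and> (\<forall>v. lorentzian (d - 1) (partial_deriv v f)))"
  by pat_completeness auto
termination by (relation "measure fst") auto

declare lorentzian.simps [simp del]

definition xy_monom :: "nat \<Rightarrow> nat \<Rightarrow> real \<Rightarrow> 2 rmpoly" where
  "xy_monom i j c = single (single 1 i + single 2 j) c"

definition binom_poly :: "nat \<Rightarrow> nat \<Rightarrow> real poly" where
  "binom_poly d i = smult (1 / fact d) (\<Prod>k<d. [:real d - real i - real k, 1:])"

lemma poly_binom_poly: "poly (binom_poly d i) x = (x + real d - real i) gchoose d"
  by (simp add: binom_poly_def gbinomial_prod_rev poly_prod lessThan_atLeast0 algebra_simps)

text \<open>The linear map given on the basis \<open>binom_poly d i\<close>, \<open>i \<le> d\<close>, of the polynomials of degree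
  at most \<open>d\<close> by \<open>binom_poly d i \<mapsto> x\<^sup>i y\<^sup>d\<^sup>-\<^sup>i\<close>; unspecified outside that space.\<close>

definition T_map :: "nat \<Rightarrow> real poly \<Rightarrow> 2 rmpoly" where
  "T_map d f = (THE p. \<exists>c. f = (\<Sum>i\<le>d. smult (c i) (binom_poly d i)) \<and>
                           p = (\<Sum>i\<le>d. xy_monom i (d - i) (c i)))"

definition T_inv :: "nat \<Rightarrow> 2 rmpoly \<Rightarrow> real poly" where
  "T_inv d = inv_into {f. degree f \<le> d} (T_map d)"

definition bullet :: "nat \<Rightarrow> nat \<Rightarrow> 2 rmpoly \<Rightarrow> 2 rmpoly \<Rightarrow> 2 rmpoly" where
  "bullet a b p q = T_map (a + b) (T_inv a p * T_inv b q)"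

lemma degree_binom_poly: "degree (binom_poly d i) = d"
proof -
  have "degree (\<Prod>k<n. [:real d - real i - real k, 1:]) = n" for n
    by (subst degree_prod_eq_sum_degree) auto
  then show ?thesis by (simp add: binom_poly_def)
qed

lemma poly_binom_poly_nat:
  assumes "i \<le> d" "k \<le> i"
  shows "poly (binom_poly d i) (real k) = (if k = i then 1 else 0)"
proof -
  have "real k + real d - real i = real (k + d - i)" using assms by simp
  then have "poly (binom_poly d i) (real k) = real ((k + d - i) choose d)"
    unfolding poly_binom_poly binomial_gbinomial by (rule arg_cong)
  also have "\<dots> = (if k = i then 1 else 0)"
  proof (cases "k = i")
    case False
    then have "k + d - i < d" using assms by linarith
    then show ?thesis using False by (simp add: binomial_eq_0)
  qed simp
  finally show ?thesis .
qed

lemma binom_poly_coeff_unique: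
  assumes eq: "(\<Sum>i\<le>d. smult (c i) (binom_poly d i)) = (\<Sum>i\<le>d. smult (c' i) (binom_poly d i))"
    and "k \<le> d"
  shows "c k = c' k"
  using \<open>k \<le> d\<close>
proof (induction k rule: less_induct)
  case (less k)
  define e where "e i = c i - c' i" for i
  have "0 = (\<Sum>i\<le>d. e i * poly (binom_poly d i) (real k))"
    using arg_cong[OF eq, of "\<lambda>f. poly f (real k)"]
    by (simp add: poly_sum e_def left_diff_distrib sum_subtractf)
  also have "\<dots> = (\<Sum>i\<le>d. if i = k then e k else 0)"
  proof (rule sum.cong)
    fix i assume "i \<in> {..d}"
    then show "e i * poly (binom_poly d i) (real k) = (if i = k then e k else 0)"
      using less by (cases "i < k") (auto simp: e_def poly_binom_poly_nat)
  qed simp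
  also have "\<dots> = e k" using less.prems by simp
  finally show ?case by (simp add: e_def)
qed

lemma binom_poly_span:
  assumes "degree f \<le> d"
  obtains c where "f = (\<Sum>i\<le>d. smult (c i) (binom_poly d i))"
proof -
  have "\<exists>c. \<forall>k<m. (\<Sum>i\<le>d. c i * poly (binom_poly d i) (real k)) = poly f (real k)"
    if "m \<le> Suc d" for m
    using that
  proof (induction m)
    case (Suc m)
    then obtain c where c: "\<forall>k<m. (\<Sum>i\<le>d. c i * poly (binom_poly d i) (real k)) = poly f (real k)"
      by auto
    define t where "t = poly f (real m) - (\<Sum>i\<le>d. c i * poly (binom_poly d i) (real m))"
    define c' where "c' i = c i + (if i = m then t else 0)" for i
    have m: "m \<le> d" using Suc.prems by simp
    have split: "(\<Sum>i\<le>d. c' i * poly (binom_poly d i) (real k)) =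
        (\<Sum>i\<le>d. c i * poly (binom_poly d i) (real k)) + t * poly (binom_poly d m) (real k)" for k
    proof -
      have "(\<Sum>i\<le>d. c' i * poly (binom_poly d i) (real k)) =
        (\<Sum>i\<le>d. c i * poly (binom_poly d i) (real k) +
               (if i = m then t * poly (binom_poly d m) (real k) else 0))"
        by (rule sum.cong) (auto simp: c'_def algebra_simps)
      then show ?thesis using m by (simp add: sum.distrib)
    qed
    have "(\<Sum>i\<le>d. c' i * poly (binom_poly d i) (real k)) = poly f (real k)" if "k < Suc m" for k
      using that m c split[of k] by (cases "k = m") (auto simp: poly_binom_poly_nat t_def)
    then show ?case by blast
  qed simp
  from this[of "Suc d"] obtain c
    where c: "\<forall>k<Suc d. (\<Sum>i\<le>d. c i * poly (binom_poly d i) (real k)) = poly f (real k)"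
    by auto
  define g where "g = f - (\<Sum>i\<le>d. smult (c i) (binom_poly d i))"
  have "degree (\<Sum>i\<le>d. smult (c i) (binom_poly d i)) \<le> d"
    by (rule degree_sum_le) (auto simp: degree_binom_poly)
  then have deg: "degree g \<le> d" unfolding g_def using assms by (rule degree_diff_le[rotated])
  have "g = 0"
  proof (rule ccontr)
    assume "g \<noteq> 0"
    have "real ` {..d} \<subseteq> {x. poly g x = 0}" using c by (auto simp: g_def poly_sum)
    then have "card (real ` {..d}) \<le> card {x. poly g x = 0}"
      by (rule card_mono[OF poly_roots_finite[OF \<open>g \<noteq> 0\<close>]])
    also have "\<dots> \<le> d" using card_poly_roots_bound[OF \<open>g \<noteq> 0\<close>] deg by simp
    finally show False by (simp add: card_image)
  qed
  then show ?thesis using that by (simp add: g_def)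
qed

lemma T_map_sum:
  "T_map d (\<Sum>i\<le>d. smult (c i) (binom_poly d i)) = (\<Sum>i\<le>d. xy_monom i (d - i) (c i))"
  unfolding T_map_def
proof (rule the_equality)
  fix p
  assume "\<exists>c'. (\<Sum>i\<le>d. smult (c i) (binom_poly d i)) = (\<Sum>i\<le>d. smult (c' i) (binom_poly d i)) \<and>
               p = (\<Sum>i\<le>d. xy_monom i (d - i) (c' i))"
  then obtain c' where
    c': "(\<Sum>i\<le>d. smult (c i) (binom_poly d i)) = (\<Sum>i\<le>d. smult (c' i) (binom_poly d i))"
    and p: "p = (\<Sum>i\<le>d. xy_monom i (d - i) (c' i))" by blast
  show "p = (\<Sum>i\<le>d. xy_monom i (d - i) (c i))"
    unfolding p by (rule sum.cong) (auto simp: binom_poly_coeff_unique[OF c'])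
qed (intro exI conjI; rule refl)

lemma T_map_binom_poly:
  assumes "i \<le> d"
  shows "T_map d (binom_poly d i) = xy_monom i (d - i) 1"
proof -
  have "binom_poly d i = (\<Sum>j\<le>d. if j = i then binom_poly d i else 0)" using assms by simp
  also have "\<dots> = (\<Sum>j\<le>d. smult (if j = i then 1 else 0) (binom_poly d j))"
    by (rule sum.cong) auto
  finally have "T_map d (binom_poly d i) = (\<Sum>j\<le>d. xy_monom j (d - j) (if j = i then 1 else 0))"
    using T_map_sum[of d "\<lambda>j. if j = i then 1 else 0"] by simp
  also have "\<dots> = (\<Sum>j\<le>d. if j = i then xy_monom i (d - i) 1 else 0)"
    by (rule sum.cong) (auto simp: xy_monom_def)
  finally show ?thesis using assms by simp
qed

lemma UNIV_type_2: "(UNIV :: 2 set) = {1, 2}"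
proof -
  have "card {1, 2 :: 2} = CARD(2)" by simp
  then show ?thesis by (metis card_subset_eq finite subset_UNIV)
qed

lemma xy_eta:
  fixes \<alpha> :: "2 \<Rightarrow>\<^sub>0 nat"
  shows "single 1 (lookup \<alpha> 1) + single 2 (lookup \<alpha> 2) = \<alpha>"
proof (rule poly_mapping_eqI)
  fix v :: 2
  have "v = 1 \<or> v = 2" using UNIV_type_2 by auto
  then show "lookup (single 1 (lookup \<alpha> 1) + single 2 (lookup \<alpha> 2)) v =
      lookup \<alpha> v"
    by (auto simp: lookup_add lookup_single)
qed

lemma lookup_xy_monom_sum:
  "lookup (\<Sum>i\<le>d. xy_monom i (d - i) (c i)) \<alpha> =
     (if lookup \<alpha> 1 + lookup \<alpha> 2 = d then c (lookup \<alpha> 1) else 0)"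
proof -
  have eq: "single 1 i + single 2 j = \<alpha> \<longleftrightarrow>
      lookup \<alpha> 1 = i \<and> lookup \<alpha> 2 = j" for i j
  proof
    assume "lookup \<alpha> 1 = i \<and> lookup \<alpha> 2 = j"
    then show "single 1 i + single 2 j = \<alpha>" using xy_eta[of \<alpha>] by simp
  next
    assume "single 1 i + single 2 j = \<alpha>"
    then show "lookup \<alpha> 1 = i \<and> lookup \<alpha> 2 = j" by (auto simp: lookup_add lookup_single)
  qed
  have "lookup (\<Sum>i\<le>d. xy_monom i (d - i) (c i)) \<alpha> =
      (\<Sum>i\<le>d. if i = lookup \<alpha> 1 then (if lookup \<alpha> 2 = d - i then c i else 0) else 0)"
    unfolding lookup_sum by (rule sum.cong) (auto simp: xy_monom_def lookup_single eq when_def)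
  then show ?thesis by auto
qed

lemma bij_betw_T_map: "bij_betw (T_map d) {f. degree f \<le> d} {p. homogeneous d p}"
  unfolding bij_betw_def
proof
  show "inj_on (T_map d) {f. degree f \<le> d}"
  proof (rule inj_onI)
    fix f g assume "f \<in> {f. degree f \<le> d}" "g \<in> {f. degree f \<le> d}" and fg: "T_map d f = T_map d g"
    then have "degree f \<le> d" "degree g \<le> d" by auto
    then obtain c c' where f: "f = (\<Sum>i\<le>d. smult (c i) (binom_poly d i))"
      and g: "g = (\<Sum>i\<le>d. smult (c' i) (binom_poly d i))"
      by (elim binom_poly_span)
    have "c i = c' i" if "i \<le> d" for i
    proof -
      let ?\<alpha> = "single (1::2) i + single 2 (d - i)"
      have "lookup ?\<alpha> 1 = i" "lookup ?\<alpha> 2 = d - i" by (auto simp: lookup_add lookup_single)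
      then show ?thesis
        using arg_cong[OF fg, of "\<lambda>p. lookup p ?\<alpha>"] that
        unfolding f g T_map_sum lookup_xy_monom_sum by simp
    qed
    then show "f = g" unfolding f g by (intro sum.cong) auto
  qed
next
  show "T_map d ` {f. degree f \<le> d} = {p. homogeneous d p}"
  proof (intro equalityI subsetI)
    fix p assume "p \<in> T_map d ` {f. degree f \<le> d}"
    then obtain f where f: "degree f \<le> d" "p = T_map d f" by blast
    obtain c where "f = (\<Sum>i\<le>d. smult (c i) (binom_poly d i))"
      by (rule binom_poly_span[OF f(1)])
    then have p: "p = (\<Sum>i\<le>d. xy_monom i (d - i) (c i))" using f(2) by (simp add: T_map_sum)
    show "p \<in> {p. homogeneous d p}"
      by (auto simp: p homogeneous_def UNIV_type_2 in_keys_iff lookup_xy_monom_sum split: if_splits)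
  next
    fix p :: "2 rmpoly" assume p: "p \<in> {p. homogeneous d p}"
    define c where "c i = lookup p (single 1 i + single 2 (d - i))" for i
    have "p = (\<Sum>i\<le>d. xy_monom i (d - i) (c i))"
    proof (rule poly_mapping_eqI)
      fix \<alpha> :: "2 \<Rightarrow>\<^sub>0 nat"
      have "\<alpha> = single 1 (lookup \<alpha> 1) + single 2 (lookup \<alpha> 2)"
        by (simp add: xy_eta)
      moreover have "lookup p \<alpha> = 0" if "lookup \<alpha> 1 + lookup \<alpha> 2 \<noteq> d"
        using p that by (auto simp: homogeneous_def UNIV_type_2 in_keys_iff)
      ultimately show "lookup p \<alpha> = lookup (\<Sum>i\<le>d. xy_monom i (d - i) (c i)) \<alpha>"
        unfolding lookup_xy_monom_sum c_def by (metis diff_add_inverse)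
    qed
    then have "p = T_map d (\<Sum>i\<le>d. smult (c i) (binom_poly d i))" by (simp add: T_map_sum)
    moreover have "degree (\<Sum>i\<le>d. smult (c i) (binom_poly d i)) \<le> d"
      by (rule degree_sum_le) (auto simp: degree_binom_poly)
    ultimately show "p \<in> T_map d ` {f. degree f \<le> d}" by blast
  qed
qed

end

theory Submission
  imports Defs "HOL-Library.Multiset" "HOL-Computational_Algebra.Fundamental_Theorem_Algebra"
begin

text \<open>
  Write \<open>p = \<Sum> p\<^sub>i x\<^sup>i y\<^sup>a\<^sup>-\<^sup>i\<close> and \<open>q = \<Sum> q\<^sub>j x\<^sup>j y\<^sup>b\<^sup>-\<^sup>j\<close>. Nanjundiah's binomial identity gives the coefficients of
  the product explicitly, and these are the coefficients of \<open>u\<^sup>b\<close> in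
  \<open>M(u) = p(x + u, y + u) q(x (y + u), y (x + u))\<close>.

  Stability: for \<open>x, y\<close> in the upper half-plane, homogeneity and stability of \<open>p\<close> and \<open>q\<close> show that \<open>M\<close> has no zero in
  the closed upper half-plane, so by Gauss--Lucas no coefficient of \<open>M\<close> vanishes.

  Lorentzian case: a directional derivative along a nonnegative vector preserves the Lorentzian property. If
  \<open>A = \<partial>\<^sub>i g\<close> and \<open>B = \<partial>\<^sub>j g\<close> for a Lorentzian cubic \<open>g\<close>, the vector \<open>A e\<^sub>j = B e\<^sub>i\<close>, if nonzero, defines a hyperplane on which
  both \<open>A\<close> and \<open>B\<close> are nonpositive, so \<open>A + B\<close> has at most one positive eigenvalue; if it is zero, the exchange
  property supplies another such hyperplane. The normalised coefficients of the product are then read off as iterated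
  directional derivatives of a product of two explicit Lorentzian polynomials in disjoint variables: \<open>p\<close> itself, and
  a multiaffine polynomial that becomes \<open>u\<^sup>b q(x (y + u), y (x + u))\<close> after identifying variables.
\<close>

section \<open>Quadratic forms with at most one positive eigenvalue\<close>

text \<open>M arises by reading each product of two binomials as a Vandermonde convolution: it is
  the coefficient of \<open>u^b\<close> in \<open>(x + u)^(b+i-j) * (y + u)^(a+j-i)\<close>, and
  together with \<open>x^j * y^(b-j)\<close> the powers regroup into a monomial of \<open>p\<close>
  and one of \<open>q\<close>. The half-plane argument rests on
  \<open>x*(y + u) = x*y*u*(1/u + 1/y)\<close> and its mirror image. For the Lorentzian case the
  obstacle is that the substitution into \<open>q\<close> is quadratic, whereas directional
  derivatives only encode linear substitutions. The factor \<open>u^b\<close> removes it: in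
  \<open>x*u*(y + u)\<close> and \<open>y*u*(x + u)\<close> the terms \<open>x*u\<close> and
  \<open>x + u\<close> are the elementary symmetric polynomials of a pair specialised to
  \<open>x, u\<close>, so a multiaffine polynomial in 4b variables specialises linearly to the form
  wanted. Together with \<open>p\<close> the degree is a + 3b. Of this, 2b derivatives go in
  direction \<open>u\<close>, b for the added factor and b for the coefficient sought, which leaves
  a form of degree a + b in \<open>x\<close> and \<open>y\<close>. Differentiating it down to degree
  two gives a two by two discriminant inequality, which is log-concavity of the normalised
  coefficients.\<close>

definition bform :: "'v set \<Rightarrow> ('v \<Rightarrow> 'v \<Rightarrow> real) \<Rightarrow> ('v \<Rightarrow> real) \<Rightarrow> ('v \<Rightarrow> real) \<Rightarrow> real" where
  "bform V A u v = (\<Sum>i\<in>V. \<Sum>j\<in>V. A i j * u i * v j)"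

text \<open>At most one positive eigenvalue, stated without eigenvalues: nonpositive on the kernel
  of a linear functional. The zero functional is allowed and then says that the form is nonpositive
  everywhere.\<close>

definition one_pos :: "'v set \<Rightarrow> ('v \<Rightarrow> 'v \<Rightarrow> real) \<Rightarrow> bool" where
  "one_pos V A \<longleftrightarrow> (\<exists>l. \<forall>v. (\<Sum>i\<in>V. l i * v i) = 0 \<longrightarrow> bform V A v v \<le> 0)"

lemma bform_add_left: "bform V A (\<lambda>i. u i + t * u' i) v = bform V A u v + t * bform V A u' v"
  by (simp add: bform_def algebra_simps sum.distrib sum_distrib_left)

lemma bform_add_right: "bform V A u (\<lambda>i. v i + t * v' i) = bform V A u v + t * bform V A u v'"
  by (simp add: bform_def algebra_simps sum.distrib sum_distrib_left)

lemma bform_add_matrix: "bform V (\<lambda>i j. A i j + t * B i j) u v = bform V A u v + t * bform V B u v"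
  by (simp add: bform_def algebra_simps sum.distrib sum_distrib_left)

lemma bform_commute:
  assumes "\<And>i j. A i j = A j i"
  shows "bform V A u v = bform V A v u"
  unfolding bform_def by (subst sum.swap) (simp add: assms mult_ac)

lemma bform_nonneg:
  assumes "\<And>i j. A i j \<ge> 0" "\<And>i. u i \<ge> 0" "\<And>i. v i \<ge> 0"
  shows "bform V A u v \<ge> 0"
  unfolding bform_def by (intro sum_nonneg mult_nonneg_nonneg assms)

lemma bform_eq_functional: "bform V A v w = (\<Sum>i\<in>V. (\<Sum>j\<in>V. A i j * w j) * v i)"
  by (simp add: bform_def sum_distrib_right sum_distrib_left mult_ac)

text \<open>Since the form is positive at \<open>w\<close>, the functional \<open>l\<close> does not
  vanish there, so some \<open>u + c * w\<close> lies in its kernel. Nonpositivity at that point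
  gives the claim after completing the square in \<open>c\<close>.\<close>

lemma one_pos_reverse_cauchy:
  assumes sym: "\<And>i j. A i j = A j i" and "one_pos V A" and pos: "bform V A w w > 0"
  shows "bform V A u u * bform V A w w \<le> (bform V A u w)\<^sup>2"
proof -
  from assms(2) obtain l where l: "\<And>v. (\<Sum>i\<in>V. l i * v i) = 0 \<Longrightarrow> bform V A v v \<le> 0"
    unfolding one_pos_def by blast
  define L where "L v = (\<Sum>i\<in>V. l i * v i)" for v
  have Lw: "L w \<noteq> 0" using l[of w] pos by (auto simp: L_def)
  define c where "c = - (L u / L w)"
  have "L (\<lambda>i. u i + c * w i) = L u + c * L w"
    by (simp add: L_def algebra_simps sum.distrib sum_distrib_left)
  also have "\<dots> = 0" using Lw by (simp add: c_def)
  finally have "bform V A (\<lambda>i. u i + c * w i) (\<lambda>i. u i + c * w i) \<le> 0"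
    using l by (simp add: L_def)
  then have le: "bform V A u u + 2 * c * bform V A u w + c\<^sup>2 * bform V A w w \<le> 0"
    by (simp add: bform_add_left bform_add_right bform_commute[of A V w u, OF sym]
        algebra_simps power2_eq_square)
  have "0 \<le> (bform V A u w + c * bform V A w w)\<^sup>2" by simp
  also have "\<dots> = (bform V A u w)\<^sup>2 + bform V A w w * (2 * c * bform V A u w + c\<^sup>2 * bform V A w w)"
    by (simp add: power2_eq_square algebra_simps)
  also have "\<dots> \<le> (bform V A u w)\<^sup>2 + bform V A w w * (- bform V A u u)"
    using le pos by (intro add_left_mono mult_left_mono) auto
  finally show ?thesis by (simp add: mult.commute)
qed

text \<open>Were the form positive at \<open>w\<close>, this would be
  \<open>one_pos_reverse_cauchy\<close>. To include isotropic \<open>w\<close>, it is replaced by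
  \<open>e + t * w\<close> with \<open>e\<close> the \<open>k\<close>-th unit vector: the value of
  the form there grows at least linearly in \<open>t\<close>, while the pairing with
  \<open>v\<close> stays constant.\<close>

lemma one_pos_orthogonal_nonpos:
  assumes fin: "finite V" and sym: "\<And>i j. A i j = A j i" and nn: "\<And>i j. A i j \<ge> 0"
    and lz: "one_pos V A" and w: "\<And>i. w i \<ge> 0"
    and k: "k \<in> V" "(\<Sum>j\<in>V. A k j * w j) \<noteq> 0" and orth: "bform V A v w = 0"
  shows "bform V A v v \<le> 0"
proof (rule ccontr)
  assume "\<not> ?thesis"
  then have pos: "bform V A v v > 0" by simp
  define e where "e i = (if i = k then 1 else 0 :: real)" for i
  define s where "s = bform V A e w"
  define c where "c = bform V A v e"
  have "s = (\<Sum>i\<in>V. if i = k then \<Sum>j\<in>V. A k j * w j else 0)"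
    unfolding s_def bform_eq_functional by (rule sum.cong) (auto simp: e_def)
  also have "\<dots> = (\<Sum>j\<in>V. A k j * w j)" using k fin by simp
  moreover have "(\<Sum>j\<in>V. A k j * w j) \<ge> 0" by (intro sum_nonneg mult_nonneg_nonneg nn w)
  ultimately have s: "s > 0" using k by linarith
  \<comment> \<open>Chosen so that \<open>bform V A v v * (2 * t * s)\<close> is
    \<open>c\<^sup>2 + 1\<close>, just above the bound \<open>c\<^sup>2\<close> of the reverse
    Cauchy inequality.\<close>
  define t where "t = (c\<^sup>2 + 1) / (2 * s * bform V A v v)"
  have t: "t > 0" unfolding t_def using s pos by (intro divide_pos_pos) (auto intro: add_nonneg_pos)
  define z where "z i = e i + t * w i" for i
  have e0: "\<And>i. e i \<ge> 0" by (simp add: e_def)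
  have "bform V A z z = bform V A e e + 2 * t * s + t\<^sup>2 * bform V A w w"
    unfolding z_def s_def
    by (simp add: bform_add_left bform_add_right bform_commute[of A V w e, OF sym]
        algebra_simps power2_eq_square)
  moreover have "bform V A e e \<ge> 0" "t\<^sup>2 * bform V A w w \<ge> 0"
    using bform_nonneg[of A e e V, OF nn] bform_nonneg[of A w w V, OF nn] e0 w by simp_all
  ultimately have zz: "bform V A z z \<ge> 2 * t * s" by linarith
  moreover have "2 * t * s > 0" using t s by simp
  ultimately have zpos: "bform V A z z > 0" by linarith
  have "bform V A v z = c" unfolding z_def c_def by (simp add: bform_add_right orth)
  then have "bform V A v v * bform V A z z \<le> c\<^sup>2"
    using one_pos_reverse_cauchy[OF sym lz zpos, of v] by simp
  moreover have "bform V A v v * (2 * t * s) \<le> bform V A v v * bform V A z z"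
    using zz pos by simp
  moreover have "bform V A v v * (2 * t * s) = c\<^sup>2 + 1"
    using pos s by (simp add: t_def)
  ultimately show False by linarith
qed

text \<open>Orthogonal nonnegative vectors have proportional images, expressed as an inclusion of
  kernels. Here \<open>y\<close> is isotropic, so moving \<open>v\<close> along \<open>y\<close>
  inside the hyperplane orthogonal to \<open>x\<close> changes the form affinely; as the form is
  nonpositive on that hyperplane, the slope must be zero.\<close>

lemma one_pos_isotropic_parallel:
  assumes fin: "finite V" and sym: "\<And>i j. A i j = A j i" and nn: "\<And>i j. A i j \<ge> 0"
    and lz: "one_pos V A" and x: "\<And>i. x i \<ge> 0" and y: "\<And>i. y i \<ge> 0"
    and k: "k \<in> V" "(\<Sum>j\<in>V. A k j * x j) \<noteq> 0"
    and xy: "bform V A x y = 0" and vx: "bform V A v x = 0"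
  shows "bform V A v y = 0"
proof (rule ccontr)
  assume ne: "bform V A v y \<noteq> 0"
  have yx: "bform V A y x = 0" using xy bform_commute[of A, OF sym] by metis
  have "bform V A y y \<le> 0"
    by (rule one_pos_orthogonal_nonpos[of V A, OF fin sym nn lz x k yx])
  moreover have "bform V A y y \<ge> 0" by (rule bform_nonneg[of A y y V, OF nn y y])
  ultimately have yy: "bform V A y y = 0" by simp
  define t where "t = (1 - bform V A v v) / (2 * bform V A v y)"
  have "bform V A (\<lambda>i. v i + t * y i) x = 0" by (simp add: bform_add_left vx yx)
  then have "bform V A (\<lambda>i. v i + t * y i) (\<lambda>i. v i + t * y i) \<le> 0"
    by (rule one_pos_orthogonal_nonpos[of V A, OF fin sym nn lz x k])
  also have "bform V A (\<lambda>i. v i + t * y i) (\<lambda>i. v i + t * y i) = bform V A v v + t * (2 * bform V A v y)"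
    by (simp add: bform_add_left bform_add_right bform_commute[of A V y v, OF sym] yy algebra_simps)
  also have "\<dots> = 1" using ne by (simp add: t_def)
  finally show False by simp
qed

lemma one_pos_if_nonpos_on_orthogonal:
  assumes "\<And>v. bform V B v w = 0 \<Longrightarrow> bform V A v v \<le> 0"
  shows "one_pos V A"
  unfolding one_pos_def
  by (rule exI[of _ "\<lambda>i. \<Sum>j\<in>V. B i j * w j"]) (auto simp: bform_eq_functional[symmetric] assms)

lemma one_pos_scale:
  assumes "one_pos V A" "c \<ge> 0"
  shows "one_pos V (\<lambda>i j. c * A i j)"
proof -
  have "bform V (\<lambda>i j. c * A i j) v v = c * bform V A v v" for v
    by (simp add: bform_def sum_distrib_left mult_ac)
  then show ?thesis using assms unfolding one_pos_def by (metis mult_nonneg_nonpos)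
qed

lemma one_pos_cong:
  assumes "one_pos V A" "\<And>i j. i \<in> V \<Longrightarrow> j \<in> V \<Longrightarrow> A i j = B i j"
  shows "one_pos V B"
proof -
  have "bform V A v v = bform V B v v" for v
    unfolding bform_def by (intro sum.cong refl) (simp add: assms)
  then show ?thesis using assms(1) by (simp add: one_pos_def)
qed

text \<open>A cubic form is given by its symmetric tensor \<open>t\<close>. Two derivatives \<open>t i\<close>, \<open>t j\<close> have a common
  image vector (\<open>t i j\<close> itself, or proportional vectors \<open>t i k\<close>, \<open>t j k\<close>), so both are
  nonpositive on the same hyperplane.\<close>

lemma one_pos_tensor_contract:
  fixes t :: "'v \<Rightarrow> 'v \<Rightarrow> 'v \<Rightarrow> real"
  assumes fin: "finite V" and nn: "\<And>i j k. t i j k \<ge> 0"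
    and sym1: "\<And>i j k. t i j k = t j i k" and sym2: "\<And>i j k. t i j k = t i k j"
    and lz: "\<And>i. i \<in> V \<Longrightarrow> one_pos V (t i)"
    and exch: "\<And>i j k l k' l'. \<lbrakk>{i, j, k, l, k', l'} \<subseteq> V; t i k l \<noteq> 0; t j k' l' \<noteq> 0\<rbrakk> \<Longrightarrow>
      (\<exists>m\<in>V. t i j m \<noteq> 0) \<or> (\<exists>k\<in>V. \<exists>m\<in>V. \<exists>m'\<in>V. t i k m \<noteq> 0 \<and> t j k m' \<noteq> 0)"
    and c: "\<And>i. c i \<ge> 0" and "I \<subseteq> V"
  shows "one_pos V (\<lambda>j k. \<Sum>i\<in>I. c i * t i j k)"
proof -
  have "finite I" using \<open>I \<subseteq> V\<close> fin finite_subset by blast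
  then show ?thesis using \<open>I \<subseteq> V\<close>
  proof (induction I rule: finite_induct)
    case empty
    show ?case by (simp add: one_pos_def bform_def)
  next
    case (insert l I)
    define A where "A j k = (\<Sum>i\<in>I. c i * t i j k)" for j k
    have A: "one_pos V A" using insert by (simp add: A_def[abs_def])
    have I: "I \<subseteq> V" and l: "l \<in> V" using insert by auto
    have eq: "(\<lambda>j k. \<Sum>i\<in>insert l I. c i * t i j k) = (\<lambda>j k. A j k + c l * t l j k)"
      using insert by (auto simp: A_def fun_eq_iff)
    have Asym: "A j k = A k j" for j k unfolding A_def by (subst sym2) (rule refl)
    have Ann: "A j k \<ge> 0" for j k using c nn by (auto simp: A_def intro!: sum_nonneg)
    have tsym: "t i j k = t i k j" for i j k by (rule sym2)
    have trot: "t i j k * x = x * t k i j" for i j k x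
      by (simp only: sym2[of i j k] sym1[of i k j] mult.commute)
    \<comment> \<open>If one of the two summands is zero on \<open>V\<close>, the other one decides
      alone; only the third case needs a common hyperplane.\<close>
    consider "\<forall>j\<in>V. \<forall>k\<in>V. A j k = 0" | "c l = 0 \<or> (\<forall>j\<in>V. \<forall>k\<in>V. t l j k = 0)"
      | k m k' m' where "k \<in> V" "m \<in> V" "A k m \<noteq> 0" "c l \<noteq> 0" "k' \<in> V" "m' \<in> V" "t l k' m' \<noteq> 0"
      by blast
    then show ?case
    proof cases
      case 1
      show ?thesis unfolding eq using one_pos_scale[OF lz[OF l] c[of l]]
        by (rule one_pos_cong) (use 1 in auto)
    next
      case 2
      show ?thesis unfolding eq using A by (rule one_pos_cong) (use 2 in auto)
    next
      case (3 k m k' m')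
      from 3(3) obtain i where i: "i \<in> I" "c i * t i k m \<noteq> 0"
        unfolding A_def by (meson sum.neutral)
      \<comment> \<open>By \<open>tx\<close>, contracting \<open>t r\<close> with \<open>x\<close>
        gives row \<open>r\<close> of \<open>A\<close>. In particular the images of \<open>x\<close>
        under \<open>t l\<close> and of \<open>e l\<close> under \<open>A\<close> are the same
        vector, the common normal in the case that it is nonzero.\<close>
      define x where "x j = (if j \<in> I then c j else 0)" for j
      define e where "e r j = (if j = r then 1 else 0 :: real)" for r j :: 'v
      have x0: "x j \<ge> 0" and e0: "e r j \<ge> 0" for r j using c by (auto simp: x_def e_def)
      have Ae: "(\<Sum>j\<in>V. B s j * e r j) = B s r" if "r \<in> V" for B s r
      proof -
        have "(\<Sum>j\<in>V. B s j * e r j) = (\<Sum>j\<in>V. if j = r then B s r else 0)"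
          by (rule sum.cong) (auto simp: e_def)
        then show ?thesis using that fin by simp
      qed
      have tx: "(\<Sum>j\<in>V. t r s j * x j) = A r s" for r s
      proof -
        have "(\<Sum>j\<in>V. t r s j * x j) = (\<Sum>j\<in>V. if j \<in> I then c j * t j r s else 0)"
          by (rule sum.cong) (simp_all add: x_def trot[of r s])
        also have "\<dots> = (\<Sum>j\<in>I. c j * t j r s)"
          using I fin by (simp add: sum.If_cases Int_absorb1)
        finally show ?thesis by (simp add: A_def)
      qed
      have Apos: "A r s \<noteq> 0" if "t i r s \<noteq> 0" for r s
      proof -
        have "0 < c i * t i r s" using that i c[of i] nn[of i r s] by (simp add: less_le)
        also have "\<dots> \<le> A r s" unfolding A_def
          using insert(1) i c nn by (intro member_le_sum) auto
        finally show ?thesis by simp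
      qed
      have sum_nonpos: "bform V (\<lambda>j k. A j k + c l * t l j k) v v \<le> 0"
        if "bform V A v v \<le> 0" "bform V (t l) v v \<le> 0" for v
        using that c[of l] by (simp add: bform_add_matrix add_nonpos_nonpos mult_nonneg_nonpos)
      show ?thesis
      proof (cases "\<exists>m\<in>V. A l m \<noteq> 0")
        case True
        then obtain r where r: "r \<in> V" "A r l \<noteq> 0" using Asym by metis
        show ?thesis unfolding eq
        proof (rule one_pos_if_nonpos_on_orthogonal[where B = A and w = "e l"], rule sum_nonpos)
          fix v assume v: "bform V A v (e l) = 0"
          show "bform V A v v \<le> 0"
            using one_pos_orthogonal_nonpos[of V A, OF fin Asym Ann A e0 r(1) _ v] Ae[OF l, of A r] r by simp
          have "bform V (t l) v x = bform V A v (e l)"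
            unfolding bform_eq_functional tx Ae[OF l] by (simp add: Asym)
          then show "bform V (t l) v v \<le> 0"
            using one_pos_orthogonal_nonpos[of V "t l" x r v, OF fin tsym nn lz[OF l] x0 r(1)] tx Asym r v by simp
        qed
      next
        case False
        have "t i l r = 0" if "r \<in> V" for r using Apos[of l r] False that by blast
        moreover have "{i, l, k, m, k', m'} \<subseteq> V" using 3 i I l by auto
        ultimately obtain s r r' where s: "s \<in> V" "r \<in> V" "r' \<in> V" "t i s r \<noteq> 0" "t l s r' \<noteq> 0"
          using exch[of i l k m k' m'] 3 i by auto
        have r: "A r s \<noteq> 0" using Apos s Asym by metis
        \<comment> \<open>Row \<open>l\<close> of \<open>A\<close> is zero here, so \<open>x\<close>
          and \<open>e l\<close> are orthogonal for the form \<open>t s\<close>. The functional of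
          \<open>e l\<close> therefore vanishes wherever that of \<open>x\<close> does, and the
          latter is row \<open>s\<close> of \<open>A\<close>: this row is the new common
          normal.\<close>
        have par: "bform V (t s) v (e l) = 0" if "bform V (t s) v x = 0" for v
        proof (rule one_pos_isotropic_parallel[of V "t s", OF fin tsym nn lz[OF s(1)] x0 e0 s(2) _ _ that])
          show "(\<Sum>j\<in>V. t s r j * x j) \<noteq> 0" using tx r Asym by metis
          have "bform V (t s) x (e l) = bform V (t s) (e l) x" by (rule bform_commute[of "t s", OF tsym])
          also have "\<dots> = (\<Sum>j\<in>V. A s j * e l j)" unfolding bform_eq_functional tx ..
          also have "\<dots> = 0" using Ae[OF l, of A s] False s(1) Asym[of s l] by simp
          finally show "bform V (t s) x (e l) = 0" .
        qed
        show ?thesis unfolding eq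
        proof (rule one_pos_if_nonpos_on_orthogonal[where B = A and w = "e s"], rule sum_nonpos)
          fix v assume v: "bform V A v (e s) = 0"
          show "bform V A v v \<le> 0"
            using one_pos_orthogonal_nonpos[of V A, OF fin Asym Ann A e0 s(2) _ v] Ae[OF s(1), of A r] r by simp
          have "bform V (t s) v x = bform V A v (e s)"
            unfolding bform_eq_functional tx Ae[OF s(1)] by (simp add: Asym)
          then have "bform V (t s) v (e l) = 0" using v par by simp
          moreover have "bform V (t l) v (e s) = bform V (t s) v (e l)"
            unfolding bform_eq_functional Ae[OF l] Ae[OF s(1)]
            by (rule sum.cong) (simp_all only: sym1[of l _ s] sym2[of _ l s] sym1[of _ s l])
          ultimately show "bform V (t l) v v \<le> 0"
            using one_pos_orthogonal_nonpos[of V "t l" "e s" r' v, OF fin tsym nn lz[OF l] e0 s(3)]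
              Ae[OF s(1), of "t l" r'] s(5) sym2[of l s r'] by simp
        qed
      qed
    qed
  qed
qed

section \<open>Lorentzian functions on multisets\<close>

definition M_exchange :: "('v multiset \<Rightarrow> real) \<Rightarrow> bool" where
  "M_exchange F \<longleftrightarrow> (\<forall>\<alpha> \<beta> i. F \<alpha> \<noteq> 0 \<longrightarrow> F \<beta> \<noteq> 0 \<longrightarrow> count \<beta> i < count \<alpha> i \<longrightarrow>
     (\<exists>j. count \<alpha> j < count \<beta> j \<and> F (add_mset j (\<alpha> - {#i#})) \<noteq> 0))"

text \<open>A homogeneous polynomial \<open>f\<close> of degree \<open>d\<close> in the variables \<open>V\<close> is encoded by the function
  \<open>F \<alpha> = \<partial>\<^sup>\<alpha> f\<close> on multisets of variables of size \<open>d\<close>; then \<open>\<partial>\<^sub>i\<close> is \<open>F \<mapsto> F \<circ> add_mset i\<close>.\<close>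

definition lor :: "'v set \<Rightarrow> nat \<Rightarrow> ('v multiset \<Rightarrow> real) \<Rightarrow> bool" where
  "lor V d F \<longleftrightarrow> (\<forall>\<alpha>. F \<alpha> \<ge> 0) \<and> (\<forall>\<alpha>. F \<alpha> \<noteq> 0 \<longrightarrow> size \<alpha> = d \<and> set_mset \<alpha> \<subseteq> V) \<and>
     M_exchange F \<and> (\<forall>\<gamma>. size \<gamma> + 2 = d \<longrightarrow> one_pos V (\<lambda>i j. F (\<gamma> + {#i, j#})))"

definition dir_deriv :: "'v set \<Rightarrow> ('v \<Rightarrow> real) \<Rightarrow> ('v multiset \<Rightarrow> real) \<Rightarrow> 'v multiset \<Rightarrow> real" where
  "dir_deriv V w F \<alpha> = (\<Sum>i\<in>V. w i * F (add_mset i \<alpha>))"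

lemma M_exchangeD:
  assumes "M_exchange F" "F \<alpha> \<noteq> 0" "F \<beta> \<noteq> 0" "count \<beta> i < count \<alpha> i"
  obtains j where "count \<alpha> j < count \<beta> j" "F (add_mset j (\<alpha> - {#i#})) \<noteq> 0"
  using assms unfolding M_exchange_def by blast

section \<open>Directional derivatives along nonnegative vectors\<close>

lemma dir_deriv_nonzero_iff:
  assumes "finite V" "\<And>\<alpha>. F \<alpha> \<ge> 0" "\<And>i. w i \<ge> 0"
  shows "dir_deriv V w F \<alpha> \<noteq> 0 \<longleftrightarrow> (\<exists>i\<in>V. w i \<noteq> 0 \<and> F (add_mset i \<alpha>) \<noteq> 0)"
  unfolding dir_deriv_def using assms
  by (subst sum_nonneg_eq_0_iff) auto

text \<open>The two multisets are lifted to \<open>add_mset s \<alpha>\<close> and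
  \<open>add_mset t \<beta>\<close> in the support of \<open>F\<close> and exchanged there; a result
  that still contains \<open>s\<close> or \<open>t\<close> can be differentiated back
  (\<open>D\<close>). The exchange goes astray only through \<open>t\<close>, as the incoming
  element or as the element \<open>k\<close> to be removed. Then either \<open>s\<close> itself can
  come in, or an exchange that removes \<open>s\<close> repairs the matter.\<close>

lemma M_exchange_dir_deriv:
  assumes fin: "finite V" and nn: "\<And>\<alpha>. F \<alpha> \<ge> 0" and w: "\<And>i. w i \<ge> 0" and M: "M_exchange F"
  shows "M_exchange (dir_deriv V w F)"
  unfolding M_exchange_def
proof (intro allI impI)
  fix \<alpha> \<beta> k
  assume "dir_deriv V w F \<alpha> \<noteq> 0" "dir_deriv V w F \<beta> \<noteq> 0" and k: "count \<beta> k < count \<alpha> k"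
  then obtain s t where s: "s \<in> V" "w s \<noteq> 0" "F (add_mset s \<alpha>) \<noteq> 0"
    and t: "t \<in> V" "w t \<noteq> 0" "F (add_mset t \<beta>) \<noteq> 0"
    using dir_deriv_nonzero_iff[of V F w, OF fin nn w] by metis
  have kin: "k \<in># \<alpha>" using k by (metis count_greater_zero_iff gr_zeroI not_less_zero)
  have D: "dir_deriv V w F \<gamma> \<noteq> 0" if "F (add_mset r \<gamma>) \<noteq> 0" "r = s \<or> r = t" for r \<gamma>
    using that s t dir_deriv_nonzero_iff[of V F w, OF fin nn w] by metis
  have sw: "add_mset j (add_mset r \<alpha> - {#k#}) = add_mset r (add_mset j (\<alpha> - {#k#}))" for j r
    using kin by (simp add: multi_member_split add_mset_commute)
  show "\<exists>j. count \<alpha> j < count \<beta> j \<and> dir_deriv V w F (add_mset j (\<alpha> - {#k#})) \<noteq> 0"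
  proof (cases "count (add_mset t \<beta>) k < count (add_mset s \<alpha>) k")
    case True
    obtain j where j: "count (add_mset s \<alpha>) j < count (add_mset t \<beta>) j"
      "F (add_mset j (add_mset s \<alpha> - {#k#})) \<noteq> 0"
      using M_exchangeD[OF M s(3) t(3) True] .
    have Fj: "F (add_mset s (add_mset j (\<alpha> - {#k#}))) \<noteq> 0" using j(2) sw by simp
    show ?thesis
    proof (cases "count \<alpha> j < count \<beta> j")
      case True
      then show ?thesis using D[OF Fj] by blast
    next
      case False
      then have jt: "j = t" "s \<noteq> t" "count \<alpha> t = count \<beta> t"
        using j(1) by (auto split: if_splits)
      then have kt: "k \<noteq> t" using k by auto
      have Ft: "F (add_mset t (add_mset s (\<alpha> - {#k#}))) \<noteq> 0" using Fj jt by (simp add: add_mset_commute)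
      show ?thesis
      proof (cases "count \<alpha> s < count \<beta> s")
        case True
        then show ?thesis using D[OF Ft] by blast
      next
        case False
        \<comment> \<open>The exchange brought in \<open>t\<close>, of which \<open>\<alpha>\<close>
          has no deficit. As \<open>\<mu>\<close> contains both \<open>s\<close> and
          \<open>t\<close>, trading its \<open>s\<close> for some \<open>m\<close> leaves
          \<open>t\<close> as the variable of differentiation.\<close>
        define \<mu> where "\<mu> = add_mset t (add_mset s (\<alpha> - {#k#}))"
        have "count (add_mset t \<beta>) s < count \<mu> s"
          using False jt k kin by (auto simp: \<mu>_def)
        then obtain m where m: "count \<mu> m < count (add_mset t \<beta>) m" "F (add_mset m (\<mu> - {#s#})) \<noteq> 0"
          using M_exchangeD[OF M _ t(3), of \<mu> s] Ft by (auto simp: \<mu>_def)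
        have "\<mu> - {#s#} = add_mset t (\<alpha> - {#k#})" by (simp add: \<mu>_def add_mset_commute[of t s])
        then have "F (add_mset t (add_mset m (\<alpha> - {#k#}))) \<noteq> 0"
          using m(2) by (simp add: add_mset_commute)
        moreover have "count \<alpha> m < count \<beta> m"
          using m(1) jt k kt kin by (auto simp: \<mu>_def split: if_splits)
        ultimately show ?thesis using D by blast
      qed
    qed
  next
    case False
    then have kt: "k = t" "s \<noteq> t" "count \<alpha> t = Suc (count \<beta> t)" using k by (auto split: if_splits)
    \<comment> \<open>The added \<open>t\<close> makes up the excess of \<open>\<alpha>\<close> over
      \<open>\<beta>\<close> in \<open>k = t\<close>, so the lifts do not allow an exchange that
      removes \<open>k\<close>. Instead one \<open>t\<close> of \<open>\<alpha>\<close> itself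
      becomes the variable of differentiation.\<close>
    have \<alpha>t: "add_mset t (\<alpha> - {#t#}) = \<alpha>" using kin kt by simp
    show ?thesis
    proof (cases "count \<alpha> s < count \<beta> s")
      case True
      have "F (add_mset t (add_mset s (\<alpha> - {#t#}))) \<noteq> 0"
        using s(3) \<alpha>t by (simp add: add_mset_commute[of t s])
      then show ?thesis using D True kt by blast
    next
      case False
      then have "count (add_mset t \<beta>) s < count (add_mset s \<alpha>) s" using kt by auto
      then obtain m where m: "count (add_mset s \<alpha>) m < count (add_mset t \<beta>) m"
        "F (add_mset m (add_mset s \<alpha> - {#s#})) \<noteq> 0"
        using M_exchangeD[OF M s(3) t(3)] by blast
      have "F (add_mset t (add_mset m (\<alpha> - {#t#}))) \<noteq> 0"
        using m(2) \<alpha>t by (simp add: add_mset_commute[of t m])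
      moreover have "count \<alpha> m < count \<beta> m" using m(1) kt by (auto split: if_splits)
      ultimately show ?thesis using D kt by blast
    qed
  qed
qed

text \<open>For fixed \<open>\<gamma>\<close> the values \<open>F (\<gamma> + {#i, j, k#})\<close>
  form a symmetric tensor whose slices are quadratic forms of \<open>F\<close>; contracting it with
  \<open>w\<close> gives the quadratic form of the derivative. The exchange property of
  \<open>F\<close> supplies the hypothesis \<open>exch\<close> of
  \<open>one_pos_tensor_contract\<close>.\<close>

lemma lor_dir_deriv:
  assumes fin: "finite V" and F: "lor V (Suc d) F" and w: "\<And>i. w i \<ge> 0"
  shows "lor V d (dir_deriv V w F)"
proof -
  have nn: "\<And>\<alpha>. F \<alpha> \<ge> 0" and supp: "\<And>\<alpha>. F \<alpha> \<noteq> 0 \<Longrightarrow> size \<alpha> = Suc d \<and> set_mset \<alpha> \<subseteq> V"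
    and M: "M_exchange F" and lz: "\<And>\<gamma>. size \<gamma> + 2 = Suc d \<Longrightarrow> one_pos V (\<lambda>i j. F (\<gamma> + {#i, j#}))"
    using F by (auto simp: lor_def)
  have "one_pos V (\<lambda>j k. dir_deriv V w F (\<gamma> + {#j, k#}))" if \<gamma>: "size \<gamma> + 2 = d" for \<gamma>
  proof -
    define t where "t i j k = F (\<gamma> + {#i, j, k#})" for i j k
    have ts1: "t i j k = t j i k" and ts2: "t i j k = t i k j" for i j k
      by (simp_all add: t_def add_mset_commute)
    have ti: "one_pos V (t i)" for i
    proof -
      have "size (add_mset i \<gamma>) + 2 = Suc d" using \<gamma> by simp
      from lz[OF this] show ?thesis by (rule one_pos_cong) (simp add: t_def add_mset_commute)
    qed
    have exch: "(\<exists>m\<in>V. t i j m \<noteq> 0) \<or> (\<exists>k\<in>V. \<exists>m\<in>V. \<exists>m'\<in>V. t i k m \<noteq> 0 \<and> t j k m' \<noteq> 0)"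
      if V: "{i, j, k, l, k', l'} \<subseteq> V" and ikl: "t i k l \<noteq> 0" and jkl: "t j k' l' \<noteq> 0" for i j k l k' l'
    proof -
      have jkl': "t j l' k' \<noteq> 0" using jkl ts2 by metis
      show ?thesis
      proof (cases "k \<in> {j, k', l'}")
        case True
        then show ?thesis using V ikl jkl jkl' by auto
      next
        case False
        \<comment> \<open>Exchanging \<open>k\<close> out of the first multiset brings in one of
          \<open>j\<close>, \<open>k'\<close>, \<open>l'\<close>. If it is \<open>j\<close>, the
          first alternative holds; otherwise the two supports share an index.\<close>
        then have "count (\<gamma> + {#j, k', l'#}) k < count (\<gamma> + {#i, k, l#}) k" by auto
        then obtain m where m: "count (\<gamma> + {#i, k, l#}) m < count (\<gamma> + {#j, k', l'#}) m"
          "F (add_mset m (\<gamma> + {#i, k, l#} - {#k#})) \<noteq> 0"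
          using M_exchangeD[OF M] ikl jkl unfolding t_def by blast
        have "\<gamma> + {#i, k, l#} - {#k#} = \<gamma> + {#i, l#}" by (simp add: add_mset_commute[of i k])
        then have il: "t i m l \<noteq> 0" using m(2) by (simp add: t_def add_mset_commute[of m])
        have "m \<in> {j, k', l'}" using m(1) by (auto split: if_splits)
        then show ?thesis using V il jkl jkl' by auto
      qed
    qed
    have "one_pos V (\<lambda>j k. \<Sum>i\<in>V. w i * t i j k)"
    proof (rule one_pos_tensor_contract[of V t])
      show "finite V" by (rule fin)
      show "t i j k \<ge> 0" "t i j k = t j i k" "t i j k = t i k j" for i j k
        by (simp add: t_def nn) (rule ts1 ts2)+
      show "one_pos V (t i)" for i by (rule ti)
    qed (erule (2) exch, rule w, rule order_refl)
    then show ?thesis by (rule one_pos_cong) (simp add: t_def dir_deriv_def)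
  qed
  moreover have "size \<alpha> = d \<and> set_mset \<alpha> \<subseteq> V" if nz: "dir_deriv V w F \<alpha> \<noteq> 0" for \<alpha>
  proof -
    obtain i where "F (add_mset i \<alpha>) \<noteq> 0"
      using dir_deriv_nonzero_iff[of V F w, OF fin nn w] nz by metis
    from supp[OF this] show ?thesis by auto
  qed
  moreover have "dir_deriv V w F \<alpha> \<ge> 0" for \<alpha>
    unfolding dir_deriv_def by (intro sum_nonneg mult_nonneg_nonneg nn w)
  ultimately show ?thesis
    using M_exchange_dir_deriv[of V F w, OF fin nn w M] by (auto simp: lor_def)
qed

lemma lor_dir_deriv_pow:
  assumes "finite V" "lor V (n + d) F" "\<And>i. w i \<ge> 0"
  shows "lor V d ((dir_deriv V w ^^ n) F)"
  using assms(2)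
proof (induction n arbitrary: d)
  case (Suc n)
  then have "lor V (Suc d) ((dir_deriv V w ^^ n) F)" by simp
  then show ?case using lor_dir_deriv[OF assms(1) _ assms(3)] by simp
qed simp

text \<open>The product of two polynomials in disjoint sets of variables \<open>{v. q v}\<close> and \<open>{v. \<not> q v}\<close>.\<close>

definition tensor :: "('v \<Rightarrow> bool) \<Rightarrow> ('v multiset \<Rightarrow> real) \<Rightarrow> ('v multiset \<Rightarrow> real) \<Rightarrow> 'v multiset \<Rightarrow> real" where
  "tensor q F G \<alpha> = F (filter_mset q \<alpha>) * G (filter_mset (\<lambda>v. \<not> q v) \<alpha>)"

text \<open>The rank-two part is twice a product of the linear forms \<open>f\<close> and
  \<open>g\<close>, so it vanishes on the kernel of \<open>f\<close>; the subtracted diagonal only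
  lowers the form.\<close>

lemma one_pos_rank_two_minus_diagonal:
  assumes "finite V" and A: "\<And>i j. A i j = f i * g j + g i * f j - (if j = i then h i else 0)"
    and h: "\<And>i. h i \<ge> 0"
  shows "one_pos V A"
  unfolding one_pos_def
proof (intro exI allI impI)
  fix v assume 0: "(\<Sum>i\<in>V. f i * v i) = 0"
  have "A i j * v i * v j = (f i * v i) * (g j * v j) + (g i * v i) * (f j * v j) -
      (if j = i then h i * (v i)\<^sup>2 else 0)" for i j
    by (simp add: A algebra_simps power2_eq_square)
  then have "bform V A v v = (\<Sum>i\<in>V. f i * v i) * (\<Sum>j\<in>V. g j * v j) +
      (\<Sum>i\<in>V. g i * v i) * (\<Sum>j\<in>V. f j * v j) - (\<Sum>i\<in>V. h i * (v i)\<^sup>2)"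
    using \<open>finite V\<close> by (simp add: bform_def sum_product sum.distrib sum_subtractf)
  moreover have "(\<Sum>i\<in>V. h i * (v i)\<^sup>2) \<ge> 0" by (simp add: sum_nonneg h)
  ultimately show "bform V A v v \<le> 0" using 0 by simp
qed

lemma M_exchange_tensor:
  assumes F: "M_exchange F" "\<And>\<alpha>. F \<alpha> \<noteq> 0 \<Longrightarrow> set_mset \<alpha> \<subseteq> Collect q"
    and G: "M_exchange G" "\<And>\<alpha>. G \<alpha> \<noteq> 0 \<Longrightarrow> set_mset \<alpha> \<inter> Collect q = {}"
  shows "M_exchange (tensor q F G)"
  unfolding M_exchange_def
proof (intro allI impI)
  fix \<alpha> \<beta> i
  let ?p = "filter_mset q" and ?n = "filter_mset (\<lambda>v. \<not> q v)"
  assume "tensor q F G \<alpha> \<noteq> 0" "tensor q F G \<beta> \<noteq> 0" and i: "count \<beta> i < count \<alpha> i"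
  then have a: "F (?p \<alpha>) \<noteq> 0" "G (?n \<alpha>) \<noteq> 0" and b: "F (?p \<beta>) \<noteq> 0" "G (?n \<beta>) \<noteq> 0"
    by (auto simp: tensor_def)
  show "\<exists>j. count \<alpha> j < count \<beta> j \<and> tensor q F G (add_mset j (\<alpha> - {#i#})) \<noteq> 0"
  proof (cases "q i")
    case True
    then have "count (?p \<beta>) i < count (?p \<alpha>) i" using i by simp
    then obtain j where j: "count (?p \<alpha>) j < count (?p \<beta>) j" "F (add_mset j (?p \<alpha> - {#i#})) \<noteq> 0"
      using M_exchangeD[OF F(1) a(1) b(1)] by blast
    have "q j" using F(2)[OF j(2)] by auto
    then have "tensor q F G (add_mset j (\<alpha> - {#i#})) \<noteq> 0" using True j a by (simp add: tensor_def)
    then show ?thesis using j \<open>q j\<close> by auto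
  next
    case False
    then have "count (?n \<beta>) i < count (?n \<alpha>) i" using i by simp
    then obtain j where j: "count (?n \<alpha>) j < count (?n \<beta>) j" "G (add_mset j (?n \<alpha> - {#i#})) \<noteq> 0"
      using M_exchangeD[OF G(1) a(2) b(2)] by blast
    have "\<not> q j" using G(2)[OF j(2)] by auto
    then have "tensor q F G (add_mset j (\<alpha> - {#i#})) \<noteq> 0" using False j a by (simp add: tensor_def)
    then show ?thesis using j \<open>\<not> q j\<close> by auto
  qed
qed

text \<open>A quadratic derivative of a product in disjoint variables is zero, a nonnegative
  constant times a quadratic derivative of one factor, or a product of two linear forms. The degree
  of \<open>\<gamma>\<close> in the variables of \<open>q\<close> decides which; the last kind has
  rank at most two.\<close>

lemma lor_tensor:
  assumes fin: "finite V"
    and F: "lor V a F" "\<And>\<alpha>. F \<alpha> \<noteq> 0 \<Longrightarrow> set_mset \<alpha> \<subseteq> Collect q"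
    and G: "lor V b G" "\<And>\<alpha>. G \<alpha> \<noteq> 0 \<Longrightarrow> set_mset \<alpha> \<inter> Collect q = {}"
  shows "lor V (a + b) (tensor q F G)"
proof -
  let ?p = "filter_mset q" and ?n = "filter_mset (\<lambda>v. \<not> q v)"
  have sz: "size \<alpha> = size (?p \<alpha>) + size (?n \<alpha>)" for \<alpha>
    by (metis multiset_partition size_union)
  have st: "set_mset \<alpha> = set_mset (?p \<alpha>) \<union> set_mset (?n \<alpha>)" for \<alpha> by auto
  have Fs: "F \<alpha> \<noteq> 0 \<Longrightarrow> size \<alpha> = a \<and> set_mset \<alpha> \<subseteq> V"
    and Gs: "G \<alpha> \<noteq> 0 \<Longrightarrow> size \<alpha> = b \<and> set_mset \<alpha> \<subseteq> V" for \<alpha>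
    using F(1) G(1) by (simp_all add: lor_def)
  have F0: "F \<alpha> = 0" if "size \<alpha> \<noteq> a \<or> \<not> set_mset \<alpha> \<subseteq> Collect q" for \<alpha> using F that by (auto simp: lor_def)
  have G0: "G \<alpha> = 0" if "size \<alpha> \<noteq> b \<or> set_mset \<alpha> \<inter> Collect q \<noteq> {}" for \<alpha> using G that by (auto simp: lor_def)
  have "one_pos V (\<lambda>i j. tensor q F G (\<gamma> + {#i, j#}))" if \<gamma>: "size \<gamma> + 2 = a + b" for \<gamma>
  proof -
    consider "size (?p \<gamma>) + 2 = a" "size (?n \<gamma>) = b" | "size (?p \<gamma>) = a" "size (?n \<gamma>) + 2 = b"
      | "size (?p \<gamma>) + 1 = a" "size (?n \<gamma>) + 1 = b"
      | "size (?p \<gamma>) \<noteq> a" "size (?p \<gamma>) + 1 \<noteq> a" "size (?p \<gamma>) + 2 \<noteq> a"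
      using \<gamma> sz[of \<gamma>] by linarith
    then show ?thesis
    proof cases
      case 1
      have eq: "tensor q F G (\<gamma> + {#i, j#}) = G (?n \<gamma>) * F (?p \<gamma> + {#i, j#})" for i j
      proof (cases "q i \<and> q j")
        case False
        then have "F (?p (\<gamma> + {#i, j#})) = 0" "F (?p \<gamma> + {#i, j#}) = 0"
          using 1 by (auto intro!: F0)
        then show ?thesis by (simp add: tensor_def)
      qed (auto simp: tensor_def)
      have "one_pos V (\<lambda>i j. F (?p \<gamma> + {#i, j#}))" "G (?n \<gamma>) \<ge> 0" using F G 1 by (auto simp: lor_def)
      from one_pos_scale[OF this] show ?thesis unfolding eq .
    next
      case 2
      have eq: "tensor q F G (\<gamma> + {#i, j#}) = F (?p \<gamma>) * G (?n \<gamma> + {#i, j#})" for i j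
      proof (cases "\<not> q i \<and> \<not> q j")
        case False
        then have "G (?n (\<gamma> + {#i, j#})) = 0" "G (?n \<gamma> + {#i, j#}) = 0"
          using 2 by (auto intro!: G0)
        then show ?thesis by (simp add: tensor_def)
      qed (auto simp: tensor_def)
      have "one_pos V (\<lambda>i j. G (?n \<gamma> + {#i, j#}))" "F (?p \<gamma>) \<ge> 0" using F G 2 by (auto simp: lor_def)
      from one_pos_scale[OF this] show ?thesis unfolding eq .
    next
      case 3
      define f where "f i = (if q i then F (add_mset i (?p \<gamma>)) else 0)" for i
      define g where "g i = (if q i then 0 else G (add_mset i (?n \<gamma>)))" for i
      have "tensor q F G (\<gamma> + {#i, j#}) = f i * g j + g i * f j - (if j = i then 0 else 0)" for i j
        using 3 by (auto simp: tensor_def f_def g_def F0 G0)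
      then show ?thesis by (rule one_pos_rank_two_minus_diagonal[OF fin]) simp
    next
      case 4
      have "tensor q F G (\<gamma> + {#i, j#}) = 0" for i j
        using 4 by (auto simp: tensor_def F0)
      then show ?thesis by (simp add: one_pos_def bform_def)
    qed
  qed
  moreover have "size \<alpha> = a + b \<and> set_mset \<alpha> \<subseteq> V" if "tensor q F G \<alpha> \<noteq> 0" for \<alpha>
  proof -
    have "F (?p \<alpha>) \<noteq> 0" "G (?n \<alpha>) \<noteq> 0" using that by (auto simp: tensor_def)
    then have "size (?p \<alpha>) = a" "set_mset (?p \<alpha>) \<subseteq> V" "size (?n \<alpha>) = b" "set_mset (?n \<alpha>) \<subseteq> V"
      using Fs[of "?p \<alpha>"] Gs[of "?n \<alpha>"] by blast+
    then show ?thesis by (subst sz, subst st) blast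
  qed
  moreover have "M_exchange (tensor q F G)"
  proof (rule M_exchange_tensor[OF _ F(2) _ G(2)])
    show "M_exchange F" "M_exchange G" using F(1) G(1) by (simp_all add: lor_def)
  qed
  ultimately show ?thesis using F(1) G(1) by (auto simp: lor_def tensor_def)
qed

section \<open>The building blocks\<close>

text \<open>It is applied to coefficients divided by binomials, where it is ultra log-concavity of
  order \<open>d\<close> without internal zeros.\<close>

definition log_concave_upto :: "nat \<Rightarrow> (nat \<Rightarrow> real) \<Rightarrow> bool" where
  "log_concave_upto d c \<longleftrightarrow> (\<forall>i. c i \<ge> 0) \<and> (\<forall>i. i > d \<longrightarrow> c i = 0) \<and>
     (\<forall>i. c i * c (i + 2) \<le> (c (i + 1))\<^sup>2) \<and>
     (\<forall>i j k. i \<le> j \<longrightarrow> j \<le> k \<longrightarrow> c i \<noteq> 0 \<longrightarrow> c k \<noteq> 0 \<longrightarrow> c j \<noteq> 0)"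

text \<open>On the line \<open>r * x + s * y = 0\<close>, completing the square leaves
  \<open>(r * t - s\<^sup>2) * y\<^sup>2\<close>, up to the factor \<open>r\<close>; for
  \<open>r = 0\<close> the line \<open>y = 0\<close> serves.\<close>

lemma binary_form_nonpos_on_line:
  fixes r s t :: real
  assumes "r \<ge> 0" "r * t \<le> s\<^sup>2"
  shows "\<exists>m n. \<forall>x y. m * x + n * y = 0 \<longrightarrow> r * x\<^sup>2 + 2 * s * x * y + t * y\<^sup>2 \<le> 0"
proof (cases "r = 0")
  case True
  then show ?thesis by (intro exI[of _ 0] exI[of _ 1]) auto
next
  case False
  then have r: "r > 0" using assms by simp
  show ?thesis
  proof (intro exI allI impI)
    fix x y assume 0: "r * x + s * y = 0"
    have "r * (r * x\<^sup>2 + 2 * s * x * y + t * y\<^sup>2) = (r * x + s * y)\<^sup>2 + (r * t - s\<^sup>2) * y\<^sup>2"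
      by (simp add: power2_eq_square algebra_simps)
    also have "\<dots> \<le> 0" using 0 assms by (simp add: mult_nonpos_nonneg)
    finally show "r * x\<^sup>2 + 2 * s * x * y + t * y\<^sup>2 \<le> 0" using r by (simp add: mult_le_0_iff)
  qed
qed

lemma sum_squares_ge:
  fixes v :: "'a \<Rightarrow> real"
  assumes "finite U"
  shows "(\<Sum>i\<in>U. v i)\<^sup>2 / card U \<le> (\<Sum>i\<in>U. (v i)\<^sup>2)"
proof (cases "card U = 0")
  case False
  define m where "m = (\<Sum>i\<in>U. v i) / card U"
  have "0 \<le> (\<Sum>i\<in>U. (v i - m)\<^sup>2)" by (simp add: sum_nonneg)
  also have "\<dots> = (\<Sum>i\<in>U. (v i)\<^sup>2) - 2 * m * (\<Sum>i\<in>U. v i) + card U * m\<^sup>2"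
    by (simp add: power2_diff sum.distrib sum_subtractf sum_distrib_left sum_distrib_right mult_ac)
  also have "\<dots> = (\<Sum>i\<in>U. (v i)\<^sup>2) - (\<Sum>i\<in>U. v i)\<^sup>2 / card U"
    using False by (simp add: m_def power2_eq_square field_simps)
  finally show ?thesis by simp
qed (use assms in \<open>simp add: sum_nonneg\<close>)

text \<open>The zero diagonal subtracts sums of squares over the blocks. Bounding these below by
  \<open>sum_squares_ge\<close> leaves a binary form in the two block sums, whose outer coefficients
  \<open>r\<close> and \<open>t\<close> carry the factors \<open>1 - 1 / card U\<close> and
  \<open>1 - 1 / card U'\<close>; \<open>disc\<close> is its discriminant condition.\<close>

lemma one_pos_two_blocks:
  fixes r s t :: real
  assumes fin: "finite V" and U: "U \<subseteq> V" "U' \<subseteq> V" "U \<inter> U' = {}" and nn: "r \<ge> 0" "t \<ge> 0"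
    and eq: "\<And>i j. \<lbrakk>i \<in> V; j \<in> V\<rbrakk> \<Longrightarrow> A i j =
      (if i = j then 0 else if i \<in> U \<and> j \<in> U then r else if i \<in> U' \<and> j \<in> U' then t
       else if (i \<in> U \<and> j \<in> U') \<or> (i \<in> U' \<and> j \<in> U) then s else 0)"
    and disc: "r * (1 - 1 / card U) * (t * (1 - 1 / card U')) \<le> s\<^sup>2"
  shows "one_pos V A"
proof -
  have finU: "finite U" "finite U'" using U fin finite_subset by blast+
  define x where "x v = (\<Sum>i\<in>U. v i)" for v :: "'a \<Rightarrow> real"
  define y where "y v = (\<Sum>i\<in>U'. v i)" for v :: "'a \<Rightarrow> real"
  define \<chi> where "\<chi> W i = (if i \<in> W then 1 else 0 :: real)" for W and i :: 'a
  have chi: "(\<Sum>i\<in>V. \<chi> W i * f i) = (\<Sum>i\<in>W. f i)" if "W \<subseteq> V" for W f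
  proof -
    have "(\<Sum>i\<in>V. \<chi> W i * f i) = (\<Sum>i\<in>V. if i \<in> W then f i else 0)"
      by (rule sum.cong) (auto simp: \<chi>_def)
    then show ?thesis using that fin by (simp add: sum.If_cases Int_absorb1)
  qed
  have bf: "bform V A v v = r * ((x v)\<^sup>2 - (\<Sum>i\<in>U. (v i)\<^sup>2)) + 2 * s * x v * y v +
      t * ((y v)\<^sup>2 - (\<Sum>i\<in>U'. (v i)\<^sup>2))" for v
  proof -
    have ij: "A i j * v i * v j = r * (\<chi> U i * v i) * (\<chi> U j * v j) +
        s * ((\<chi> U i * v i) * (\<chi> U' j * v j)) + s * ((\<chi> U' i * v i) * (\<chi> U j * v j)) +
        t * (\<chi> U' i * v i) * (\<chi> U' j * v j) -
        (if j = i then r * (\<chi> U i * (v i)\<^sup>2) + t * (\<chi> U' i * (v i)\<^sup>2) else 0)"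
      if "i \<in> V" "j \<in> V" for i j
      using U(3) eq[OF that] by (auto simp: \<chi>_def power2_eq_square)
    have "bform V A v v = (\<Sum>i\<in>V. \<Sum>j\<in>V. r * (\<chi> U i * v i) * (\<chi> U j * v j) +
        s * ((\<chi> U i * v i) * (\<chi> U' j * v j)) + s * ((\<chi> U' i * v i) * (\<chi> U j * v j)) +
        t * (\<chi> U' i * v i) * (\<chi> U' j * v j) -
        (if j = i then r * (\<chi> U i * (v i)\<^sup>2) + t * (\<chi> U' i * (v i)\<^sup>2) else 0))"
      unfolding bform_def by (intro sum.cong refl ij)
    also have "\<dots> = r * x v * x v + s * (x v * y v) + s * (y v * x v) + t * y v * y v -
        (r * (\<Sum>i\<in>U. (v i)\<^sup>2) + t * (\<Sum>i\<in>U'. (v i)\<^sup>2))"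
      using fin by (simp add: sum.distrib sum_subtractf sum_distrib_left[symmetric]
          sum_distrib_right[symmetric] chi U x_def y_def)
    finally show ?thesis by (simp add: algebra_simps power2_eq_square)
  qed
  obtain m n where mn: "\<And>X Y. m * X + n * Y = 0 \<Longrightarrow>
      r * (1 - 1 / card U) * X\<^sup>2 + 2 * s * X * Y + t * (1 - 1 / card U') * Y\<^sup>2 \<le> 0"
  proof -
    have "r * (1 - 1 / card U) \<ge> 0" using nn by (cases "card U = 0") auto
    from binary_form_nonpos_on_line[OF this disc] that show ?thesis by blast
  qed
  show ?thesis unfolding one_pos_def
  proof (intro exI allI impI)
    fix v assume 0: "(\<Sum>i\<in>V. (m * \<chi> U i + n * \<chi> U' i) * v i) = 0"
    have "(\<Sum>i\<in>V. (m * \<chi> U i + n * \<chi> U' i) * v i) = m * x v + n * y v"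
      by (simp add: distrib_right sum.distrib mult.assoc sum_distrib_left[symmetric] chi U x_def y_def)
    then have le: "r * (1 - 1 / card U) * (x v)\<^sup>2 + 2 * s * x v * y v + t * (1 - 1 / card U') * (y v)\<^sup>2 \<le> 0"
      using 0 mn by simp
    have "r * ((x v)\<^sup>2 / card U) \<le> r * (\<Sum>i\<in>U. (v i)\<^sup>2)"
      using sum_squares_ge[OF finU(1), of v] nn by (intro mult_left_mono) (auto simp: x_def)
    moreover have "t * ((y v)\<^sup>2 / card U') \<le> t * (\<Sum>i\<in>U'. (v i)\<^sup>2)"
      using sum_squares_ge[OF finU(2), of v] nn by (intro mult_left_mono) (auto simp: y_def)
    ultimately show "bform V A v v \<le> 0"
      using le unfolding bf by (simp add: algebra_simps)
  qed
qed

text \<open>\<open>X0\<close> and \<open>Y0\<close> are the variables of \<open>p\<close>. The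
  numbered pairs polarise the quadratic substitution into \<open>q\<close>: \<open>x * u\<close> and
  \<open>x + u\<close> become \<open>XA j * XB j\<close> and \<open>XA j + XB j\<close>, and
  likewise for \<open>y\<close>.\<close>

datatype var = X0 | Y0 | XA nat | XB nat | YA nat | YB nat

fun is_base :: "var \<Rightarrow> bool" where
  "is_base X0 = True" | "is_base Y0 = True" | "is_base _ = False"

fun is_x :: "var \<Rightarrow> bool" where
  "is_x (XA _) = True" | "is_x (XB _) = True" | "is_x _ = False"

fun partner :: "var \<Rightarrow> var" where
  "partner (XA j) = XB j" | "partner (XB j) = XA j" | "partner (YA j) = YB j" | "partner (YB j) = YA j"
| "partner v = v"

definition pair_vars :: "nat \<Rightarrow> var set" where
  "pair_vars b = XA ` {..<b} \<union> XB ` {..<b} \<union> YA ` {..<b} \<union> YB ` {..<b}"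

definition all_vars :: "nat \<Rightarrow> var set" where
  "all_vars b = {X0, Y0} \<union> pair_vars b"

text \<open>The derivative of order \<open>i\<close>, \<open>a - i\<close> is the coefficient times
  \<open>i! (a - i)!\<close>, that is \<open>a!\<close> times the coefficient divided by
  \<open>a choose i\<close>. The factor \<open>a!\<close> is left out, so \<open>c\<close> is the
  normalised sequence; it returns as \<open>fact a\<close> in
  \<open>joint_block_derivatives\<close>.\<close>

definition base_block :: "nat \<Rightarrow> (nat \<Rightarrow> real) \<Rightarrow> var multiset \<Rightarrow> real" where
  "base_block a c \<alpha> = (if set_mset \<alpha> \<subseteq> {X0, Y0} \<and> size \<alpha> = a then c (count \<alpha> X0) else 0)"

definition covers :: "nat \<Rightarrow> var set \<Rightarrow> bool" where
  "covers b S \<longleftrightarrow> S \<subseteq> pair_vars b \<and> (\<forall>v\<in>pair_vars b. v \<in> S \<or> partner v \<in> S)"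

text \<open>The polynomial \<open>\<Sum> c\<^sub>|\<^sub>I\<^sub>| / (b choose |I|) \<Prod> \<dots>\<close> over \<open>I, I' \<subseteq> {..<b}\<close> with \<open>|I| + |I'| = b\<close>, where \<open>j\<close> contributes
  \<open>XA j XB j\<close> if \<open>j \<in> I\<close> and \<open>XA j + XB j\<close> otherwise, and likewise \<open>YA j\<close>, \<open>YB j\<close> with \<open>I'\<close>. All \<open>XB j\<close>, \<open>YB j\<close> will be
  identified with \<open>u\<close>, all \<open>XA j\<close> with \<open>x\<close> and all \<open>YA j\<close> with \<open>y\<close>.\<close>

definition pair_block :: "nat \<Rightarrow> (nat \<Rightarrow> real) \<Rightarrow> var multiset \<Rightarrow> real" where
  "pair_block b c \<alpha> = (if covers b (set_mset \<alpha>) \<and> (\<forall>v. count \<alpha> v \<le> 1) \<and> size \<alpha> = 3 * b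
     then c (size (filter_mset is_x \<alpha>) - b) / (b choose (size (filter_mset is_x \<alpha>) - b)) else 0)"

lemma finite_pair_vars [simp]: "finite (pair_vars b)" and finite_all_vars [simp]: "finite (all_vars b)"
  by (simp_all add: pair_vars_def all_vars_def)

lemma size_supported_pair: "set_mset \<alpha> \<subseteq> {x, y} \<Longrightarrow> x \<noteq> y \<Longrightarrow> size \<alpha> = count \<alpha> x + count \<alpha> y"
proof -
  assume *: "set_mset \<alpha> \<subseteq> {x, y}" "x \<noteq> y"
  have "size \<alpha> = sum (count \<alpha>) (set_mset \<alpha>)" by (simp add: size_multiset_overloaded_eq)
  also have "\<dots> = sum (count \<alpha>) {x, y}"
    using * by (intro sum.mono_neutral_left) (auto simp: not_in_iff)
  finally show ?thesis using * by simp
qed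

text \<open>With two variables the exchange property is the absence of internal zeros, and each
  quadratic derivative is a binary form with coefficients \<open>c (n + 2)\<close>,
  \<open>c (n + 1)\<close>, \<open>c n\<close>, whose discriminant condition is
  log-concavity.\<close>

lemma lor_base_block:
  assumes c: "log_concave_upto a c"
  shows "lor (all_vars b) a (base_block a c)"
proof -
  have "M_exchange (base_block a c)" unfolding M_exchange_def
  proof (intro allI impI)
    fix \<alpha> \<beta> i
    assume "base_block a c \<alpha> \<noteq> 0" "base_block a c \<beta> \<noteq> 0" and i: "count \<beta> i < count \<alpha> i"
    then have \<alpha>: "set_mset \<alpha> \<subseteq> {X0, Y0}" "size \<alpha> = a" "c (count \<alpha> X0) \<noteq> 0"
      and \<beta>: "set_mset \<beta> \<subseteq> {X0, Y0}" "size \<beta> = a" "c (count \<beta> X0) \<noteq> 0"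
      by (auto simp: base_block_def split: if_splits)
    have tot: "count \<alpha> X0 + count \<alpha> Y0 = a" "count \<beta> X0 + count \<beta> Y0 = a"
      using size_supported_pair[OF \<alpha>(1)] size_supported_pair[OF \<beta>(1)] \<alpha>(2) \<beta>(2) by simp_all
    have iin: "i \<in># \<alpha>" using i by (metis count_greater_zero_iff gr_zeroI not_less_zero)
    then have "i = X0 \<or> i = Y0" using \<alpha>(1) by auto
    define j where "j = (if i = X0 then Y0 else X0)"
    have "count \<alpha> j < count \<beta> j" using i tot \<open>i = X0 \<or> i = Y0\<close> by (auto simp: j_def)
    moreover have "c (count (add_mset j (\<alpha> - {#i#})) X0) \<noteq> 0"
    proof (cases "i = X0")
      case True
      then have "count \<beta> X0 \<le> count \<alpha> X0 - 1" "count \<alpha> X0 - 1 \<le> count \<alpha> X0" using i by auto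
      then have "c (count \<alpha> X0 - 1) \<noteq> 0"
        using c \<alpha>(3) \<beta>(3) unfolding log_concave_upto_def by blast
      then show ?thesis using True by (simp add: j_def)
    next
      case False
      then have "i = Y0" using \<open>i = X0 \<or> i = Y0\<close> by simp
      then have "count \<alpha> X0 \<le> Suc (count \<alpha> X0)" "Suc (count \<alpha> X0) \<le> count \<beta> X0"
        using i tot by auto
      then have "c (Suc (count \<alpha> X0)) \<noteq> 0"
        using c \<alpha>(3) \<beta>(3) unfolding log_concave_upto_def by blast
      then show ?thesis using \<open>i = Y0\<close> by (simp add: j_def)
    qed
    moreover have "set_mset (add_mset j (\<alpha> - {#i#})) \<subseteq> {X0, Y0}"
      using \<alpha>(1) by (auto simp: j_def dest: in_diffD)
    moreover have "size (add_mset j (\<alpha> - {#i#})) = a"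
      using \<alpha>(2) iin by (metis add_mset_remove_trivial_eq size_add_mset)
    ultimately show "\<exists>j. count \<alpha> j < count \<beta> j \<and> base_block a c (add_mset j (\<alpha> - {#i#})) \<noteq> 0"
      unfolding base_block_def by metis
  qed
  moreover have "one_pos (all_vars b) (\<lambda>i j. base_block a c (\<gamma> + {#i, j#}))" if \<gamma>: "size \<gamma> + 2 = a" for \<gamma>
  proof (cases "set_mset \<gamma> \<subseteq> {X0, Y0}")
    case False
    then have "base_block a c (\<gamma> + {#i, j#}) = 0" for i j by (auto simp: base_block_def)
    then show ?thesis by (simp add: one_pos_def bform_def)
  next
    case True
    define n where "n = count \<gamma> X0"
    have eq: "base_block a c (\<gamma> + {#i, j#}) = (if i = X0 \<and> j = X0 then c (n + 2)
        else if i = Y0 \<and> j = Y0 then c n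
        else if (i = X0 \<and> j = Y0) \<or> (i = Y0 \<and> j = X0) then c (n + 1) else 0)" for i j
      using True \<gamma> by (auto simp: base_block_def n_def)
    have "c (n + 2) \<ge> 0" "c (n + 2) * c n \<le> (c (n + 1))\<^sup>2"
      using c by (auto simp: log_concave_upto_def mult.commute)
    from binary_form_nonpos_on_line[OF this]
    obtain m k where mk: "\<And>x y. m * x + k * y = 0 \<Longrightarrow>
        c (n + 2) * x\<^sup>2 + 2 * c (n + 1) * x * y + c n * y\<^sup>2 \<le> 0" by blast
    have two: "(\<Sum>i\<in>all_vars b. f i) = f X0 + f Y0"
      if "\<And>i. i \<noteq> X0 \<Longrightarrow> i \<noteq> Y0 \<Longrightarrow> f i = 0" for f :: "var \<Rightarrow> real"
    proof -
      have "(\<Sum>i\<in>all_vars b. f i) = (\<Sum>i\<in>{X0, Y0}. f i)"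
        using that by (intro sum.mono_neutral_right) (auto simp: all_vars_def)
      then show ?thesis by simp
    qed
    show ?thesis unfolding one_pos_def
    proof (intro exI allI impI)
      fix v :: "var \<Rightarrow> real"
      assume 0: "(\<Sum>i\<in>all_vars b. (if i = X0 then m else if i = Y0 then k else 0) * v i) = 0"
      have "m * v X0 + k * v Y0 = 0" using 0 by (subst (asm) two) auto
      from mk[OF this] show "bform (all_vars b) (\<lambda>i j. base_block a c (\<gamma> + {#i, j#})) v v \<le> 0"
        unfolding bform_def eq by (subst two, simp)+ (simp add: power2_eq_square algebra_simps)
    qed
  qed
  ultimately show ?thesis using c
    by (auto simp: lor_def base_block_def all_vars_def log_concave_upto_def)
qed

section \<open>Combinatorics and quadratic derivatives of the pair block\<close>

lemma partner_partner [simp]: "partner (partner v) = v"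
  by (cases v) auto

lemma is_x_partner [simp]: "is_x (partner v) = is_x v"
  by (cases v) auto

lemma partner_pair_vars [simp]: "partner v \<in> pair_vars b \<longleftrightarrow> v \<in> pair_vars b"
  by (cases v) (auto simp: pair_vars_def)

lemma partner_neq: "v \<in> pair_vars b \<Longrightarrow> partner v \<noteq> v"
  by (cases v) (auto simp: pair_vars_def)

lemma card_pair_vars_x: "card {v \<in> pair_vars b. is_x v} = 2 * b"
  and card_pair_vars_y: "card {v \<in> pair_vars b. \<not> is_x v} = 2 * b"
proof -
  have "{v \<in> pair_vars b. is_x v} = XA ` {..<b} \<union> XB ` {..<b}" by (auto simp: pair_vars_def)
  moreover have "card \<dots> = 2 * b" by (subst card_Un_disjoint) (auto simp: card_image inj_on_def)
  ultimately show "card {v \<in> pair_vars b. is_x v} = 2 * b" by simp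
  have "{v \<in> pair_vars b. \<not> is_x v} = YA ` {..<b} \<union> YB ` {..<b}" by (auto simp: pair_vars_def)
  moreover have "card \<dots> = 2 * b" by (subst card_Un_disjoint) (auto simp: card_image inj_on_def)
  ultimately show "card {v \<in> pair_vars b. \<not> is_x v} = 2 * b" by simp
qed

lemma mset_set_set_mset_if_count_le_1:
  assumes "\<And>v. count \<alpha> v \<le> 1"
  shows "mset_set (set_mset \<alpha>) = \<alpha>"
proof (rule multiset_eqI)
  fix v show "count (mset_set (set_mset \<alpha>)) v = count \<alpha> v"
  proof (cases "v \<in># \<alpha>")
    case True
    then have "count \<alpha> v = 1" using assms[of v] count_greater_eq_one_iff[of \<alpha> v] by linarith
    then show ?thesis using True by simp
  qed (simp add: not_in_iff)
qed

lemma pair_block_mset_set: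
  assumes "finite S"
  shows "pair_block b c (mset_set S) = (if covers b S \<and> card S = 3 * b
     then c (card {v\<in>S. is_x v} - b) / (b choose (card {v\<in>S. is_x v} - b)) else 0)"
  using assms by (simp add: pair_block_def count_mset_set')

lemma pair_block_nonzeroE:
  assumes "pair_block b c \<alpha> \<noteq> 0"
  obtains S where "\<alpha> = mset_set S" "finite S" "covers b S" "card S = 3 * b" "c (card {v\<in>S. is_x v} - b) \<noteq> 0"
proof -
  have "\<And>v. count \<alpha> v \<le> 1" using assms by (auto simp: pair_block_def split: if_splits)
  then have *: "\<alpha> = mset_set (set_mset \<alpha>)" by (simp add: mset_set_set_mset_if_count_le_1)
  have "pair_block b c (mset_set (set_mset \<alpha>)) \<noteq> 0" using assms * by simp
  then show ?thesis using that[OF *] unfolding pair_block_mset_set[OF finite_set_mset]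
    by (simp split: if_splits)
qed

lemma pair_block_nonzeroD:
  assumes "pair_block b c \<alpha> \<noteq> 0"
  shows "set_mset \<alpha> \<subseteq> pair_vars b" "count \<alpha> v \<le> 1"
  using assms by (auto simp: pair_block_def covers_def split: if_splits)

lemma pair_block_nonzeroI:
  assumes "log_concave_upto b c" "finite S" "covers b S" "card S = 3 * b" "c (card {v\<in>S. is_x v} - b) \<noteq> 0"
  shows "pair_block b c (mset_set S) \<noteq> 0"
proof -
  \<comment> \<open>Beyond \<open>b\<close> the binomial in the denominator would be zero, and with
    it the whole quotient.\<close>
  have "card {v\<in>S. is_x v} - b \<le> b" using assms(1,5) unfolding log_concave_upto_def by (meson not_le)
  then show ?thesis using assms by (simp add: pair_block_mset_set)
qed

text \<open>If \<open>partner i\<close> is not in \<open>S\<close>, it lies in \<open>T\<close> and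
  replaces \<open>i\<close>. Otherwise \<open>S\<close> without \<open>i\<close> still meets every
  pair, and any element of \<open>T - S\<close> may come in as far as covering is concerned. One of
  the same type as \<open>i\<close> keeps the number of x-variables. If there is none,
  \<open>S\<close> has more variables of that type than \<open>T\<close>, so the exchange moves this
  number one step towards that of \<open>T\<close>, and \<open>c\<close> has no internal
  zeros.\<close>

lemma M_exchange_pair_block:
  assumes c: "log_concave_upto b c"
  shows "M_exchange (pair_block b c)"
  unfolding M_exchange_def
proof (intro allI impI)
  fix \<alpha> \<beta> i
  assume "pair_block b c \<alpha> \<noteq> 0" "pair_block b c \<beta> \<noteq> 0" and i: "count \<beta> i < count \<alpha> i"
  then obtain S T where S: "\<alpha> = mset_set S" "finite S" "covers b S" "card S = 3 * b" "c (card {v\<in>S. is_x v} - b) \<noteq> 0"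
    and T: "\<beta> = mset_set T" "finite T" "covers b T" "card T = 3 * b" "c (card {v\<in>T. is_x v} - b) \<noteq> 0"
    by (elim pair_block_nonzeroE)
  have iS: "i \<in> S" "i \<notin> T" using i S(1,2) T(1,2) by (auto simp: count_mset_set' split: if_splits)
  then have iV: "i \<in> pair_vars b" using S(3) by (auto simp: covers_def)
  have red: "\<exists>j. count \<alpha> j < count \<beta> j \<and> pair_block b c (add_mset j (\<alpha> - {#i#})) \<noteq> 0"
    if j: "j \<in> T" "j \<notin> S" "covers b (insert j (S - {i}))" "c (card {v\<in>insert j (S - {i}). is_x v} - b) \<noteq> 0" for j
  proof (intro exI conjI)
    show "count \<alpha> j < count \<beta> j" using j S T by (simp add: count_mset_set')
    have "add_mset j (\<alpha> - {#i#}) = mset_set (insert j (S - {i}))"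
      using S j iS by (simp add: mset_set_Diff)
    moreover have "card (insert j (S - {i})) = 3 * b"
      using S j iS by (simp add: card.insert_remove card_gt_0_iff) (metis Suc_pred card_gt_0_iff empty_iff)
    ultimately show "pair_block b c (add_mset j (\<alpha> - {#i#})) \<noteq> 0"
      using pair_block_nonzeroI[OF c _ j(3) _ j(4)] S by simp
  qed
  have swap: "card {v\<in>insert j (S - {i}). is_x v} = card {v\<in>S. is_x v}" if "is_x j = is_x i" "j \<notin> S" for j
  proof (cases "is_x i")
    case True
    then have "{v\<in>insert j (S - {i}). is_x v} = insert j ({v\<in>S. is_x v} - {i})" using that by auto
    moreover have "card {v\<in>S. is_x v} = Suc (card ({v\<in>S. is_x v} - {i}))"
      using True iS S by (intro card.remove) auto
    ultimately show ?thesis using that S by simp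
  next
    case False
    then have "{v\<in>insert j (S - {i}). is_x v} = {v\<in>S. is_x v}" using that by auto
    then show ?thesis by simp
  qed
  show "\<exists>j. count \<alpha> j < count \<beta> j \<and> pair_block b c (add_mset j (\<alpha> - {#i#})) \<noteq> 0"
  proof (cases "partner i \<in> S")
    case False
    have "partner i \<in> T" using T(3) iV iS by (auto simp: covers_def)
    moreover have "covers b (insert (partner i) (S - {i}))"
      unfolding covers_def
    proof (intro conjI ballI)
      show "insert (partner i) (S - {i}) \<subseteq> pair_vars b" using S(3) iV by (auto simp: covers_def)
      fix v assume "v \<in> pair_vars b"
      then have "v \<in> S \<or> partner v \<in> S" using S(3) by (simp add: covers_def)
      moreover have "partner v = i \<Longrightarrow> v = partner i" by auto
      ultimately show "v \<in> insert (partner i) (S - {i}) \<or> partner v \<in> insert (partner i) (S - {i})" by blast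
    qed
    ultimately show ?thesis using red[of "partner i"] False swap[of "partner i"] S(5) by simp
  next
    case True
    have cov: "covers b (insert j (S - {i}))" if "j \<in> T" for j
      unfolding covers_def
    proof (intro conjI ballI)
      show "insert j (S - {i}) \<subseteq> pair_vars b" using S(3) T(3) that by (auto simp: covers_def)
      fix v assume "v \<in> pair_vars b"
      then have "v \<in> S \<or> partner v \<in> S" using S(3) by (simp add: covers_def)
      moreover have "partner v = i \<Longrightarrow> v = partner i" by auto
      ultimately show "v \<in> insert j (S - {i}) \<or> partner v \<in> insert j (S - {i})"
        using True partner_neq[OF iV] by (metis Diff_iff insertCI singletonD)
    qed
    show ?thesis
    proof (cases "\<exists>j\<in>T - S. is_x j = is_x i")
      case True
      then obtain j where j: "j \<in> T" "j \<notin> S" "is_x j = is_x i" by blast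
      show ?thesis using red[OF j(1,2) cov[OF j(1)]] swap[OF j(3,2)] S(5) by simp
    next
      case False
      have "\<not> T \<subseteq> S" using card_subset_eq[OF S(2), of T] S(4) T(4) iS by auto
      then obtain j where j: "j \<in> T" "j \<notin> S" by auto
      have jx: "is_x j \<noteq> is_x i" using False j by auto
      have "{v\<in>T. is_x v = is_x i} \<subset> {v\<in>S. is_x v = is_x i}" using False iS by auto
      then have less: "card {v\<in>T. is_x v = is_x i} < card {v\<in>S. is_x v = is_x i}"
        using S(2) by (intro psubset_card_mono) auto
      have split: "card {v\<in>W. is_x v} + card {v\<in>W. \<not> is_x v} = card W" if "finite W" for W
        using that by (subst card_Un_disjoint[symmetric]) (auto intro!: arg_cong[where f = card])
      have "c (card {v\<in>insert j (S - {i}). is_x v} - b) \<noteq> 0"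
      proof (cases "is_x i")
        case True
        then have "{v\<in>insert j (S - {i}). is_x v} = {v\<in>S. is_x v} - {i}" using jx by auto
        then have "card {v\<in>insert j (S - {i}). is_x v} = card {v\<in>S. is_x v} - 1"
          using True iS S(2) by simp
        then have "card {v\<in>T. is_x v} - b \<le> card {v\<in>insert j (S - {i}). is_x v} - b"
          "card {v\<in>insert j (S - {i}). is_x v} - b \<le> card {v\<in>S. is_x v} - b" using less True by auto
        then show ?thesis using c S(5) T(5) unfolding log_concave_upto_def by blast
      next
        case False
        then have "{v\<in>insert j (S - {i}). is_x v} = insert j {v\<in>S. is_x v}" using jx by auto
        then have "card {v\<in>insert j (S - {i}). is_x v} = card {v\<in>S. is_x v} + 1"
          using j S(2) by simp
        moreover have "card {v\<in>S. is_x v} < card {v\<in>T. is_x v}"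
          using less False split[OF S(2)] split[OF T(2)] S(4) T(4) by simp
        ultimately have "card {v\<in>S. is_x v} - b \<le> card {v\<in>insert j (S - {i}). is_x v} - b"
          "card {v\<in>insert j (S - {i}). is_x v} - b \<le> card {v\<in>T. is_x v} - b" by auto
        then show ?thesis using c S(5) T(5) unfolding log_concave_upto_def by blast
      qed
      then show ?thesis using red[OF j cov[OF j(1)]] by simp
    qed
  qed
qed

text \<open>The factors \<open>1 - 1 / n\<close> come from \<open>one_pos_two_blocks\<close>. With
  \<open>K\<close> the middle binomial and \<open>m = b - s\<close>, the outer binomials are
  \<open>(s + 1) * K / m\<close> and \<open>(m - 1) * K / (s + 2)\<close>. Their product is
  \<open>K\<^sup>2\<close> times exactly these factors, so everything cancels down to log-concavity
  of \<open>c\<close>; the division by a binomial in \<open>pair_block\<close> is made for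
  this.\<close>

lemma normalized_log_concave:
  assumes c: "log_concave_upto b c"
  shows "c (s + 2) / (b choose (s + 2)) * (1 - 1 / real (b - s)) * (c s / (b choose s) * (1 - 1 / real (s + 2)))
     \<le> (c (s + 1) / (b choose (s + 1)))\<^sup>2"
proof (cases "s + 2 \<le> b")
  case False
  then have "c (s + 2) = 0" using c by (auto simp: log_concave_upto_def)
  then show ?thesis by simp
next
  case True
  define K where "K = real (b choose (s + 1))"
  define m where "m = real (b - s)"
  have K: "K > 0" using True by (simp add: K_def)
  have m: "m \<ge> 2" using True by (simp add: m_def)
  have absorb: "Suc k * (b choose Suc k) = (b - k) * (b choose k)" for k
    by (simp only: binomial_absorption binomial_absorb_comp)
  have 1: "real (s + 1) * K = m * real (b choose s)"
    using absorb[of s] unfolding K_def m_def of_nat_mult[symmetric] by simp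
  have 2: "real (s + 2) * real (b choose (s + 2)) = (m - 1) * K"
  proof -
    have "m - 1 = real (b - Suc s)" using True by (simp add: m_def of_nat_diff)
    then show ?thesis using absorb[of "Suc s"] unfolding K_def of_nat_mult[symmetric] by simp
  qed
  have e1: "real (b choose s) = real (s + 1) * K / m" using 1 m by (simp add: field_simps)
  have e2: "real (b choose (s + 2)) = (m - 1) * K / real (s + 2)" using 2 by (simp add: field_simps)
  have "c (s + 2) / (b choose (s + 2)) * (1 - 1 / m) * (c s / (b choose s) * (1 - 1 / real (s + 2)))
    = c s * c (s + 2) / K\<^sup>2"
  proof -
    have gen: "x / (m1 * K / t) * (m1 / m) * (y / (r * K / m) * (r / t)) = y * x / K\<^sup>2"
      if "m1 > 0" "r > 0" "t > 0" for x y m1 r t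
      using that K m by (simp add: field_simps power2_eq_square)
    have "1 - 1 / m = (m - 1) / m" "1 - 1 / real (s + 2) = real (s + 1) / real (s + 2)"
      using m by (simp_all add: field_simps)
    then show ?thesis unfolding e1 e2 using gen[of "m - 1" "real (s + 1)" "real (s + 2)"] m by simp
  qed
  also have "\<dots> \<le> (c (s + 1))\<^sup>2 / K\<^sup>2"
    using c by (intro divide_right_mono) (auto simp: log_concave_upto_def)
  finally show ?thesis by (simp add: K_def m_def power_divide)
qed

text \<open>If \<open>\<gamma>\<close> misses a whole pair, one of the two remaining variables must
  come from it, and both members of the pair behave alike: the form is a product of linear forms
  minus a diagonal. If \<open>\<gamma>\<close> meets every pair, any two distinct further variables
  are admissible and the entry depends only on their types: this is a two-block matrix.\<close>

lemma one_pos_pair_block: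
  assumes c: "log_concave_upto b c" and \<gamma>: "size \<gamma> + 2 = 3 * b"
  shows "one_pos (all_vars b) (\<lambda>i j. pair_block b c (\<gamma> + {#i, j#}))"
proof -
  let ?V = "all_vars b"
  let ?A = "\<lambda>i j. pair_block b c (\<gamma> + {#i, j#})"
  have nn: "pair_block b c \<alpha> \<ge> 0" for \<alpha> using c by (simp add: pair_block_def log_concave_upto_def)
  consider (bad) "\<not> (set_mset \<gamma> \<subseteq> pair_vars b \<and> (\<forall>v. count \<gamma> v \<le> 1))"
    | (open_pair) v0 where "set_mset \<gamma> \<subseteq> pair_vars b" "\<forall>v. count \<gamma> v \<le> 1" "v0 \<in> pair_vars b"
        "v0 \<notin># \<gamma>" "partner v0 \<notin># \<gamma>"
    | (covered) "\<forall>v. count \<gamma> v \<le> 1" "covers b (set_mset \<gamma>)"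
    unfolding covers_def by blast
  then show ?thesis
  proof cases
    case bad
    have "?A i j = 0" for i j
    proof (rule ccontr)
      assume "?A i j \<noteq> 0"
      then have "set_mset (\<gamma> + {#i, j#}) \<subseteq> pair_vars b" "\<And>v. count (\<gamma> + {#i, j#}) v \<le> 1"
        by (rule pair_block_nonzeroD)+
      moreover have "count \<gamma> v \<le> count (\<gamma> + {#i, j#}) v" for v by simp
      ultimately show False using bad by (metis le_trans le_sup_iff set_mset_union)
    qed
    then show ?thesis by (simp add: one_pos_def bform_def)
  next
    case (open_pair v0)
    define v1 where "v1 = partner v0"
    have ne: "v0 \<noteq> v1" using partner_neq open_pair v1_def by metis
    have zero: "?A i j = 0" if "i \<notin> {v0, v1}" "j \<notin> {v0, v1}" for i j
      using open_pair that by (auto simp: pair_block_def covers_def v1_def)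
    have diag: "?A i i = 0" for i
    proof -
      have "count (\<gamma> + {#i, i#}) i > 1" by simp
      then have "\<not> (\<forall>v. count (\<gamma> + {#i, i#}) v \<le> 1)" using not_le by blast
      then show ?thesis by (simp only: pair_block_def) auto
    qed
    have comm: "?A i j = ?A j i" for i j by (simp add: add_mset_commute)
    have same: "?A v0 k = ?A v1 k" if "k \<notin> {v0, v1}" for k
    proof -
      have "covers b (set_mset (\<gamma> + {#v0, k#})) = covers b (set_mset (\<gamma> + {#v1, k#}))"
      proof -
        have "partner v = v0 \<longleftrightarrow> v = v1" "partner v = v1 \<longleftrightarrow> v = v0" for v
          by (metis partner_partner v1_def)+
        moreover have "v1 \<in> pair_vars b" using open_pair by (simp add: v1_def)
        ultimately show ?thesis using open_pair(3) unfolding covers_def by auto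
      qed
      moreover have "(\<forall>v. count (\<gamma> + {#v0, k#}) v \<le> 1) = (\<forall>v. count (\<gamma> + {#v1, k#}) v \<le> 1)"
        using that open_pair ne unfolding v1_def by (auto simp: not_in_iff)
      moreover have "size (\<gamma> + {#v0, k#}) = size (\<gamma> + {#v1, k#})"
        "size (filter_mset is_x (\<gamma> + {#v0, k#})) = size (filter_mset is_x (\<gamma> + {#v1, k#}))"
        by (simp_all add: v1_def)
      ultimately show ?thesis unfolding pair_block_def by presburger
    qed
    define f where "f i = (if i \<in> {v0, v1} then 1 else 0 :: real)" for i
    \<comment> \<open>Half of the entry at each of \<open>v0\<close> and \<open>v1\<close> makes the
      rank-two part equal to \<open>?A v0 v1\<close> on all four positions of the pair;
      \<open>h\<close> then clears the two diagonal ones.\<close>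
    define g where "g i = (if i \<in> {v0, v1} then ?A v0 v1 / 2 else ?A v0 i)" for i
    define h where "h i = (if i \<in> {v0, v1} then ?A v0 v1 else 0)" for i
    show ?thesis
    proof (rule one_pos_rank_two_minus_diagonal)
      show "h i \<ge> 0" for i by (simp add: h_def nn)
      show "?A i j = f i * g j + g i * f j - (if j = i then h i else 0)" for i j
      proof -
        consider "i \<notin> {v0, v1}" "j \<notin> {v0, v1}" | "i \<in> {v0, v1}" "j \<notin> {v0, v1}"
          | "i \<notin> {v0, v1}" "j \<in> {v0, v1}" | "i = j" "i \<in> {v0, v1}"
          | "i \<noteq> j" "i \<in> {v0, v1}" "j \<in> {v0, v1}" by blast
        then show ?thesis
        proof cases
          case 1
          then show ?thesis using zero[OF 1] by (auto simp: f_def h_def)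
        next
          case 2
          have "?A i j = ?A v0 j" using 2 same[of j] by auto
          then show ?thesis using 2 by (auto simp: f_def g_def h_def)
        next
          case 3
          have "?A i j = ?A v0 i" using 3 same[of i] comm[of i j] by auto
          then show ?thesis using 3 by (auto simp: f_def g_def h_def)
        next
          case 4
          then show ?thesis using diag[of i] by (simp add: f_def g_def h_def)
        next
          case 5
          then have "?A i j = ?A v0 v1" using comm by auto
          then show ?thesis using 5 by (simp add: f_def g_def h_def)
        qed
      qed
    qed simp
  next
    case covered
    define S where "S = set_mset \<gamma>"
    have S: "\<gamma> = mset_set S" "finite S" using covered by (simp_all add: S_def mset_set_set_mset_if_count_le_1)
    have cS: "card S + 2 = 3 * b" using \<gamma> S by simp
    have SV: "S \<subseteq> pair_vars b" using covered by (auto simp: S_def covers_def)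
    define U where "U = {v \<in> pair_vars b. is_x v} - S"
    define U' where "U' = {v \<in> pair_vars b. \<not> is_x v} - S"
    define n where "n = card {v\<in>S. is_x v}"
    define s where "s = n - b"
    have "card {v \<in> pair_vars b. is_x v} = card U + n" unfolding n_def U_def using SV S(2)
      by (subst card_Un_disjoint[symmetric]) (auto intro!: arg_cong[where f = card])
    then have cU: "card U + n = 2 * b" by (simp add: card_pair_vars_x)
    have "n + card {v\<in>S. \<not> is_x v} = card S" unfolding n_def using S(2)
      by (subst card_Un_disjoint[symmetric]) (auto intro!: arg_cong[where f = card])
    moreover have "card {v \<in> pair_vars b. \<not> is_x v} = card U' + card {v\<in>S. \<not> is_x v}" unfolding U'_def using SV S(2)
      by (subst card_Un_disjoint[symmetric]) (auto intro!: arg_cong[where f = card])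
    ultimately have cU': "card U' + b = n + 2" using cS by (simp add: card_pair_vars_y)
    \<comment> \<open>An x-variable outside \<open>S\<close> has its partner in \<open>S\<close>.
      With \<open>cU\<close> this yields \<open>n \<ge> b\<close>, so the subtraction in
      \<open>s\<close> is not truncated.\<close>
    have "card U \<le> n" unfolding n_def
    proof (rule card_inj_on_le[where f = partner])
      show "inj_on partner U" by (metis inj_onI partner_partner)
      show "partner ` U \<subseteq> {v\<in>S. is_x v}" using covered by (auto simp: U_def S_def covers_def)
    qed (use S in auto)
    then have nb: "n \<ge> b" using cU by linarith
    have cards: "card U = b - s" "card U' = s + 2" using cU cU' nb by (auto simp: s_def)
    show ?thesis
    proof (rule one_pos_two_blocks[where U = U and U' = U'])
      show "c (s + 2) / (b choose (s + 2)) \<ge> 0" "c s / (b choose s) \<ge> 0"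
        using c by (auto simp: log_concave_upto_def)
      show "c (s + 2) / (b choose (s + 2)) * (1 - 1 / card U) * (c s / (b choose s) * (1 - 1 / card U'))
          \<le> (c (s + 1) / (b choose (s + 1)))\<^sup>2"
        unfolding cards by (rule normalized_log_concave[OF c])
      fix i j
      show "?A i j = (if i = j then 0 else if i \<in> U \<and> j \<in> U then c (s + 2) / (b choose (s + 2))
        else if i \<in> U' \<and> j \<in> U' then c s / (b choose s)
        else if (i \<in> U \<and> j \<in> U') \<or> (i \<in> U' \<and> j \<in> U) then c (s + 1) / (b choose (s + 1)) else 0)"
      proof (cases "i \<noteq> j \<and> i \<in> pair_vars b - S \<and> j \<in> pair_vars b - S")
        case False
        have "?A i j = 0"
        proof (rule ccontr)
          assume "?A i j \<noteq> 0"
          then have "set_mset (\<gamma> + {#i, j#}) \<subseteq> pair_vars b" and le: "\<And>v. count (\<gamma> + {#i, j#}) v \<le> 1"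
            by (rule pair_block_nonzeroD)+
          moreover have "i \<noteq> j" using le[of i] by auto
          moreover have "i \<notin># \<gamma>" "j \<notin># \<gamma>" using le[of i] le[of j] by (auto simp: not_in_iff split: if_splits)
          ultimately show False using False by (auto simp: S_def)
        qed
        then show ?thesis using False by (auto simp: U_def U'_def)
      next
        case True
        have eq: "\<gamma> + {#i, j#} = mset_set (insert i (insert j S))" using True S by simp
        have "covers b (insert i (insert j S))" using covered True by (auto simp: covers_def S_def)
        moreover have "card (insert i (insert j S)) = 3 * b" using True S cS by simp
        moreover have "{v\<in>insert i (insert j S). is_x v} =
            (if is_x i then {i} else {}) \<union> ((if is_x j then {j} else {}) \<union> {v\<in>S. is_x v})" by auto
        then have "card {v\<in>insert i (insert j S). is_x v} - b =
            s + (if is_x i then 1 else 0) + (if is_x j then 1 else 0)"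
          using True S(2) nb by (cases "is_x i"; cases "is_x j") (simp_all add: n_def s_def card_insert_if)
        ultimately have "?A i j = c (s + (if is_x i then 1 else 0) + (if is_x j then 1 else 0)) /
            (b choose (s + (if is_x i then 1 else 0) + (if is_x j then 1 else 0)))"
          unfolding eq by (subst pair_block_mset_set) (use S in simp_all)
        then show ?thesis using True by (auto simp: U_def U'_def)
      qed
    qed (auto simp: U_def U'_def all_vars_def)
  qed
qed

lemma lor_pair_block:
  assumes c: "log_concave_upto b c"
  shows "lor (all_vars b) (3 * b) (pair_block b c)"
proof -
  have "size \<alpha> = 3 * b \<and> set_mset \<alpha> \<subseteq> all_vars b" if "pair_block b c \<alpha> \<noteq> 0" for \<alpha>
    using that by (auto simp: pair_block_def covers_def all_vars_def split: if_splits)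
  moreover have "pair_block b c \<alpha> \<ge> 0" for \<alpha> using c by (simp add: pair_block_def log_concave_upto_def)
  ultimately show ?thesis using M_exchange_pair_block[OF c] one_pos_pair_block[OF c] by (simp add: lor_def)
qed

section \<open>Iterated directional derivatives and evaluation\<close>

lemma dir_deriv_commute: "dir_deriv V w (dir_deriv V w' F) = dir_deriv V w' (dir_deriv V w F)"
proof
  fix \<alpha>
  have "dir_deriv V w (dir_deriv V w' F) \<alpha> =
      (\<Sum>i\<in>V. \<Sum>j\<in>V. w i * (w' j * F (add_mset j (add_mset i \<alpha>))))"
    by (simp add: dir_deriv_def sum_distrib_left)
  also have "\<dots> = (\<Sum>j\<in>V. \<Sum>i\<in>V. w i * (w' j * F (add_mset j (add_mset i \<alpha>))))" by (rule sum.swap)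
  also have "\<dots> = dir_deriv V w' (dir_deriv V w F) \<alpha>"
    by (simp add: dir_deriv_def sum_distrib_left add_mset_commute mult.left_commute)
  finally show "dir_deriv V w (dir_deriv V w' F) \<alpha> = dir_deriv V w' (dir_deriv V w F) \<alpha>" .
qed

lemma dir_deriv_pow_commute:
  "dir_deriv V w ((dir_deriv V w' ^^ n) F) = (dir_deriv V w' ^^ n) (dir_deriv V w F)"
  by (induction n) (simp_all add: dir_deriv_commute[of V w w'])

lemma dir_deriv_sum:
  "dir_deriv V w (\<lambda>\<alpha>. \<Sum>i\<in>I. c i * G i \<alpha>) = (\<lambda>\<alpha>. \<Sum>i\<in>I. c i * dir_deriv V w (G i) \<alpha>)"
proof
  fix \<alpha>
  have "dir_deriv V w (\<lambda>\<alpha>. \<Sum>i\<in>I. c i * G i \<alpha>) \<alpha> = (\<Sum>v\<in>V. \<Sum>i\<in>I. w v * (c i * G i (add_mset v \<alpha>)))"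
    by (simp add: dir_deriv_def sum_distrib_left)
  also have "\<dots> = (\<Sum>i\<in>I. \<Sum>v\<in>V. w v * (c i * G i (add_mset v \<alpha>)))" by (rule sum.swap)
  finally show "dir_deriv V w (\<lambda>\<alpha>. \<Sum>i\<in>I. c i * G i \<alpha>) \<alpha> = (\<Sum>i\<in>I. c i * dir_deriv V w (G i) \<alpha>)"
    by (simp add: dir_deriv_def sum_distrib_left mult.left_commute)
qed

lemma dir_deriv_pow_sum:
  "(dir_deriv V w ^^ n) (\<lambda>\<alpha>. \<Sum>i\<in>I. c i * G i \<alpha>) = (\<lambda>\<alpha>. \<Sum>i\<in>I. c i * (dir_deriv V w ^^ n) (G i) \<alpha>)"
  by (induction n) (simp_all add: dir_deriv_sum)

lemma dir_deriv_add:
  "dir_deriv V (\<lambda>i. w i + t * w' i) F \<alpha> = dir_deriv V w F \<alpha> + t * dir_deriv V w' F \<alpha>"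
  by (simp add: dir_deriv_def algebra_simps sum.distrib sum_distrib_left)

text \<open>The binomial theorem for commuting operators. It exhibits mixed derivatives as the
  coefficients of a polynomial in \<open>t\<close>, from which they are later read off.\<close>

lemma dir_deriv_binomial:
  "(dir_deriv V (\<lambda>i. w i + t * w' i) ^^ n) F =
     (\<lambda>\<alpha>. \<Sum>m\<le>n. (real (n choose m) * t ^ m) * (dir_deriv V w ^^ (n - m)) ((dir_deriv V w' ^^ m) F) \<alpha>)"
proof (induction n)
  case (Suc n)
  let ?D = "dir_deriv V w" and ?E = "dir_deriv V w'"
  define f where "f i j = (?D ^^ i) ((?E ^^ j) F)" for i j
  have Df: "?D (f i j) = f (Suc i) j" and Ef: "?E (f i j) = f i (Suc j)" for i j
    by (simp_all add: f_def dir_deriv_pow_commute)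
  show ?case
  proof
    fix \<alpha>
    have "(dir_deriv V (\<lambda>i. w i + t * w' i) ^^ Suc n) F \<alpha> =
        (\<Sum>m\<le>n. (real (n choose m) * t ^ m) * f (Suc (n - m)) m \<alpha>) +
        t * (\<Sum>m\<le>n. (real (n choose m) * t ^ m) * f (n - m) (Suc m) \<alpha>)"
      by (simp add: Suc.IH dir_deriv_add dir_deriv_sum f_def[symmetric] Df Ef)
        (simp add: distrib_left sum.distrib sum_distrib_left mult_ac)
    also have "(\<Sum>m\<le>n. (real (n choose m) * t ^ m) * f (Suc (n - m)) m \<alpha>) =
        (\<Sum>m\<le>Suc n. (real (n choose m) * t ^ m) * f (Suc n - m) m \<alpha>)"
      by (simp add: Suc_diff_le)
    also have "\<dots> = f (Suc n) 0 \<alpha> + (\<Sum>m\<le>n. (real (n choose Suc m) * t ^ Suc m) * f (n - m) (Suc m) \<alpha>)"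
      by (subst sum.atMost_Suc_shift) simp
    also have "t * (\<Sum>m\<le>n. (real (n choose m) * t ^ m) * f (n - m) (Suc m) \<alpha>) =
        (\<Sum>m\<le>n. (real (n choose m) * t ^ Suc m) * f (n - m) (Suc m) \<alpha>)"
      by (simp add: sum_distrib_left mult_ac)
    also have "f (Suc n) 0 \<alpha> + (\<Sum>m\<le>n. (real (n choose Suc m) * t ^ Suc m) * f (n - m) (Suc m) \<alpha>) +
        (\<Sum>m\<le>n. (real (n choose m) * t ^ Suc m) * f (n - m) (Suc m) \<alpha>) =
        f (Suc n) 0 \<alpha> + (\<Sum>m\<le>n. (real (Suc n choose Suc m) * t ^ Suc m) * f (n - m) (Suc m) \<alpha>)"
      by (simp add: sum.distrib[symmetric] algebra_simps)
    also have "\<dots> = (\<Sum>m\<le>Suc n. (real (Suc n choose m) * t ^ m) * f (Suc n - m) m \<alpha>)"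
      by (subst sum.atMost_Suc_shift) simp
    finally show "(dir_deriv V (\<lambda>i. w i + t * w' i) ^^ Suc n) F \<alpha> =
        (\<Sum>m\<le>Suc n. (real (Suc n choose m) * t ^ m) * (?D ^^ (Suc n - m)) ((?E ^^ m) F) \<alpha>)"
      by (simp only: f_def)
  qed
qed simp

lemma bform_eq_dir_deriv:
  "bform V (\<lambda>i j. F {#i, j#}) u v = dir_deriv V u (dir_deriv V v F) {#}"
  unfolding bform_def dir_deriv_def sum_distrib_left
  by (intro sum.cong refl) (simp add: add_mset_commute mult_ac)

lemma lor_two_reverse_cauchy:
  assumes F: "lor V 2 F" and w: "\<And>i. w i \<ge> 0"
  shows "dir_deriv V u (dir_deriv V u F) {#} * dir_deriv V w (dir_deriv V w F) {#}
    \<le> (dir_deriv V u (dir_deriv V w F) {#})\<^sup>2"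
proof -
  let ?A = "\<lambda>i j. F {#i, j#}"
  have "one_pos V (\<lambda>i j. F ({#} + {#i, j#}))" using F by (simp add: lor_def)
  then have A: "one_pos V ?A" by simp
  have sym: "?A i j = ?A j i" for i j by (simp add: add_mset_commute)
  have "bform V ?A w w \<ge> 0"
    by (rule bform_nonneg) (use F w in \<open>auto simp: lor_def\<close>)
  then consider "bform V ?A w w = 0" | "bform V ?A w w > 0" by linarith
  then show ?thesis
  proof cases
    case 2
    from one_pos_reverse_cauchy[of ?A, OF sym A 2, of u] show ?thesis by (simp only: bform_eq_dir_deriv)
  qed (simp add: bform_eq_dir_deriv)
qed

text \<open>The value at \<open>w\<close> of the polynomial encoded by the indicator of
  \<open>\<alpha>\<close>, which is the monomial divided by the factorials of its exponents.\<close>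

definition monom_eval :: "'v set \<Rightarrow> ('v \<Rightarrow> real) \<Rightarrow> 'v multiset \<Rightarrow> real" where
  "monom_eval V w \<alpha> = prod_mset (image_mset w \<alpha>) / (\<Prod>v\<in>V. fact (count \<alpha> v))"

text \<open>Euler's identity for one monomial. A derivative removes one \<open>i\<close> from
  \<open>\<alpha>\<close>; the value of what remains, times \<open>w i\<close>, is
  \<open>count \<alpha> i\<close> times the old value, and the counts add up to the degree.\<close>

lemma dir_deriv_pow_indicator:
  assumes fin: "finite V"
  shows "size \<alpha> = n \<Longrightarrow> set_mset \<alpha> \<subseteq> V \<Longrightarrow>
    (dir_deriv V w ^^ n) (\<lambda>\<beta>. if \<beta> = \<alpha> then 1 else 0) {#} = fact n * monom_eval V w \<alpha>"
proof (induction n arbitrary: \<alpha>)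
  case 0
  then show ?case by (simp add: monom_eval_def)
next
  case (Suc n)
  let ?\<delta> = "\<lambda>\<alpha> \<beta>. if \<beta> = \<alpha> then 1 else 0 :: real"
  have "dir_deriv V w (?\<delta> \<alpha>) = (\<lambda>\<beta>. \<Sum>i\<in>set_mset \<alpha>. w i * ?\<delta> (\<alpha> - {#i#}) \<beta>)"
  proof
    fix \<beta>
    have "dir_deriv V w (?\<delta> \<alpha>) \<beta> = (\<Sum>i\<in>set_mset \<alpha>. w i * ?\<delta> \<alpha> (add_mset i \<beta>))"
      unfolding dir_deriv_def using Suc.prems fin by (intro sum.mono_neutral_right) auto
    also have "\<dots> = (\<Sum>i\<in>set_mset \<alpha>. w i * ?\<delta> (\<alpha> - {#i#}) \<beta>)"
      by (intro sum.cong refl) auto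
    finally show "dir_deriv V w (?\<delta> \<alpha>) \<beta> = (\<Sum>i\<in>set_mset \<alpha>. w i * ?\<delta> (\<alpha> - {#i#}) \<beta>)" .
  qed
  then have "(dir_deriv V w ^^ Suc n) (?\<delta> \<alpha>) {#} =
      (\<Sum>i\<in>set_mset \<alpha>. w i * (dir_deriv V w ^^ n) (?\<delta> (\<alpha> - {#i#})) {#})"
    by (simp add: funpow_Suc_right dir_deriv_pow_sum del: funpow.simps)
  also have "\<dots> = (\<Sum>i\<in>set_mset \<alpha>. fact n * monom_eval V w \<alpha> * count \<alpha> i)"
  proof (intro sum.cong refl)
    fix i assume i: "i \<in> set_mset \<alpha>"
    then have iV: "i \<in> V" using Suc.prems by auto
    obtain \<beta> where \<beta>: "\<alpha> = add_mset i \<beta>" using i by (metis multi_member_split)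
    have "(\<Prod>v\<in>V. fact (count \<alpha> v)) = fact (count \<alpha> i) * (\<Prod>v\<in>V - {i}. fact (count \<alpha> v) :: real)"
      using fin iV by (rule prod.remove)
    also have "(\<Prod>v\<in>V - {i}. fact (count \<alpha> v) :: real) = (\<Prod>v\<in>V - {i}. fact (count \<beta> v))"
      by (intro prod.cong) (auto simp: \<beta>)
    also have "fact (count \<alpha> i) * \<dots> = real (count \<alpha> i) * (fact (count \<beta> i) * (\<Prod>v\<in>V - {i}. fact (count \<beta> v)))"
      by (simp add: \<beta>)
    also have "fact (count \<beta> i) * (\<Prod>v\<in>V - {i}. fact (count \<beta> v) :: real) = (\<Prod>v\<in>V. fact (count \<beta> v))"
      using fin iV by (rule prod.remove[symmetric])
    finally have fact_eq: "(\<Prod>v\<in>V. fact (count \<alpha> v)) = real (count \<alpha> i) * (\<Prod>v\<in>V. fact (count \<beta> v))" .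
    have "count \<alpha> i > 0" by (simp add: \<beta>)
    then have "monom_eval V w \<alpha> * count \<alpha> i = w i * monom_eval V w \<beta>"
      unfolding monom_eval_def fact_eq by (simp add: \<beta>)
    moreover have "(dir_deriv V w ^^ n) (?\<delta> (\<alpha> - {#i#})) {#} = fact n * monom_eval V w \<beta>"
      using Suc.IH[of \<beta>] Suc.prems by (simp add: \<beta>)
    ultimately show "w i * (dir_deriv V w ^^ n) (?\<delta> (\<alpha> - {#i#})) {#} = fact n * monom_eval V w \<alpha> * count \<alpha> i"
      by simp
  qed
  also have "\<dots> = fact n * monom_eval V w \<alpha> * real (size \<alpha>)"
    by (simp add: sum_distrib_left[symmetric] size_multiset_overloaded_eq)
  also have "\<dots> = fact (Suc n) * monom_eval V w \<alpha>" using Suc.prems by simp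
  finally show ?case .
qed

text \<open>By linearity from the indicators: differentiating a form of degree \<open>n\<close> in
  direction \<open>w\<close> exactly \<open>n\<close> times gives \<open>n!\<close> times its value
  at \<open>w\<close>.\<close>

lemma dir_deriv_pow_eval:
  assumes fin: "finite V" "finite A" and supp: "\<And>\<alpha>. F \<alpha> \<noteq> 0 \<Longrightarrow> \<alpha> \<in> A"
    and A: "\<And>\<alpha>. \<alpha> \<in> A \<Longrightarrow> size \<alpha> = n \<and> set_mset \<alpha> \<subseteq> V"
  shows "(dir_deriv V w ^^ n) F {#} = fact n * (\<Sum>\<alpha>\<in>A. F \<alpha> * monom_eval V w \<alpha>)"
proof -
  have "F = (\<lambda>\<beta>. \<Sum>\<alpha>\<in>A. F \<alpha> * (if \<beta> = \<alpha> then 1 else 0))"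
  proof
    fix \<beta>
    have "(\<Sum>\<alpha>\<in>A. F \<alpha> * (if \<beta> = \<alpha> then 1 else 0)) = (\<Sum>\<alpha>\<in>A. if \<alpha> = \<beta> then F \<beta> else 0)"
      by (intro sum.cong) auto
    then show "F \<beta> = (\<Sum>\<alpha>\<in>A. F \<alpha> * (if \<beta> = \<alpha> then 1 else 0))" using fin supp[of \<beta>] by auto
  qed
  then have "(dir_deriv V w ^^ n) F {#} =
      (\<Sum>\<alpha>\<in>A. F \<alpha> * (dir_deriv V w ^^ n) (\<lambda>\<beta>. if \<beta> = \<alpha> then 1 else 0) {#})"
    using dir_deriv_pow_sum[of n V w F "\<lambda>\<alpha> \<beta>. if \<beta> = \<alpha> then 1 else 0" A] by simp
  also have "\<dots> = (\<Sum>\<alpha>\<in>A. fact n * (F \<alpha> * monom_eval V w \<alpha>))"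
    using A by (intro sum.cong refl) (simp add: dir_deriv_pow_indicator[OF fin(1)])
  finally show ?thesis by (simp add: sum_distrib_left)
qed

section \<open>Specialisation of the pair block to \<open>x\<close>, \<open>y\<close> and
  \<open>u\<close>\<close>

lemma sum_Pow_power:
  fixes x u :: real
  assumes "finite A"
  shows "(\<Sum>K\<in>Pow A. x ^ card K * u ^ (card A - card K)) = (x + u) ^ card A"
proof -
  have "(x + u) ^ card A = (\<Prod>i\<in>A. x + u)" by simp
  also have "\<dots> = (\<Sum>K\<in>Pow A. (\<Prod>i\<in>K. x) * (\<Prod>i\<in>A - K. u))" by (rule prod_add[OF assms])
  also have "\<dots> = (\<Sum>K\<in>Pow A. x ^ card K * u ^ (card A - card K))"
    using assms by (intro sum.cong refl) (auto simp: card_Diff_subset finite_subset)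
  finally show ?thesis by simp
qed

lemma sum_Pow_card:
  fixes f :: "nat \<Rightarrow> real"
  assumes "finite A"
  shows "(\<Sum>I\<in>Pow A. f (card I)) = (\<Sum>j\<le>card A. real (card A choose j) * f j)"
proof -
  have "(\<Sum>I\<in>Pow A. f (card I)) = (\<Sum>j\<le>card A. \<Sum>I\<in>{I \<in> Pow A. card I = j}. f (card I))"
    using assms by (intro sum.group[symmetric]) (auto intro: card_mono)
  also have "\<dots> = (\<Sum>j\<le>card A. real (card A choose j) * f j)"
  proof (intro sum.cong refl)
    fix j
    have "card {I \<in> Pow A. card I = j} = card A choose j" using n_subsets[OF assms, of j] by simp
    then show "(\<Sum>I\<in>{I \<in> Pow A. card I = j}. f (card I)) = real (card A choose j) * f j" by simp
  qed
  finally show ?thesis .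
qed

text \<open>In each pair \<open>XA j, XB j\<close> both variables are chosen for \<open>j \<in> I\<close>, only \<open>XA j\<close> for \<open>j \<in> K\<close> and only
  \<open>XB j\<close> otherwise; likewise for \<open>YA j, YB j\<close> with \<open>I', K'\<close>.\<close>

definition cover_set :: "nat \<Rightarrow> (nat set \<times> nat set) \<times> (nat set \<times> nat set) \<Rightarrow> var set" where
  "cover_set b = (\<lambda>((I, K), (I', K')). XA ` (I \<union> K) \<union> XB ` ({..<b} - K) \<union> YA ` (I' \<union> K') \<union> YB ` ({..<b} - K'))"

definition cover_index :: "nat \<Rightarrow> (nat set \<times> nat set) set" where
  "cover_index b = (SIGMA I : Pow {..<b}. Pow ({..<b} - I))"

lemma cover_set_props:
  assumes "(I, K) \<in> cover_index b" "(I', K') \<in> cover_index b"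
  defines "S \<equiv> cover_set b ((I, K), (I', K'))"
  shows "covers b S" "card S = 2 * b + card I + card I'" "card {v\<in>S. is_x v} = b + card I"
    "(\<Prod>v\<in>S. w v) = (\<Prod>j\<in>I \<union> K. w (XA j)) * (\<Prod>j\<in>{..<b} - K. w (XB j)) *
       ((\<Prod>j\<in>I' \<union> K'. w (YA j)) * (\<Prod>j\<in>{..<b} - K'. w (YB j)) :: real)"
proof -
  have fin: "finite I" "finite K" "finite I'" "finite K'" "I \<inter> K = {}" "I' \<inter> K' = {}"
    and sub: "I \<subseteq> {..<b}" "K \<subseteq> {..<b}" "I' \<subseteq> {..<b}" "K' \<subseteq> {..<b}"
    using assms(1,2) unfolding cover_index_def by (auto intro: finite_subset[of _ "{..<b}"])
  show "covers b S"
    using sub unfolding covers_def pair_vars_def S_def cover_set_def by auto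
  have cardK: "card K \<le> b" "card K' \<le> b" using card_mono[OF _ sub(2)] card_mono[OF _ sub(4)] by auto
  have cX: "card (XA ` (I \<union> K) \<union> XB ` ({..<b} - K)) = b + card I"
    using fin sub cardK by (subst card_Un_disjoint) (auto simp: card_image inj_on_def card_Un_disjoint card_Diff_subset)
  have cY: "card (YA ` (I' \<union> K') \<union> YB ` ({..<b} - K')) = b + card I'"
    using fin sub cardK by (subst card_Un_disjoint) (auto simp: card_image inj_on_def card_Un_disjoint card_Diff_subset)
  have S: "S = (XA ` (I \<union> K) \<union> XB ` ({..<b} - K)) \<union> (YA ` (I' \<union> K') \<union> YB ` ({..<b} - K'))"
    by (auto simp: S_def cover_set_def)
  show "card S = 2 * b + card I + card I'"
    unfolding S using fin cX cY by (subst card_Un_disjoint) auto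
  have "{v\<in>S. is_x v} = XA ` (I \<union> K) \<union> XB ` ({..<b} - K)" unfolding S by auto
  then show "card {v\<in>S. is_x v} = b + card I" using cX by simp
  have "(\<Prod>v\<in>S. w v) = (\<Prod>v\<in>XA ` (I \<union> K). w v) * (\<Prod>v\<in>XB ` ({..<b} - K). w v) *
      ((\<Prod>v\<in>YA ` (I' \<union> K'). w v) * (\<Prod>v\<in>YB ` ({..<b} - K'). w v))"
  proof -
    have "prod w S = prod w (XA ` (I \<union> K) \<union> XB ` ({..<b} - K)) * prod w (YA ` (I' \<union> K') \<union> YB ` ({..<b} - K'))"
      unfolding S by (rule prod.union_disjoint) (use fin in auto)
    also have "prod w (XA ` (I \<union> K) \<union> XB ` ({..<b} - K)) = prod w (XA ` (I \<union> K)) * prod w (XB ` ({..<b} - K))"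
      by (rule prod.union_disjoint) (use fin in auto)
    also have "prod w (YA ` (I' \<union> K') \<union> YB ` ({..<b} - K')) = prod w (YA ` (I' \<union> K')) * prod w (YB ` ({..<b} - K'))"
      by (rule prod.union_disjoint) (use fin in auto)
    finally show ?thesis .
  qed
  then show "(\<Prod>v\<in>S. w v) = (\<Prod>j\<in>I \<union> K. w (XA j)) * (\<Prod>j\<in>{..<b} - K. w (XB j)) *
       ((\<Prod>j\<in>I' \<union> K'. w (YA j)) * (\<Prod>j\<in>{..<b} - K'. w (YB j)))"
    by (simp add: prod.reindex inj_on_def)
qed

lemma cover_set_bij:
  "bij_betw (cover_set b)
     {z \<in> cover_index b \<times> cover_index b. card (fst (fst z)) + card (fst (snd z)) = b}
     {S. covers b S \<and> card S = 3 * b}"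
proof (rule bij_betw_byWitness)
  \<comment> \<open>The inverse of \<open>cover_set\<close>: a covering set that misses
    \<open>XB j\<close> contains \<open>XA j\<close>, so \<open>K\<close> can be read off from the
    missing \<open>XB j\<close> alone.\<close>
  define g where "g S =
    (({j. XA j \<in> S \<and> XB j \<in> S}, {j. j < b \<and> XB j \<notin> S}), ({j. YA j \<in> S \<and> YB j \<in> S}, {j. j < b \<and> YB j \<notin> S}))" for S
  let ?Z = "{z \<in> cover_index b \<times> cover_index b. card (fst (fst z)) + card (fst (snd z)) = b}"
  let ?S = "{S. covers b S \<and> card S = 3 * b}"
  have gz: "g S \<in> cover_index b \<times> cover_index b \<and> cover_set b (g S) = S" if "covers b S" for S
  proof
    have "\<forall>j. (XA j \<in> S \<or> XB j \<in> S \<longrightarrow> j < b) \<and> (YA j \<in> S \<or> YB j \<in> S \<longrightarrow> j < b)" and base: "X0 \<notin> S" "Y0 \<notin> S"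
      using that by (auto simp: covers_def pair_vars_def)
    moreover have hit: "\<forall>j<b. (XA j \<in> S \<or> XB j \<in> S) \<and> (YA j \<in> S \<or> YB j \<in> S)"
    proof (intro allI impI)
      fix j assume "j < b"
      then have "XA j \<in> pair_vars b" "YA j \<in> pair_vars b" by (auto simp: pair_vars_def)
      then show "(XA j \<in> S \<or> XB j \<in> S) \<and> (YA j \<in> S \<or> YB j \<in> S)"
        using that by (force simp: covers_def)
    qed
    ultimately show "g S \<in> cover_index b \<times> cover_index b" by (auto simp: g_def cover_index_def)
    show "cover_set b (g S) = S"
    proof (rule set_eqI)
      fix v show "v \<in> cover_set b (g S) \<longleftrightarrow> v \<in> S"
        using hit base \<open>\<forall>j. (XA j \<in> S \<or> XB j \<in> S \<longrightarrow> j < b) \<and> (YA j \<in> S \<or> YB j \<in> S \<longrightarrow> j < b)\<close>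
        by (cases v) (auto simp: g_def cover_set_def)
    qed
  qed
  show "\<forall>z\<in>?Z. g (cover_set b z) = z"
    by (auto simp: g_def cover_set_def cover_index_def)
  show "\<forall>S\<in>?S. cover_set b (g S) = S" using gz by blast
  show "cover_set b ` ?Z \<subseteq> ?S" using cover_set_props(1,2) by force
  show "g ` ?S \<subseteq> ?Z"
  proof (rule image_subsetI)
    fix S assume "S \<in> ?S"
    then have S: "covers b S" "card S = 3 * b" by simp_all
    from gz[OF S(1)] obtain I K I' K' where eq: "g S = ((I, K), (I', K'))"
      and in_idx: "(I, K) \<in> cover_index b" "(I', K') \<in> cover_index b" and cS: "cover_set b ((I, K), (I', K')) = S"
      by (metis SigmaE prod.exhaust)
    have "card I + card I' = b" using cover_set_props(2)[OF in_idx] cS S(2) by simp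
    then show "g S \<in> ?Z" using gz[OF S(1)] eq by simp
  qed
qed

text \<open>The point \<open>x * dir_x + y * dir_y + u * dir_u\<close> has coordinates
  \<open>X0 = x + u\<close>, \<open>Y0 = y + u\<close>, \<open>XA j = x\<close>,
  \<open>YA j = y\<close> and \<open>XB j = YB j = u\<close>, which is the specialisation
  wanted.\<close>

definition dir_x :: "var \<Rightarrow> real" where "dir_x v = (case v of X0 \<Rightarrow> 1 | XA _ \<Rightarrow> 1 | _ \<Rightarrow> 0)"
definition dir_y :: "var \<Rightarrow> real" where "dir_y v = (case v of Y0 \<Rightarrow> 1 | YA _ \<Rightarrow> 1 | _ \<Rightarrow> 0)"
definition dir_u :: "var \<Rightarrow> real" where
  "dir_u v = (case v of X0 \<Rightarrow> 1 | Y0 \<Rightarrow> 1 | XB _ \<Rightarrow> 1 | YB _ \<Rightarrow> 1 | _ \<Rightarrow> 0)"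

text \<open>An index in \<open>I\<close> contributes \<open>x * u\<close>; any other contributes
  \<open>x\<close> or \<open>u\<close> according to \<open>K\<close>, which sums to
  \<open>x + u\<close>.\<close>

lemma sum_cover_index:
  fixes x u :: real
  shows "(\<Sum>z\<in>cover_index b. f (card (fst z)) * (x ^ (card (fst z) + card (snd z)) * u ^ (b - card (snd z))))
    = (\<Sum>j\<le>b. real (b choose j) * (f j * ((x * u) ^ j * (x + u) ^ (b - j))))"
proof -
  have "(\<Sum>z\<in>cover_index b. f (card (fst z)) * (x ^ (card (fst z) + card (snd z)) * u ^ (b - card (snd z))))
    = (\<Sum>I\<in>Pow {..<b}. \<Sum>K\<in>Pow ({..<b} - I). f (card I) * (x ^ (card I + card K) * u ^ (b - card K)))"
    unfolding cover_index_def by (subst sum.Sigma) (auto simp: case_prod_beta)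
  also have "\<dots> = (\<Sum>I\<in>Pow {..<b}. f (card I) * ((x * u) ^ card I * (x + u) ^ (b - card I)))"
  proof (intro sum.cong refl)
    fix I assume "I \<in> Pow {..<b}"
    then have I: "I \<subseteq> {..<b}" "finite I" by (auto intro: finite_subset)
    have cI: "card ({..<b} - I) = b - card I" "card I \<le> b"
      using I card_mono[of "{..<b}" I] by (auto simp: card_Diff_subset)
    have "(\<Sum>K\<in>Pow ({..<b} - I). f (card I) * (x ^ (card I + card K) * u ^ (b - card K))) =
        (\<Sum>K\<in>Pow ({..<b} - I). f (card I) * (x * u) ^ card I * (x ^ card K * u ^ (card ({..<b} - I) - card K)))"
    proof (intro sum.cong refl)
      fix K assume "K \<in> Pow ({..<b} - I)"
      then have "card K \<le> b - card I" using card_mono[of "{..<b} - I" K] cI by auto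
      then have "b - card K = card I + (b - card I - card K)" using cI by linarith
      then have "u ^ (b - card K) = u ^ card I * u ^ (b - card I - card K)" by (simp add: power_add)
      then show "f (card I) * (x ^ (card I + card K) * u ^ (b - card K)) =
          f (card I) * (x * u) ^ card I * (x ^ card K * u ^ (card ({..<b} - I) - card K))"
        by (simp add: cI power_add power_mult_distrib mult_ac)
    qed
    also have "\<dots> = f (card I) * (x * u) ^ card I * (x + u) ^ (b - card I)"
      using sum_Pow_power[of "{..<b} - I" x u] by (simp add: sum_distrib_left[symmetric] cI)
    finally show "(\<Sum>K\<in>Pow ({..<b} - I). f (card I) * (x ^ (card I + card K) * u ^ (b - card K))) =
        f (card I) * ((x * u) ^ card I * (x + u) ^ (b - card I))" by (simp add: mult.assoc)
  qed
  also have "\<dots> = (\<Sum>j\<le>b. real (b choose j) * (f j * ((x * u) ^ j * (x + u) ^ (b - j))))"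
    using sum_Pow_card[of "{..<b}" "\<lambda>j. f j * ((x * u) ^ j * (x + u) ^ (b - j))"] by simp
  finally show ?thesis .
qed

text \<open>There are \<open>(b choose j)\<^sup>2\<close> choices of \<open>I\<close>,
  \<open>I'\<close> with \<open>card I = j\<close>. One binomial cancels against the division in
  \<open>pair_block\<close>; the other turns the normalised \<open>c j\<close> back into a
  coefficient of \<open>q\<close>.\<close>

lemma sum_pair_block:
  fixes x y u :: real
  assumes w: "\<And>j. w (XA j) = x" "\<And>j. w (XB j) = u" "\<And>j. w (YA j) = y" "\<And>j. w (YB j) = u"
  shows "(\<Sum>S | covers b S \<and> card S = 3 * b. pair_block b c (mset_set S) * (\<Prod>v\<in>S. w v)) =
    (\<Sum>j\<le>b. c j * real (b choose j) * ((x * u) ^ j * (x + u) ^ (b - j) * ((y * u) ^ (b - j) * (y + u) ^ j)))"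
proof -
  define hx where "hx z = x ^ (card (fst z) + card (snd z)) * u ^ (b - card (snd z))" for z :: "nat set \<times> nat set"
  define hy where "hy z = y ^ (card (fst z) + card (snd z)) * u ^ (b - card (snd z))" for z :: "nat set \<times> nat set"
  define Z where "Z = cover_index b"
  have finZ: "finite Z" unfolding Z_def cover_index_def by (intro finite_SigmaI) auto
  define C where "C j = c j / real (b choose j)" for j
  have "(\<Sum>S | covers b S \<and> card S = 3 * b. pair_block b c (mset_set S) * (\<Prod>v\<in>S. w v)) =
      (\<Sum>z\<in>{z \<in> Z \<times> Z. card (fst (fst z)) + card (fst (snd z)) = b}.
         pair_block b c (mset_set (cover_set b z)) * (\<Prod>v\<in>cover_set b z. w v))"
    unfolding Z_def by (rule sum.reindex_bij_betw[OF cover_set_bij, symmetric])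
  also have "\<dots> = (\<Sum>z\<in>{z \<in> Z \<times> Z. card (fst (fst z)) + card (fst (snd z)) = b}.
      C (card (fst (fst z))) * (hx (fst z) * hy (snd z)))"
  proof (intro sum.cong refl)
    fix z assume zin: "z \<in> {z \<in> Z \<times> Z. card (fst (fst z)) + card (fst (snd z)) = b}"
    obtain I K I' K' where z: "z = ((I, K), (I', K'))" by (metis prod.exhaust)
    have in_idx: "(I, K) \<in> cover_index b" "(I', K') \<in> cover_index b" and cards: "card I + card I' = b"
      using zin by (simp_all add: z Z_def)
    have fin: "finite I" "finite K" "finite I'" "finite K'" "I \<inter> K = {}" "I' \<inter> K' = {}" "K \<subseteq> {..<b}" "K' \<subseteq> {..<b}"
      using in_idx unfolding cover_index_def by (auto intro: finite_subset[of _ "{..<b}"])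
    have "finite (cover_set b z)" using fin by (auto simp: z cover_set_def)
    then have "pair_block b c (mset_set (cover_set b z)) = C (card I)"
      using cover_set_props(1-3)[OF in_idx] cards unfolding z C_def by (subst pair_block_mset_set) simp_all
    moreover have "(\<Prod>v\<in>cover_set b z. w v) = hx (fst z) * hy (snd z)"
      unfolding z cover_set_props(4)[OF in_idx] using fin
      by (simp add: w hx_def hy_def card_Un_disjoint card_Diff_subset)
    ultimately show "pair_block b c (mset_set (cover_set b z)) * (\<Prod>v\<in>cover_set b z. w v) =
        C (card (fst (fst z))) * (hx (fst z) * hy (snd z))" by (simp add: z)
  qed
  also have "\<dots> = (\<Sum>z\<in>Z \<times> Z. if card (fst (fst z)) + card (fst (snd z)) = b
      then C (card (fst (fst z))) * (hx (fst z) * hy (snd z)) else 0)"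
    using finZ by (subst sum.inter_filter[symmetric]) auto
  also have "\<dots> = (\<Sum>r\<in>Z. \<Sum>s\<in>Z. if card (fst r) + card (fst s) = b then C (card (fst r)) * (hx r * hy s) else 0)"
    by (simp add: sum.cartesian_product case_prod_beta)
  also have "\<dots> = (\<Sum>r\<in>Z. (\<Sum>j\<le>b. real (b choose j) * ((if card (fst r) + j = b then C (card (fst r)) else 0) *
      ((y * u) ^ j * (y + u) ^ (b - j)))) * hx r)"
  proof (intro sum.cong refl)
    fix r assume "r \<in> Z"
    have "(\<Sum>s\<in>Z. if card (fst r) + card (fst s) = b then C (card (fst r)) * (hx r * hy s) else 0) =
        (\<Sum>s\<in>Z. (if card (fst r) + card (fst s) = b then C (card (fst r)) else 0) * hy s) * hx r"
      unfolding sum_distrib_right by (intro sum.cong) (auto simp: mult_ac)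
    also have "(\<Sum>s\<in>Z. (if card (fst r) + card (fst s) = b then C (card (fst r)) else 0) * hy s) =
        (\<Sum>j\<le>b. real (b choose j) * ((if card (fst r) + j = b then C (card (fst r)) else 0) *
      ((y * u) ^ j * (y + u) ^ (b - j))))"
      unfolding Z_def hy_def by (rule sum_cover_index)
    finally show "(\<Sum>s\<in>Z. if card (fst r) + card (fst s) = b then C (card (fst r)) * (hx r * hy s) else 0) =
      (\<Sum>j\<le>b. real (b choose j) * ((if card (fst r) + j = b then C (card (fst r)) else 0) *
      ((y * u) ^ j * (y + u) ^ (b - j)))) * hx r" .
  qed
  also have "\<dots> = (\<Sum>i\<le>b. real (b choose i) * ((\<Sum>j\<le>b. real (b choose j) * ((if i + j = b then C i else 0) *
      ((y * u) ^ j * (y + u) ^ (b - j)))) * ((x * u) ^ i * (x + u) ^ (b - i))))"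
    unfolding Z_def hx_def by (rule sum_cover_index)
  also have "\<dots> = (\<Sum>j\<le>b. c j * real (b choose j) * ((x * u) ^ j * (x + u) ^ (b - j) * ((y * u) ^ (b - j) * (y + u) ^ j)))"
  proof (intro sum.cong refl)
    fix i assume "i \<in> {..b}"
    then have i: "i \<le> b" by simp
    have "(\<Sum>j\<le>b. real (b choose j) * ((if i + j = b then C i else 0) * ((y * u) ^ j * (y + u) ^ (b - j)))) =
        (\<Sum>j\<le>b. if j = b - i then real (b choose (b - i)) * (C i * ((y * u) ^ (b - i) * (y + u) ^ i)) else 0)"
      using i by (intro sum.cong) auto
    also have "\<dots> = c i * ((y * u) ^ (b - i) * (y + u) ^ i)"
      using i by (simp add: C_def binomial_symmetric[symmetric])
    finally show "real (b choose i) * ((\<Sum>j\<le>b. real (b choose j) * ((if i + j = b then C i else 0) *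
      ((y * u) ^ j * (y + u) ^ (b - j)))) * ((x * u) ^ i * (x + u) ^ (b - i))) =
      c i * real (b choose i) * ((x * u) ^ i * (x + u) ^ (b - i) * ((y * u) ^ (b - i) * (y + u) ^ i))"
      by (simp add: mult_ac)
  qed
  finally show ?thesis .
qed

section \<open>The coefficients of the product\<close>

text \<open>The coefficient of \<open>binom_poly (a + b) k\<close> in
  \<open>binom_poly a i * binom_poly b j\<close>, see \<open>binom_poly_mult\<close>. Without the
  guard, truncated subtraction would turn a negative lower index into 0 and the binomial into
  1.\<close>

definition bullet_coeff :: "nat \<Rightarrow> nat \<Rightarrow> nat \<Rightarrow> nat \<Rightarrow> nat \<Rightarrow> nat" where
  "bullet_coeff a b i j k =
     (if i \<le> k \<and> j \<le> k then (a + j - i choose (k - i)) * (b + i - j choose (k - j)) else 0)"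

lemma coeff_monic_linear_power:
  fixes x :: "'a::comm_ring_1"
  shows "coeff ([:x, 1:] ^ n) r = of_nat (n choose r) * x ^ (n - r)"
proof (cases "r \<le> n")
  case True
  then show ?thesis by (simp add: coeff_linear_poly_power)
next
  case False
  then show ?thesis by (simp add: coeff_eq_0 degree_linear_power binomial_eq_0)
qed

text \<open>For \<open>k = i + b - r\<close> one has \<open>k - i = b - r\<close>, while
  \<open>k - j\<close> and \<open>r\<close> add up to \<open>b + i - j\<close>. The resulting
  convolution is what both \<open>coeff_shifted_product\<close> and \<open>binom_poly_mult\<close>
  use.\<close>

lemma sum_bullet_coeff:
  fixes g :: "nat \<Rightarrow> 'a::comm_semiring_1"
  assumes i: "i \<le> a" and j: "j \<le> b"
  shows "(\<Sum>k\<le>a + b. of_nat (bullet_coeff a b i j k) * g k) =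
    (\<Sum>r\<le>b. of_nat ((b + i - j choose r) * (a + j - i choose (b - r))) * g (i + b - r))"
proof -
  let ?n = "b + i - j" and ?m = "a + j - i"
  have "(\<Sum>k\<le>a + b. of_nat (bullet_coeff a b i j k) * g k) =
      (\<Sum>k\<in>{i..i + b}. of_nat (bullet_coeff a b i j k) * g k)"
  proof (rule sum.mono_neutral_right)
    show "\<forall>k\<in>{..a + b} - {i..i + b}. of_nat (bullet_coeff a b i j k) * g k = 0"
    proof
      fix k assume "k \<in> {..a + b} - {i..i + b}"
      then have "bullet_coeff a b i j k = 0" using j by (auto simp: bullet_coeff_def binomial_eq_0)
      then show "of_nat (bullet_coeff a b i j k) * g k = 0" by simp
    qed
  qed (use i in auto)
  also have "\<dots> = (\<Sum>r\<le>b. of_nat (bullet_coeff a b i j (i + b - r)) * g (i + b - r))"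
    by (rule sum.reindex_bij_witness[of _ "\<lambda>r. i + b - r" "\<lambda>k. i + b - k"]) auto
  also have "\<dots> = (\<Sum>r\<le>b. of_nat ((?n choose r) * (?m choose (b - r))) * g (i + b - r))"
  proof (intro sum.cong refl)
    fix r assume "r \<in> {..b}"
    then have r: "r \<le> b" by simp
    have "bullet_coeff a b i j (i + b - r) = (?n choose r) * (?m choose (b - r))"
    proof (cases "r \<le> ?n")
      case True
      then have "i \<le> i + b - r" "j \<le> i + b - r" "i + b - r - i = b - r" "i + b - r - j = ?n - r"
        using r i j by auto
      then show ?thesis using True binomial_symmetric[of r ?n] by (simp add: bullet_coeff_def)
    next
      case False
      then have "i + b - r < j" using r j by linarith
      then show ?thesis using False by (simp add: bullet_coeff_def binomial_eq_0)
    qed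
    then show "of_nat (bullet_coeff a b i j (i + b - r)) * g (i + b - r) =
        of_nat ((?n choose r) * (?m choose (b - r))) * g (i + b - r)" by simp
  qed
  finally show ?thesis .
qed

text \<open>Choosing the indeterminate from \<open>r\<close> factors of the first power and
  \<open>b - r\<close> of the second leaves, with the monomial in front, the exponent
  \<open>i + b - r\<close> on \<open>x\<close>.\<close>

lemma coeff_shifted_product:
  fixes x y :: "'a::comm_ring_1"
  assumes i: "i \<le> a" and j: "j \<le> b"
  shows "x ^ j * y ^ (b - j) * coeff ([:x, 1:] ^ (b + i - j) * [:y, 1:] ^ (a + j - i)) b =
    (\<Sum>k\<le>a + b. of_nat (bullet_coeff a b i j k) * (x ^ k * y ^ (a + b - k)))"
proof -
  let ?n = "b + i - j" and ?m = "a + j - i"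
  have "x ^ j * y ^ (b - j) * coeff ([:x, 1:] ^ ?n * [:y, 1:] ^ ?m) b =
      (\<Sum>r\<le>b. x ^ j * y ^ (b - j) * (of_nat (?n choose r) * x ^ (?n - r) * (of_nat (?m choose (b - r)) * y ^ (?m - (b - r)))))"
    by (simp add: coeff_mult coeff_monic_linear_power sum_distrib_left mult.assoc)
  also have "\<dots> = (\<Sum>r\<le>b. of_nat ((?n choose r) * (?m choose (b - r))) * (x ^ (i + b - r) * y ^ (a + b - (i + b - r))))"
  proof (intro sum.cong refl)
    fix r assume "r \<in> {..b}"
    then have r: "r \<le> b" by simp
    show "x ^ j * y ^ (b - j) * (of_nat (?n choose r) * x ^ (?n - r) * (of_nat (?m choose (b - r)) * y ^ (?m - (b - r)))) =
        of_nat ((?n choose r) * (?m choose (b - r))) * (x ^ (i + b - r) * y ^ (a + b - (i + b - r)))"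
    proof (cases "r \<le> ?n \<and> b - r \<le> ?m")
      case True
      have "i + b - r = j + (?n - r)" using True r j by linarith
      then have "x ^ (i + b - r) = x ^ j * x ^ (?n - r)" by (simp only: power_add)
      moreover have "a + b - (i + b - r) = (b - j) + (?m - (b - r))" using True r i j by linarith
      then have "y ^ (a + b - (i + b - r)) = y ^ (b - j) * y ^ (?m - (b - r))" by (simp only: power_add)
      ultimately show ?thesis by (simp add: mult_ac)
    next
      case False
      then have "(?n choose r) = 0 \<or> (?m choose (b - r)) = 0" by (auto simp: binomial_eq_0)
      then have "of_nat (?n choose r) = (0::'a) \<or> of_nat (?m choose (b - r)) = (0::'a)" by (metis of_nat_0)
      then show ?thesis by auto
    qed
  qed
  also have "\<dots> = (\<Sum>k\<le>a + b. of_nat (bullet_coeff a b i j k) * (x ^ k * y ^ (a + b - k)))"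
    by (rule sum_bullet_coeff[OF i j, symmetric])
  finally show ?thesis .
qed

section \<open>Mixed derivatives of the joint block\<close>

definition base_mset :: "nat \<Rightarrow> nat \<Rightarrow> var multiset" where
  "base_mset a i = replicate_mset i X0 + replicate_mset (a - i) Y0"

definition joint_block :: "nat \<Rightarrow> nat \<Rightarrow> (nat \<Rightarrow> real) \<Rightarrow> (nat \<Rightarrow> real) \<Rightarrow> var multiset \<Rightarrow> real" where
  "joint_block a b p q = tensor is_base (base_block a p) (pair_block b q)"

lemma pair_vars_not_base: "v \<in> pair_vars b \<Longrightarrow> \<not> is_base v"
  by (auto simp: pair_vars_def)

lemma lor_joint_block:
  assumes "log_concave_upto a p" "log_concave_upto b q"
  shows "lor (all_vars b) (a + 3 * b) (joint_block a b p q)"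
  unfolding joint_block_def
proof (rule lor_tensor[OF finite_all_vars lor_base_block[OF assms(1)] _ lor_pair_block[OF assms(2)]])
  show "set_mset \<alpha> \<subseteq> Collect is_base" if "base_block a p \<alpha> \<noteq> 0" for \<alpha>
    using that by (auto simp: base_block_def split: if_splits)
  show "set_mset \<alpha> \<inter> Collect is_base = {}" if "pair_block b q \<alpha> \<noteq> 0" for \<alpha>
    using pair_block_nonzeroD(1)[OF that] pair_vars_not_base by auto
qed

lemma base_mset_plus_pairs:
  assumes S: "S \<subseteq> pair_vars b" and i: "i \<le> a"
  shows "filter_mset is_base (base_mset a i + mset_set S) = base_mset a i"
    "filter_mset (\<lambda>v. \<not> is_base v) (base_mset a i + mset_set S) = mset_set S"
    "base_block a p (base_mset a i) = p i"
    "monom_eval (all_vars b) w (base_mset a i + mset_set S) =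
       w X0 ^ i * w Y0 ^ (a - i) / (fact i * fact (a - i)) * (\<Prod>v\<in>S. w v)"
proof -
  have fin: "finite S" by (rule finite_subset[OF S finite_pair_vars])
  have nb: "\<And>v. v \<in> S \<Longrightarrow> \<not> is_base v" using S pair_vars_not_base by auto
  have XY: "X0 \<notin> S" "Y0 \<notin> S" using nb[of X0] nb[of Y0] by auto
  have "filter_mset is_base (mset_set S) = mset_set {v \<in> S. is_base v}" using fin by simp
  also have "{v \<in> S. is_base v} = {}" using nb by auto
  finally have "filter_mset is_base (mset_set S) = {#}" by simp
  moreover have "filter_mset (\<lambda>v. \<not> is_base v) (mset_set S) = mset_set {v \<in> S. \<not> is_base v}" using fin by simp
  moreover have "{v \<in> S. \<not> is_base v} = S" using nb by auto
  moreover have "filter_mset is_base (base_mset a i) = base_mset a i" "filter_mset (\<lambda>v. \<not> is_base v) (base_mset a i) = {#}"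
  proof -
    have "filter_mset f (replicate_mset n v) = (if f v then replicate_mset n v else {#})" for f n and v :: var
      by (induction n) auto
    then show "filter_mset is_base (base_mset a i) = base_mset a i" "filter_mset (\<lambda>v. \<not> is_base v) (base_mset a i) = {#}"
      by (simp_all add: base_mset_def)
  qed
  ultimately show "filter_mset is_base (base_mset a i + mset_set S) = base_mset a i"
    "filter_mset (\<lambda>v. \<not> is_base v) (base_mset a i + mset_set S) = mset_set S" by simp_all
  show "base_block a p (base_mset a i) = p i"
    using i by (auto simp: base_block_def base_mset_def split: if_splits)
  let ?\<alpha> = "base_mset a i + mset_set S"
  have "(\<Prod>v\<in>all_vars b. fact (count ?\<alpha> v) :: real) = (\<Prod>v\<in>{X0, Y0}. fact (count ?\<alpha> v)) * (\<Prod>v\<in>pair_vars b. fact (count ?\<alpha> v))"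
    unfolding all_vars_def by (rule prod.union_disjoint) (auto simp: pair_vars_def)
  also have "(\<Prod>v\<in>pair_vars b. fact (count ?\<alpha> v) :: real) = 1"
  proof (rule prod.neutral, rule ballI)
    fix v assume "v \<in> pair_vars b"
    then have "v \<noteq> X0" "v \<noteq> Y0" by (auto simp: pair_vars_def)
    then show "fact (count ?\<alpha> v) = (1::real)" using fin by (simp add: base_mset_def count_mset_set')
  qed
  also have "(\<Prod>v\<in>{X0, Y0}. fact (count ?\<alpha> v) :: real) = fact i * fact (a - i)"
    using XY fin by (simp add: base_mset_def count_mset_set')
  finally show "monom_eval (all_vars b) w ?\<alpha> =
       w X0 ^ i * w Y0 ^ (a - i) / (fact i * fact (a - i)) * (\<Prod>v\<in>S. w v)"
    using fin by (simp add: monom_eval_def base_mset_def prod_unfold_prod_mset)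
qed

text \<open>A multiset in the support splits uniquely into a base part, given by an exponent
  \<open>i\<close>, and a set of pair variables, so the sum of monomial values factors.\<close>

lemma joint_block_eval:
  assumes w: "w X0 = x + u" "w Y0 = y + u" "\<And>j. w (XA j) = x" "\<And>j. w (XB j) = u"
    "\<And>j. w (YA j) = y" "\<And>j. w (YB j) = u"
  shows "(dir_deriv (all_vars b) w ^^ (a + 3 * b)) (joint_block a b p q) {#} =
    fact (a + 3 * b) * (\<Sum>i\<le>a. p i * ((x + u) ^ i * (y + u) ^ (a - i) / (fact i * fact (a - i)))) *
     (\<Sum>j\<le>b. q j * real (b choose j) * ((x * u) ^ j * (x + u) ^ (b - j) * ((y * u) ^ (b - j) * (y + u) ^ j)))"
proof -
  let ?SS = "{S. covers b S \<and> card S = 3 * b}"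
  let ?h = "\<lambda>(i, S). base_mset a i + mset_set S"
  have SS: "S \<subseteq> pair_vars b" if "S \<in> ?SS" for S using that by (auto simp: covers_def)
  have finSS: "finite ?SS" by (rule finite_subset[of _ "Pow (pair_vars b)"]) (auto simp: covers_def)
  have inj: "inj_on ?h ({..a} \<times> ?SS)"
  proof (rule inj_onI)
    fix z z' assume z: "z \<in> {..a} \<times> ?SS" "z' \<in> {..a} \<times> ?SS" and hz: "?h z = ?h z'"
    obtain i S i' S' where zz': "z = (i, S)" "z' = (i', S')" by (metis prod.exhaust)
    have i: "i \<in> {..a}" "i' \<in> {..a}" and S: "covers b S" "covers b S'"
      and eq: "base_mset a i + mset_set S = base_mset a i' + mset_set S'"
      using z hz by (simp_all add: zz')
    have sub: "S \<subseteq> pair_vars b" "S' \<subseteq> pair_vars b" using S by (auto simp: covers_def)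
    have "base_mset a i = base_mset a i'" "mset_set S = mset_set S'"
      using base_mset_plus_pairs(1,2)[OF sub(1), of i a] base_mset_plus_pairs(1,2)[OF sub(2), of i' a] i eq by auto
    moreover have "count (base_mset a n) X0 = n" for n by (simp add: base_mset_def)
    moreover have "finite S" "finite S'" using sub by (auto intro: finite_subset[OF _ finite_pair_vars])
    ultimately show "z = z'" unfolding zz' by (metis finite_set_mset_mset_set)
  qed
  have "(dir_deriv (all_vars b) w ^^ (a + 3 * b)) (joint_block a b p q) {#} =
      fact (a + 3 * b) * (\<Sum>\<alpha>\<in>?h ` ({..a} \<times> ?SS). joint_block a b p q \<alpha> * monom_eval (all_vars b) w \<alpha>)"
  proof (rule dir_deriv_pow_eval)
    show "\<alpha> \<in> ?h ` ({..a} \<times> ?SS)" if nz: "joint_block a b p q \<alpha> \<noteq> 0" for \<alpha>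
    proof -
      let ?B = "filter_mset is_base \<alpha>"
      have "base_block a p ?B \<noteq> 0" "pair_block b q (filter_mset (\<lambda>v. \<not> is_base v) \<alpha>) \<noteq> 0"
        using nz by (auto simp: joint_block_def tensor_def)
      moreover from this(2) obtain S where S: "filter_mset (\<lambda>v. \<not> is_base v) \<alpha> = mset_set S" "S \<in> ?SS"
        by (auto elim: pair_block_nonzeroE)
      ultimately have B: "set_mset ?B \<subseteq> {X0, Y0}" "size ?B = a" by (auto simp: base_block_def split: if_splits)
      have sz: "count ?B X0 + count ?B Y0 = a" using size_supported_pair[OF B(1)] B(2) by simp
      have "?B = base_mset a (count ?B X0)"
      proof (rule multiset_eqI)
        fix v show "count ?B v = count (base_mset a (count ?B X0)) v"
          using sz by (cases v) (auto simp: base_mset_def)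
      qed
      then have "\<alpha> = ?h (count ?B X0, S)"
        using multiset_partition[of \<alpha> is_base] S(1) by (metis (no_types, lifting) case_prod_conv)
      moreover have "count ?B X0 \<le> a" using sz by simp
      ultimately show ?thesis using S(2) by (intro image_eqI[of _ _ "(count ?B X0, S)"]) auto
    qed
    show "size \<alpha> = a + 3 * b \<and> set_mset \<alpha> \<subseteq> all_vars b" if "\<alpha> \<in> ?h ` ({..a} \<times> ?SS)" for \<alpha>
    proof -
      from that obtain i S where \<alpha>: "\<alpha> = base_mset a i + mset_set S" "i \<le> a" "S \<in> ?SS" by auto
      moreover have "finite S" by (rule finite_subset[OF SS[OF \<alpha>(3)] finite_pair_vars])
      ultimately show ?thesis using SS[OF \<alpha>(3)] by (auto simp: base_mset_def all_vars_def split: if_splits)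
    qed
  qed (use finSS in auto)
  also have "(\<Sum>\<alpha>\<in>?h ` ({..a} \<times> ?SS). joint_block a b p q \<alpha> * monom_eval (all_vars b) w \<alpha>) =
      (\<Sum>z\<in>{..a} \<times> ?SS. joint_block a b p q (?h z) * monom_eval (all_vars b) w (?h z))"
    by (subst sum.reindex[OF inj]) simp
  also have "\<dots> = (\<Sum>z\<in>{..a} \<times> ?SS. (case z of (i, S) \<Rightarrow>
      (p i * ((x + u) ^ i * (y + u) ^ (a - i) / (fact i * fact (a - i)))) *
      (pair_block b q (mset_set S) * (\<Prod>v\<in>S. w v))))"
  proof (intro sum.cong refl)
    fix z assume z: "z \<in> {..a} \<times> ?SS"
    obtain i S where zi: "z = (i, S)" by (metis prod.exhaust)
    have i: "i \<le> a" and S: "S \<subseteq> pair_vars b" using z by (auto simp: zi covers_def)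
    show "joint_block a b p q (?h z) * monom_eval (all_vars b) w (?h z) = (case z of (i, S) \<Rightarrow>
       (p i * ((x + u) ^ i * (y + u) ^ (a - i) / (fact i * fact (a - i)))) *
      (pair_block b q (mset_set S) * (\<Prod>v\<in>S. w v)))"
      using base_mset_plus_pairs[OF S i] by (simp add: joint_block_def tensor_def w zi)
  qed
  also have "\<dots> = (\<Sum>i\<le>a. p i * ((x + u) ^ i * (y + u) ^ (a - i) / (fact i * fact (a - i)))) *
      (\<Sum>S\<in>?SS. pair_block b q (mset_set S) * (\<Prod>v\<in>S. w v))"
    by (simp add: sum_product sum.cartesian_product)
  finally show ?thesis using sum_pair_block[of w x u y b q, OF w(3-6)] by (simp add: mult.assoc)
qed

definition bullet_sum :: "nat \<Rightarrow> nat \<Rightarrow> (nat \<Rightarrow> real) \<Rightarrow> (nat \<Rightarrow> real) \<Rightarrow> nat \<Rightarrow> real" where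
  "bullet_sum a b p q k = (\<Sum>i\<le>a. \<Sum>j\<le>b. p i * q j * real (bullet_coeff a b i j k))"

text \<open>With \<open>y = 1\<close>, the value in direction
  \<open>dir_y + x * dir_x + u * dir_u\<close> is computed by \<open>dir_deriv_binomial\<close> and
  by \<open>joint_block_eval\<close>. Comparing coefficients in \<open>u\<close> and then in
  \<open>x\<close> isolates one mixed derivative.\<close>

lemma joint_block_derivatives:
  fixes p q :: "nat \<Rightarrow> real"
  assumes k: "k \<le> a + b"
  defines "P \<equiv> \<lambda>i. real (a choose i) * p i" and "Q \<equiv> \<lambda>j. real (b choose j) * q j"
    and "D \<equiv> dir_deriv (all_vars b)"
  shows "real (a + 3 * b choose (2 * b)) * real (a + b choose k) *
      (D dir_x ^^ k) ((D dir_y ^^ (a + b - k)) ((D dir_u ^^ (2 * b)) (joint_block a b p q))) {#} =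
    fact (a + 3 * b) / fact a * bullet_sum a b P Q k"
proof -
  let ?F = "joint_block a b p q" and ?N = "a + 3 * b"
  define G where "G = (D dir_u ^^ (2 * b)) ?F"
  define M where "M x = (\<Sum>i\<le>a. \<Sum>j\<le>b. smult (P i * Q j * x ^ j) ([:x, 1:] ^ (b + i - j) * [:1, 1:] ^ (a + j - i)))" for x
  have eq_u: "(\<Sum>m\<le>?N. monom (real (?N choose m) * (D (\<lambda>v. dir_y v + x * dir_x v) ^^ (?N - m)) ((D dir_u ^^ m) ?F) {#}) m) =
      smult (fact ?N / fact a) (monom 1 b * M x)" (is "?L = ?R") for x
  proof -
    have "poly ?L u = poly ?R u" for u
    proof -
      define w where "w v = (dir_y v + x * dir_x v) + u * dir_u v" for v
      have "poly ?L u = (D w ^^ ?N) ?F {#}"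
        unfolding D_def w_def dir_deriv_binomial by (simp add: poly_sum poly_monom mult_ac)
      also have "\<dots> = fact ?N * (\<Sum>i\<le>a. p i * ((x + u) ^ i * (1 + u) ^ (a - i) / (fact i * fact (a - i)))) *
         (\<Sum>j\<le>b. q j * real (b choose j) * ((x * u) ^ j * (x + u) ^ (b - j) * ((1 * u) ^ (b - j) * (1 + u) ^ j)))"
        unfolding D_def by (rule joint_block_eval) (simp_all add: w_def dir_x_def dir_y_def dir_u_def)
      also have "\<dots> = fact ?N * (\<Sum>i\<le>a. \<Sum>j\<le>b. p i * ((x + u) ^ i * (1 + u) ^ (a - i) / (fact i * fact (a - i))) *
         (q j * real (b choose j) * ((x * u) ^ j * (x + u) ^ (b - j) * ((1 * u) ^ (b - j) * (1 + u) ^ j))))"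
        by (simp only: sum_product mult.assoc)
      also have "\<dots> = fact ?N * (\<Sum>i\<le>a. \<Sum>j\<le>b. 1 / fact a * (u ^ b * (P i * Q j * x ^ j * ((x + u) ^ (b + i - j) * (1 + u) ^ (a + j - i)))))"
      proof (intro arg_cong[where f = "\<lambda>t. fact ?N * t"] sum.cong refl)
        fix i j assume "i \<in> {..a}" "j \<in> {..b}"
        then have i: "i \<le> a" and j: "j \<le> b" by auto
        have "(x + u) ^ (b + i - j) = (x + u) ^ i * (x + u) ^ (b - j)"
          using j by (simp add: power_add[symmetric] add.commute)
        moreover have "(1 + u) ^ (a + j - i) = (1 + u) ^ (a - i) * (1 + u) ^ j"
          using i by (simp add: power_add[symmetric])
        moreover have "u ^ b = u ^ j * u ^ (b - j)" using j by (simp add: power_add[symmetric])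
        moreover have "p i / (fact i * fact (a - i)) = P i / fact a"
          using i by (simp add: P_def binomial_fact)
        ultimately show "p i * ((x + u) ^ i * (1 + u) ^ (a - i) / (fact i * fact (a - i))) *
         (q j * real (b choose j) * ((x * u) ^ j * (x + u) ^ (b - j) * ((1 * u) ^ (b - j) * (1 + u) ^ j))) =
         1 / fact a * (u ^ b * (P i * Q j * x ^ j * ((x + u) ^ (b + i - j) * (1 + u) ^ (a + j - i))))"
          by (simp add: Q_def power_mult_distrib field_simps)
      qed
      also have "\<dots> = poly ?R u"
        by (simp add: M_def poly_sum poly_monom sum_distrib_left mult_ac add.commute)
      finally show ?thesis .
    qed
    then show ?thesis using poly_eq_poly_eq_iff by blast
  qed
  have eq_x: "real (?N choose (2 * b)) * (D (\<lambda>v. dir_y v + x * dir_x v) ^^ (a + b)) G {#} =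
      fact ?N / fact a * (\<Sum>k\<le>a + b. bullet_sum a b P Q k * x ^ k)" for x
  proof -
    \<comment> \<open>The index is \<open>2 * b\<close> because the factor \<open>u^b\<close>
      precedes \<open>M x\<close>, of which coefficient \<open>b\<close> is wanted.\<close>
    have "coeff (\<Sum>m\<le>?N. monom (real (?N choose m) * (D (\<lambda>v. dir_y v + x * dir_x v) ^^ (?N - m)) ((D dir_u ^^ m) ?F) {#}) m) (2 * b) =
        real (?N choose (2 * b)) * (D (\<lambda>v. dir_y v + x * dir_x v) ^^ (?N - 2 * b)) ((D dir_u ^^ (2 * b)) ?F) {#}"
      by (simp add: coeff_sum)
    moreover have "?N - 2 * b = a + b" by simp
    moreover have "coeff (smult (fact ?N / fact a) (monom 1 b * M x)) (2 * b) = fact ?N / fact a * coeff (M x) b"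
      by (simp add: coeff_monom_mult)
    moreover have "coeff (M x) b = (\<Sum>k\<le>a + b. bullet_sum a b P Q k * x ^ k)"
    proof -
      have "coeff (M x) b = (\<Sum>i\<le>a. \<Sum>j\<le>b. P i * Q j * (x ^ j * 1 ^ (b - j) * coeff ([:x, 1:] ^ (b + i - j) * [:1, 1:] ^ (a + j - i)) b))"
        by (simp add: M_def coeff_sum mult_ac)
      also have "\<dots> = (\<Sum>i\<le>a. \<Sum>j\<le>b. P i * Q j * (\<Sum>k\<le>a + b. real (bullet_coeff a b i j k) * (x ^ k * 1 ^ (a + b - k))))"
        by (intro sum.cong refl) (subst coeff_shifted_product, auto)
      also have "\<dots> = (\<Sum>i\<le>a. \<Sum>j\<le>b. \<Sum>k\<le>a + b. P i * Q j * real (bullet_coeff a b i j k) * x ^ k)"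
        by (simp add: sum_distrib_left mult.assoc)
      also have "\<dots> = (\<Sum>i\<le>a. \<Sum>k\<le>a + b. \<Sum>j\<le>b. P i * Q j * real (bullet_coeff a b i j k) * x ^ k)"
        by (intro sum.cong refl sum.swap)
      also have "\<dots> = (\<Sum>k\<le>a + b. \<Sum>i\<le>a. \<Sum>j\<le>b. P i * Q j * real (bullet_coeff a b i j k) * x ^ k)"
        by (rule sum.swap)
      finally show ?thesis by (simp add: bullet_sum_def sum_distrib_right)
    qed
    ultimately show ?thesis using eq_u[of x] by (simp add: G_def)
  qed
  have "(\<Sum>k\<le>a + b. monom (real (?N choose (2 * b)) * real (a + b choose k) * (D dir_y ^^ (a + b - k)) ((D dir_x ^^ k) G) {#}) k) =
      (\<Sum>k\<le>a + b. monom (fact ?N / fact a * bullet_sum a b P Q k) k)" (is "?L = ?R")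
  proof -
    have "poly ?L x = poly ?R x" for x
      using eq_x[of x] unfolding D_def dir_deriv_binomial
      by (simp add: poly_sum poly_monom sum_distrib_left mult_ac)
    then show ?thesis using poly_eq_poly_eq_iff by blast
  qed
  then have "coeff ?L k = coeff ?R k" by simp
  then have "real (?N choose (2 * b)) * real (a + b choose k) * (D dir_y ^^ (a + b - k)) ((D dir_x ^^ k) G) {#} =
      fact ?N / fact a * bullet_sum a b P Q k"
    using k by (simp add: coeff_sum)
  moreover have "(D dir_y ^^ m) ((D dir_x ^^ n) H) = (D dir_x ^^ n) ((D dir_y ^^ m) H)" for m n H
    unfolding D_def by (induction m) (simp_all add: dir_deriv_pow_commute)
  ultimately show ?thesis by (simp add: G_def)
qed

text \<open>Up to a constant \<open>K\<close> independent of \<open>k\<close>, the normalised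
  coefficients are mixed derivatives \<open>\<Psi> k\<close>. Stopping two derivatives earlier gives
  a Lorentzian quadratic form \<open>H\<close>, and the claim is its reverse Cauchy inequality for
  \<open>dir_y\<close> and \<open>dir_x\<close>.\<close>

lemma bullet_sum_log_concave:
  assumes p: "log_concave_upto a p" and q: "log_concave_upto b q" and k: "k + 2 \<le> a + b"
  defines "c \<equiv> \<lambda>k. bullet_sum a b (\<lambda>i. real (a choose i) * p i) (\<lambda>j. real (b choose j) * q j) k / real (a + b choose k)"
  shows "c k * c (k + 2) \<le> (c (k + 1))\<^sup>2"
proof -
  define D where "D = dir_deriv (all_vars b)"
  define F where "F = joint_block a b p q"
  define \<Psi> where "\<Psi> k = (D dir_x ^^ k) ((D dir_y ^^ (a + b - k)) ((D dir_u ^^ (2 * b)) F)) {#}" for k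
  define K where "K = fact a * real (a + 3 * b choose (2 * b)) / fact (a + 3 * b)"
  have c: "c k = K * \<Psi> k" if "k \<le> a + b" for k
  proof -
    have "real (a + b choose k) \<noteq> 0" using that by simp
    then show ?thesis
      using joint_block_derivatives[OF that, of p q] unfolding c_def K_def \<Psi>_def D_def F_def
      by (simp add: field_simps)
  qed
  define m where "m = a + b - (k + 2)"
  define H where "H = (D dir_x ^^ k) ((D dir_y ^^ m) ((D dir_u ^^ (2 * b)) F))"
  have nn: "dir_x v \<ge> 0" "dir_y v \<ge> 0" "dir_u v \<ge> 0" for v
    by (auto simp: dir_x_def dir_y_def dir_u_def split: var.split)
  have "2 * b + (m + (k + 2)) = a + 3 * b" using k by (simp add: m_def)
  then have "lor (all_vars b) (2 * b + (m + (k + 2))) F"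
    using lor_joint_block[OF p q] by (simp only: F_def)
  then have "lor (all_vars b) 2 H" unfolding H_def D_def
    by (intro lor_dir_deriv_pow finite_all_vars nn)
  from lor_two_reverse_cauchy[OF this nn(1), of dir_y]
  have "D dir_y (D dir_y H) {#} * D dir_x (D dir_x H) {#} \<le> (D dir_y (D dir_x H) {#})\<^sup>2"
    by (simp add: D_def)
  moreover have "D dir_x (D dir_x H) {#} = \<Psi> (k + 2)" by (simp add: H_def \<Psi>_def m_def)
  moreover have "D dir_y (D dir_x H) {#} = \<Psi> (k + 1)"
  proof -
    have "D dir_y (D dir_x H) = (D dir_x ^^ Suc k) (D dir_y ((D dir_y ^^ m) ((D dir_u ^^ (2 * b)) F)))"
      unfolding H_def D_def by (metis dir_deriv_pow_commute funpow.simps(2) comp_apply)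
    also have "D dir_y ((D dir_y ^^ m) ((D dir_u ^^ (2 * b)) F)) = (D dir_y ^^ Suc m) ((D dir_u ^^ (2 * b)) F)" by simp
    also have "Suc m = a + b - (k + 1)" using k by (simp add: m_def)
    finally show ?thesis by (simp add: \<Psi>_def)
  qed
  moreover have "D dir_y (D dir_y H) {#} = \<Psi> k"
  proof -
    have "D dir_y (D dir_y H) = (D dir_x ^^ k) (D dir_y (D dir_y ((D dir_y ^^ m) ((D dir_u ^^ (2 * b)) F))))"
      unfolding H_def D_def by (simp only: dir_deriv_pow_commute[where w = dir_y and w' = dir_x])
    also have "D dir_y (D dir_y ((D dir_y ^^ m) ((D dir_u ^^ (2 * b)) F))) = (D dir_y ^^ Suc (Suc m)) ((D dir_u ^^ (2 * b)) F)" by simp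
    also have "Suc (Suc m) = a + b - k" using k by (simp add: m_def)
    finally show ?thesis by (simp add: \<Psi>_def)
  qed
  ultimately have "\<Psi> k * \<Psi> (k + 2) \<le> (\<Psi> (k + 1))\<^sup>2" by simp
  then have "K\<^sup>2 * (\<Psi> k * \<Psi> (k + 2)) \<le> K\<^sup>2 * (\<Psi> (k + 1))\<^sup>2" by (rule mult_left_mono) simp
  then show ?thesis using c[of k] c[of "k + 1"] c[of "k + 2"] k
    by (simp add: power2_eq_square mult_ac)
qed

section \<open>Stability\<close>

text \<open>Three Vandermonde convolutions. The first expands \<open>x + k choose m + n\<close> over
  \<open>l\<close>. After \<open>(A choose k) * (k choose l) = (A choose l) * (A - l choose (k -
  l))\<close> the second sums over \<open>k\<close> to \<open>m + n - l choose m\<close>, which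
  combines with \<open>x choose (m + n - l)\<close> into
  \<open>(x choose m) * (x - m choose (n - l))\<close>. The third sums over
  \<open>l\<close>.\<close>

lemma nanjundiah:
  assumes AB: "A + B = m + n" and xy: "m \<le> x" "A + (x - m) = y"
  shows "(\<Sum>k\<le>n. (A choose k) * (B choose (n - k)) * ((x + k) choose (m + n))) = (x choose m) * (y choose n)"
proof -
  have term_eq: "(A choose k) * (B choose (n - k)) * ((x + k) choose (m + n)) =
      (\<Sum>l\<le>n. if l \<le> k then (A choose l) * (x choose (m + n - l)) * ((A - l choose (k - l)) * (B choose (n - k))) else 0)"
    if k: "k \<le> n" for k
  proof -
    have "(x + k) choose (m + n) = (\<Sum>l\<le>m + n. (k choose l) * (x choose (m + n - l)))"
      using vandermonde[of k x "m + n"] by (simp add: add.commute)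
    also have "\<dots> = (\<Sum>l\<le>n. (k choose l) * (x choose (m + n - l)))"
      using k by (intro sum.mono_neutral_right) auto
    finally have "(A choose k) * (B choose (n - k)) * ((x + k) choose (m + n)) =
        (\<Sum>l\<le>n. (A choose k) * (k choose l) * ((x choose (m + n - l)) * (B choose (n - k))))"
      by (simp add: sum_distrib_left mult_ac)
    also have "\<dots> = (\<Sum>l\<le>n. if l \<le> k then (A choose l) * (x choose (m + n - l)) * ((A - l choose (k - l)) * (B choose (n - k))) else 0)"
    proof (intro sum.cong refl)
      fix l
      have "(A choose k) * (k choose l) = (A choose l) * (A - l choose (k - l))" if "l \<le> k"
      proof (cases "k \<le> A")
        case True
        then show ?thesis using choose_mult[OF that, of A] by simp
      next
        case False
        then show ?thesis using that by (cases "l \<le> A") (auto simp: binomial_eq_0)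
      qed
      then show "(A choose k) * (k choose l) * ((x choose (m + n - l)) * (B choose (n - k))) =
          (if l \<le> k then (A choose l) * (x choose (m + n - l)) * ((A - l choose (k - l)) * (B choose (n - k))) else 0)"
        by (cases "l \<le> k") (auto simp: mult_ac binomial_eq_0)
    qed
    finally show ?thesis .
  qed
  have inner: "(\<Sum>k\<le>n. if l \<le> k then (A choose l) * (x choose (m + n - l)) * ((A - l choose (k - l)) * (B choose (n - k))) else 0) =
      (x choose m) * ((A choose l) * (x - m choose (n - l)))" if l: "l \<le> n" for l
  proof -
    have "(\<Sum>k\<le>n. if l \<le> k then (A choose l) * (x choose (m + n - l)) * ((A - l choose (k - l)) * (B choose (n - k))) else 0) =
        (\<Sum>k\<in>{l..n}. (A choose l) * (x choose (m + n - l)) * ((A - l choose (k - l)) * (B choose (n - k))))"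
      by (intro sum.mono_neutral_cong_right) auto
    also have "\<dots> = (\<Sum>k\<le>n - l. (A choose l) * (x choose (m + n - l)) * ((A - l choose k) * (B choose (n - l - k))))"
      by (rule sum.reindex_bij_witness[of _ "\<lambda>k. k + l" "\<lambda>k. k - l"]) (use l in auto)
    also have "\<dots> = (A choose l) * (x choose (m + n - l)) * (A - l + B choose (n - l))"
      by (simp only: sum_distrib_left[symmetric] vandermonde)
    also have "\<dots> = (x choose m) * ((A choose l) * (x - m choose (n - l)))"
    proof (cases "l \<le> A")
      case True
      have "A - l + B = m + n - l" using True AB by simp
      moreover have "(m + n - l) choose (n - l) = (m + n - l) choose m"
        using l binomial_symmetric[of m "m + n - l"] by simp
      moreover have "(x choose (m + n - l)) * ((m + n - l) choose m) = (x choose m) * (x - m choose (n - l))"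
      proof (cases "m + n - l \<le> x")
        case True
        then show ?thesis using choose_mult[of m "m + n - l" x] l by simp
      next
        case False
        then have "x choose (m + n - l) = 0" "x - m choose (n - l) = 0" using l xy(1) by (auto intro!: binomial_eq_0)
        then show ?thesis by (simp only: mult_zero_left mult_zero_right)
      qed
      ultimately show ?thesis by (simp add: mult_ac)
    next
      case False
      then show ?thesis by (simp add: binomial_eq_0)
    qed
    finally show ?thesis .
  qed
  have "(\<Sum>k\<le>n. (A choose k) * (B choose (n - k)) * ((x + k) choose (m + n))) =
      (\<Sum>k\<le>n. \<Sum>l\<le>n. if l \<le> k then (A choose l) * (x choose (m + n - l)) * ((A - l choose (k - l)) * (B choose (n - k))) else 0)"
    by (intro sum.cong refl term_eq) simp
  also have "\<dots> = (\<Sum>l\<le>n. \<Sum>k\<le>n. if l \<le> k then (A choose l) * (x choose (m + n - l)) * ((A - l choose (k - l)) * (B choose (n - k))) else 0)"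
    by (rule sum.swap)
  also have "\<dots> = (\<Sum>l\<le>n. (x choose m) * ((A choose l) * (x - m choose (n - l))))"
    by (intro sum.cong refl inner) simp
  also have "\<dots> = (x choose m) * (y choose n)"
    by (simp add: sum_distrib_left[symmetric] vandermonde xy(2))
  finally show ?thesis .
qed

text \<open>At integers \<open>t \<ge> a + b\<close> all values are binomials of natural numbers and
  \<open>nanjundiah\<close> applies; infinitely many agreements make the polynomials equal.\<close>

lemma binom_poly_mult:
  assumes i: "i \<le> a" and j: "j \<le> b"
  shows "binom_poly a i * binom_poly b j =
    (\<Sum>k\<le>a + b. smult (real (bullet_coeff a b i j k)) (binom_poly (a + b) k))" (is "?L = ?R")
proof (rule ccontr)
  assume "?L \<noteq> ?R"
  then have "?L - ?R \<noteq> 0" by (metis right_minus_eq)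
  then have "finite {x. poly (?L - ?R) x = 0}" by (rule poly_roots_finite)
  moreover have "real ` {a + b..} \<subseteq> {x. poly (?L - ?R) x = 0}"
  proof (rule image_subsetI)
    fix t assume "t \<in> {a + b..}"
    then have t: "a + b \<le> t" by simp
    have pb: "poly (binom_poly d k) (real t) = real ((t + d - k) choose d)" if "k \<le> a + b" for d k
    proof -
      have "real t + real d - real k = real (t + d - k)" using that t by simp
      then show ?thesis unfolding poly_binom_poly binomial_gbinomial by (rule arg_cong)
    qed
    have "poly ?R (real t) = (\<Sum>k\<le>a + b. real (bullet_coeff a b i j k) * real ((t + (a + b) - k) choose (a + b)))"
      by (simp add: poly_sum pb)
    also have "\<dots> = (\<Sum>r\<le>b. real ((b + i - j choose r) * (a + j - i choose (b - r))) * real ((t + (a + b) - (i + b - r)) choose (a + b)))"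
      by (rule sum_bullet_coeff[OF i j])
    also have "\<dots> = real (\<Sum>r\<le>b. (b + i - j choose r) * (a + j - i choose (b - r)) * (((t + a - i) + r) choose (a + b)))"
      unfolding of_nat_sum of_nat_mult
    proof (intro sum.cong refl)
      fix r assume "r \<in> {..b}"
      then have "t + (a + b) - (i + b - r) = t + a - i + r" using t i by simp
      then show "real (b + i - j choose r) * real (a + j - i choose (b - r)) * real ((t + (a + b) - (i + b - r)) choose (a + b)) =
        real (b + i - j choose r) * real (a + j - i choose (b - r)) * real ((t + a - i + r) choose (a + b))" by simp
    qed
    also have "(\<Sum>r\<le>b. (b + i - j choose r) * (a + j - i choose (b - r)) * (((t + a - i) + r) choose (a + b))) =
        (t + a - i choose a) * (t + b - j choose b)"
      by (rule nanjundiah) (use i j t in auto)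
    finally have "poly ?R (real t) = poly ?L (real t)" using pb[of i a] pb[of j b] i j by simp
    then show "real t \<in> {x. poly (?L - ?R) x = 0}" by (simp only: mem_Collect_eq poly_diff right_minus_eq)
  qed
  ultimately have "finite (real ` {a + b..})" using finite_subset by blast
  then show False by (simp add: finite_image_iff infinite_Ici)
qed

section \<open>Bivariate forms as coefficient sequences\<close>

definition bipoly :: "nat \<Rightarrow> (nat \<Rightarrow> real) \<Rightarrow> 2 rmpoly" where
  "bipoly d c = (\<Sum>i\<le>d. xy_monom i (d - i) (c i))"

definition bicoeff :: "nat \<Rightarrow> 2 rmpoly \<Rightarrow> nat \<Rightarrow> real" where
  "bicoeff d p i = lookup p (single 1 i + single 2 (d - i))"

lemma homogeneous_bipoly: "homogeneous d (bipoly d c)"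
  by (auto simp: bipoly_def homogeneous_def UNIV_type_2 in_keys_iff lookup_xy_monom_sum split: if_splits)

lemma lookup_bipoly:
  "lookup (bipoly d c) \<alpha> = (if lookup \<alpha> 1 + lookup \<alpha> 2 = d then c (lookup \<alpha> 1) else 0)"
  unfolding bipoly_def by (rule lookup_xy_monom_sum)

lemma bipoly_bicoeff:
  assumes "homogeneous d p"
  shows "bipoly d (bicoeff d p) = p"
proof (rule poly_mapping_eqI)
  fix \<alpha> :: "2 \<Rightarrow>\<^sub>0 nat"
  have "lookup p \<alpha> = 0" if "lookup \<alpha> 1 + lookup \<alpha> 2 \<noteq> d"
    using assms that by (auto simp: homogeneous_def UNIV_type_2 in_keys_iff)
  moreover have "\<alpha> = single 1 (lookup \<alpha> 1) + single 2 (lookup \<alpha> 2)" by (simp add: xy_eta)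
  ultimately show "lookup (bipoly d (bicoeff d p)) \<alpha> = lookup p \<alpha>"
    unfolding lookup_bipoly bicoeff_def by (metis diff_add_inverse)
qed

lemma T_inv_bipoly: "T_inv d (bipoly d c) = (\<Sum>i\<le>d. smult (c i) (binom_poly d i))"
proof -
  let ?f = "\<Sum>i\<le>d. smult (c i) (binom_poly d i)"
  have "degree ?f \<le> d" by (rule degree_sum_le) (auto simp: degree_binom_poly)
  moreover have "inj_on (T_map d) {f. degree f \<le> d}" using bij_betw_T_map by (rule bij_betw_imp_inj_on)
  ultimately show ?thesis
    unfolding T_inv_def bipoly_def T_map_sum[symmetric] by (intro inv_into_f_f) auto
qed

lemma smult_sum_right: "smult c (\<Sum>i\<in>S. f i) = (\<Sum>i\<in>S. smult c (f i))"
  by (induction S rule: infinite_finite_induct) (simp_all add: smult_add_right)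

lemma bullet_bipoly: "bullet a b (bipoly a p) (bipoly b q) = bipoly (a + b) (bullet_sum a b p q)"
proof -
  have "(\<Sum>i\<le>a. smult (p i) (binom_poly a i)) * (\<Sum>j\<le>b. smult (q j) (binom_poly b j)) =
      (\<Sum>i\<le>a. \<Sum>j\<le>b. smult (p i * q j) (binom_poly a i * binom_poly b j))"
    by (simp add: sum_product mult_ac)
  also have "\<dots> = (\<Sum>i\<le>a. \<Sum>j\<le>b. \<Sum>k\<le>a + b. smult (p i * q j * real (bullet_coeff a b i j k)) (binom_poly (a + b) k))"
    by (intro sum.cong refl) (simp add: binom_poly_mult smult_sum_right)
  also have "\<dots> = (\<Sum>i\<le>a. \<Sum>k\<le>a + b. \<Sum>j\<le>b. smult (p i * q j * real (bullet_coeff a b i j k)) (binom_poly (a + b) k))"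
    by (intro sum.cong refl sum.swap)
  also have "\<dots> = (\<Sum>k\<le>a + b. \<Sum>i\<le>a. \<Sum>j\<le>b. smult (p i * q j * real (bullet_coeff a b i j k)) (binom_poly (a + b) k))"
    by (rule sum.swap)
  also have "\<dots> = (\<Sum>k\<le>a + b. smult (bullet_sum a b p q k) (binom_poly (a + b) k))"
    by (simp add: bullet_sum_def smult_sum)
  finally show ?thesis unfolding bullet_def T_inv_bipoly by (simp add: T_map_sum bipoly_def)
qed

definition bieval :: "nat \<Rightarrow> (nat \<Rightarrow> real) \<Rightarrow> complex \<Rightarrow> complex \<Rightarrow> complex" where
  "bieval d c x y = (\<Sum>i\<le>d. of_real (c i) * x ^ i * y ^ (d - i))"

lemma ceval_bipoly: "ceval (bipoly d c) z = bieval d c (z 1) (z 2)"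
proof -
  let ?m = "\<lambda>i. single (1::2) i + single 2 (d - i)"
  have l: "lookup (?m i) 1 = i" "lookup (?m i) 2 = d - i" for i
    by (auto simp: lookup_add lookup_single)
  have inj: "inj_on ?m {..d}" by (rule inj_on_inverseI[of _ "\<lambda>\<alpha>. lookup \<alpha> 1"]) (simp add: l)
  have "ceval (bipoly d c) z = (\<Sum>\<alpha>\<in>?m ` {..d}. complex_of_real (lookup (bipoly d c) \<alpha>) * (\<Prod>v\<in>UNIV. z v ^ lookup \<alpha> v))"
    unfolding ceval_def
  proof (rule sum.mono_neutral_left)
    show "keys (bipoly d c) \<subseteq> ?m ` {..d}"
    proof
      fix \<alpha> assume "\<alpha> \<in> keys (bipoly d c)"
      then have "lookup \<alpha> 1 + lookup \<alpha> 2 = d" by (auto simp: in_keys_iff lookup_bipoly split: if_splits)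
      then have "\<alpha> = ?m (lookup \<alpha> 1)" "lookup \<alpha> 1 \<le> d" using xy_eta[of \<alpha>] by auto
      then show "\<alpha> \<in> ?m ` {..d}" by blast
    qed
  qed (auto simp: in_keys_iff)
  also have "\<dots> = (\<Sum>i\<le>d. complex_of_real (lookup (bipoly d c) (?m i)) * (\<Prod>v\<in>UNIV. z v ^ lookup (?m i) v))"
    by (subst sum.reindex[OF inj]) simp
  also have "\<dots> = bieval d c (z 1) (z 2)"
    unfolding bieval_def by (intro sum.cong refl) (simp add: UNIV_type_2 lookup_bipoly l mult.assoc)
  finally show ?thesis .
qed

lemma stable_bipoly:
  "stable_poly (bipoly d c) \<longleftrightarrow> (\<forall>x y. Im x > 0 \<longrightarrow> Im y > 0 \<longrightarrow> bieval d c x y \<noteq> 0)"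
proof
  assume s: "stable_poly (bipoly d c)"
  show "\<forall>x y. Im x > 0 \<longrightarrow> Im y > 0 \<longrightarrow> bieval d c x y \<noteq> 0"
  proof (intro allI impI)
    fix x y :: complex assume "Im x > 0" "Im y > 0"
    then have "ceval (bipoly d c) (\<lambda>v. if v = 1 then x else y) \<noteq> 0" using s by (auto simp: stable_poly_def)
    then show "bieval d c x y \<noteq> 0" by (simp add: ceval_bipoly)
  qed
qed (auto simp: stable_poly_def ceval_bipoly)

lemma bieval_scale: "bieval d c (s * x) (s * y) = s ^ d * bieval d c x y"
  unfolding bieval_def sum_distrib_left
proof (intro sum.cong refl)
  fix i assume "i \<in> {..d}"
  then have "s ^ d = s ^ i * s ^ (d - i)" by (simp add: power_add[symmetric])
  then show "of_real (c i) * (s * x) ^ i * (s * y) ^ (d - i) = s ^ d * (of_real (c i) * x ^ i * y ^ (d - i))"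
    by (simp add: power_mult_distrib mult_ac)
qed

section \<open>Zero-free half-planes and stability of the product\<close>

lemma Im_inverse_neg:
  assumes "Im z > 0"
  shows "Im (1 / z) < 0"
proof -
  have "(Re z)\<^sup>2 + (Im z)\<^sup>2 > 0" using assms by (simp add: add_nonneg_pos)
  then show ?thesis using assms by (simp add: Im_divide divide_neg_pos)
qed

text \<open>The quotient is the sum of \<open>1 / (u - r)\<close> over the zeros \<open>r\<close>,
  all in the open lower half-plane, and every term has negative imaginary part. The induction splits
  off one zero at a time.\<close>

lemma logarithmic_derivative_im:
  fixes N :: "complex poly"
  assumes "\<And>u. Im u \<ge> 0 \<Longrightarrow> poly N u \<noteq> 0" and "Im u \<ge> 0"
  shows "Im (poly (pderiv N) u / poly N u) \<le> 0 \<and> (degree N > 0 \<longrightarrow> Im (poly (pderiv N) u / poly N u) < 0)"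
  using assms(1)
proof (induction "degree N" arbitrary: N)
  case 0
  then have "pderiv N = 0" by (simp add: pderiv_eq_0_iff)
  then show ?case using 0 by simp
next
  case (Suc n)
  have "\<not> constant (poly N)" using Suc(2) constant_degree[of N] by simp
  then obtain r where r: "poly N r = 0" using fundamental_theorem_of_algebra by blast
  then have imr: "Im r < 0" using Suc.prems[of r] by linarith
  obtain Q where Q: "N = [:- r, 1:] * Q" using r by (metis dvdE poly_eq_0_iff_dvd)
  have "Q \<noteq> 0" using Q Suc.hyps(2) by auto
  then have "degree N = degree [:- r, 1:] + degree Q" unfolding Q by (intro degree_mult_eq) auto
  then have dQ: "degree Q = n" using Suc.hyps(2) by simp
  have Qnz: "\<And>v. Im v \<ge> 0 \<Longrightarrow> poly Q v \<noteq> 0" using Suc.prems Q by auto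
  have IH: "Im (poly (pderiv Q) u / poly Q u) \<le> 0" using Suc.hyps(1)[OF dQ[symmetric] Qnz] by blast
  have ur: "Im (u - r) > 0" using imr assms(2) by simp
  then have nz: "u - r \<noteq> 0" by auto
  have "poly (pderiv N) u = poly Q u + (u - r) * poly (pderiv Q) u"
    unfolding Q pderiv_mult by (simp add: pderiv_pCons algebra_simps)
  then have "poly (pderiv N) u / poly N u = 1 / (u - r) + poly (pderiv Q) u / poly Q u"
    using nz Qnz[OF assms(2)] unfolding Q by (simp add: field_simps)
  moreover have "Im (1 / (u - r)) < 0"
    using ur by (rule Im_inverse_neg)
  ultimately show ?case using IH by simp
qed

text \<open>By Gauss--Lucas all derivatives are zero-free in the closed upper half-plane, in particular at 0.\<close>

lemma coeff_nonzero_if_no_upper_zeros: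
  fixes N :: "complex poly"
  assumes "\<And>u. Im u \<ge> 0 \<Longrightarrow> poly N u \<noteq> 0" "k \<le> degree N"
  shows "coeff N k \<noteq> 0"
  using assms
proof (induction k arbitrary: N)
  case 0
  then show ?case using "0.prems"(1)[of 0] by (simp add: poly_0_coeff_0)
next
  case (Suc k)
  have "poly (pderiv N) u \<noteq> 0" if "Im u \<ge> 0" for u
    using logarithmic_derivative_im[OF Suc.prems(1) that] Suc.prems(2) by auto
  moreover have "k \<le> degree (pderiv N)" using Suc.prems(2) by (simp add: degree_pderiv)
  ultimately have "coeff (pderiv N) k \<noteq> 0" by (rule Suc.IH)
  then show ?case by (simp add: coeff_pderiv)
qed

lemma stable_bullet_sum:
  assumes p: "\<And>x y. Im x > 0 \<Longrightarrow> Im y > 0 \<Longrightarrow> bieval a p x y \<noteq> 0"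
    and q: "\<And>x y. Im x > 0 \<Longrightarrow> Im y > 0 \<Longrightarrow> bieval b q x y \<noteq> 0"
    and x: "Im x > 0" and y: "Im y > 0"
  shows "bieval (a + b) (bullet_sum a b p q) x y \<noteq> 0"
proof -
  define N :: "complex poly" where "N = (\<Sum>i\<le>a. \<Sum>j\<le>b. smult (of_real (p i * q j) * (x ^ j * y ^ (b - j)))
    ([:x, 1:] ^ (b + i - j) * [:y, 1:] ^ (a + j - i)))"
  have coeffN: "coeff N b = bieval (a + b) (bullet_sum a b p q) x y"
  proof -
    have "coeff N b = (\<Sum>i\<le>a. \<Sum>j\<le>b. of_real (p i * q j) *
        (x ^ j * y ^ (b - j) * coeff ([:x, 1:] ^ (b + i - j) * [:y, 1:] ^ (a + j - i)) b))"
      by (simp add: N_def coeff_sum mult.assoc)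
    also have "\<dots> = (\<Sum>i\<le>a. \<Sum>j\<le>b. of_real (p i * q j) * (\<Sum>k\<le>a + b. of_nat (bullet_coeff a b i j k) * (x ^ k * y ^ (a + b - k))))"
      by (intro sum.cong refl) (subst coeff_shifted_product, auto)
    also have "\<dots> = (\<Sum>i\<le>a. \<Sum>j\<le>b. \<Sum>k\<le>a + b. of_real (p i * q j * real (bullet_coeff a b i j k)) * x ^ k * y ^ (a + b - k))"
      by (simp add: sum_distrib_left mult.assoc)
    also have "\<dots> = (\<Sum>i\<le>a. \<Sum>k\<le>a + b. \<Sum>j\<le>b. of_real (p i * q j * real (bullet_coeff a b i j k)) * x ^ k * y ^ (a + b - k))"
      by (intro sum.cong refl sum.swap)
    also have "\<dots> = (\<Sum>k\<le>a + b. \<Sum>i\<le>a. \<Sum>j\<le>b. of_real (p i * q j * real (bullet_coeff a b i j k)) * x ^ k * y ^ (a + b - k))"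
      by (rule sum.swap)
    finally show ?thesis by (simp add: bieval_def bullet_sum_def sum_distrib_right)
  qed
  have polyN: "poly N u = bieval a p (x + u) (y + u) * bieval b q (x * (y + u)) (y * (x + u))" for u
  proof -
    have "poly N u = (\<Sum>i\<le>a. \<Sum>j\<le>b. (of_real (p i) * (x + u) ^ i * (y + u) ^ (a - i)) *
        (of_real (q j) * (x * (y + u)) ^ j * (y * (x + u)) ^ (b - j)))"
      unfolding N_def poly_sum
    proof (intro sum.cong refl)
      fix i j assume "i \<in> {..a}" "j \<in> {..b}"
      then have i: "i \<le> a" and j: "j \<le> b" by auto
      have "(x + u) ^ (b + i - j) = (x + u) ^ i * (x + u) ^ (b - j)"
        using j by (simp add: power_add[symmetric] add.commute)
      moreover have "(y + u) ^ (a + j - i) = (y + u) ^ (a - i) * (y + u) ^ j"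
        using i by (simp add: power_add[symmetric])
      ultimately show "poly (smult (of_real (p i * q j) * (x ^ j * y ^ (b - j)))
          ([:x, 1:] ^ (b + i - j) * [:y, 1:] ^ (a + j - i))) u =
        (of_real (p i) * (x + u) ^ i * (y + u) ^ (a - i)) *
        (of_real (q j) * (x * (y + u)) ^ j * (y * (x + u)) ^ (b - j))"
        by (simp add: power_mult_distrib mult_ac)
    qed
    then show ?thesis by (simp add: bieval_def sum_product)
  qed
  \<comment> \<open>The point (1, 1) is on the boundary of the domain of stability, but homogeneity
    moves it to (\<i>, \<i>).\<close>
  have one: "bieval d c 1 1 \<noteq> 0" if "\<And>x y. Im x > 0 \<Longrightarrow> Im y > 0 \<Longrightarrow> bieval d c x y \<noteq> 0" for d c
    using that[of \<i> \<i>] bieval_scale[of d c \<i> 1 1] by auto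
  have "poly N u \<noteq> 0" if u: "Im u \<ge> 0" for u
  proof -
    have "bieval a p (x + u) (y + u) \<noteq> 0" using p x y u by simp
    moreover have "bieval b q (x * (y + u)) (y * (x + u)) \<noteq> 0"
    proof (cases "u = 0")
      \<comment> \<open>At \<open>u = 0\<close> both arguments equal \<open>x * y\<close>, which
        need not lie in the upper half-plane; scaling reduces to (1, 1).\<close>
      case True
      then show ?thesis using bieval_scale[of b q "x * y" 1 1] one[OF q] x y by (auto simp: mult.commute)
    next
      case False
      \<comment> \<open>After division by \<open>- (x * y * u)\<close> the arguments become
        \<open>s\<close> and \<open>t\<close>. Both lie in the open upper half-plane, even for real
        \<open>u\<close>, because \<open>1 / y\<close> and \<open>1 / x\<close> contribute
        strictly.\<close>
      define s where "s = - (1 / u + 1 / y)"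
      define t where "t = - (1 / u + 1 / x)"
      have "Im (1 / u) \<le> 0" using u by (simp add: Im_divide divide_nonpos_nonneg)
      then have "Im s > 0" "Im t > 0" using Im_inverse_neg[OF x] Im_inverse_neg[OF y] by (auto simp: s_def t_def)
      then have st: "bieval b q s t \<noteq> 0" by (rule q)
      have nz: "x \<noteq> 0" "y \<noteq> 0" using x y by auto
      have "x * (y + u) = - (x * y * u) * s" "y * (x + u) = - (x * y * u) * t"
        using False nz by (simp_all add: s_def t_def field_simps)
      then show ?thesis using bieval_scale[of b q "- (x * y * u)" s t] st False nz by simp
    qed
    ultimately show ?thesis by (simp add: polyN)
  qed
  moreover have "b \<le> degree N"
  proof -
    \<comment> \<open>The top coefficient is the value of \<open>p\<close> at (1, 1) times that of
      \<open>q\<close> at (x, y), so \<open>N\<close> has degree at least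
      \<open>a + b\<close>.\<close>
    have "coeff N (a + b) = (\<Sum>i\<le>a. \<Sum>j\<le>b. of_real (p i * q j) * (x ^ j * y ^ (b - j)))"
      unfolding N_def coeff_sum
    proof (intro sum.cong refl)
      fix i j assume "i \<in> {..a}" "j \<in> {..b}"
      then have "a + b = (b + i - j) + (a + j - i)" by auto
      then have "coeff ([:x, 1:] ^ (b + i - j) * [:y, 1:] ^ (a + j - i)) (a + b) =
          coeff ([:x, 1:] ^ (b + i - j)) (b + i - j) * coeff ([:y, 1:] ^ (a + j - i)) (a + j - i)"
        using coeff_mult_degree_sum[of "[:x, 1:] ^ (b + i - j)" "[:y, 1:] ^ (a + j - i)"]
        by (simp add: degree_linear_power)
      then show "coeff (smult (of_real (p i * q j) * (x ^ j * y ^ (b - j)))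
          ([:x, 1:] ^ (b + i - j) * [:y, 1:] ^ (a + j - i))) (a + b) = of_real (p i * q j) * (x ^ j * y ^ (b - j))"
        by (simp add: coeff_linear_power)
    qed
    also have "\<dots> = bieval a p 1 1 * bieval b q x y"
      by (simp add: bieval_def sum_product mult.assoc)
    also have "\<dots> \<noteq> 0" using one[OF p] q[OF x y] by simp
    finally have "a + b \<le> degree N" by (rule le_degree)
    then show ?thesis by simp
  qed
  ultimately show ?thesis using coeff_nonzero_if_no_upper_zeros[of N b] coeffN by simp
qed

section \<open>Bivariate Lorentzian polynomials\<close>

lemma lookup_partial_deriv:
  "lookup (partial_deriv v f) \<beta> = real (lookup \<beta> v + 1) * lookup f (\<beta> + single v 1)"
proof -
  let ?\<alpha> = "\<beta> + single v 1"
  have "lookup (partial_deriv v f) \<beta> =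
      (\<Sum>\<alpha>\<in>keys f. if \<alpha> - single v 1 = \<beta> then real (lookup \<alpha> v) * lookup f \<alpha> else 0)"
    unfolding partial_deriv_def lookup_sum by (intro sum.cong refl) (simp add: lookup_single when_def)
  also have "\<dots> = (\<Sum>\<alpha>\<in>keys f. if \<alpha> = ?\<alpha> then real (lookup \<alpha> v) * lookup f \<alpha> else 0)"
  proof (intro sum.cong refl)
    fix \<alpha>
    \<comment> \<open>Truncated subtraction fixes an exponent vector without \<open>v\<close>, but
      the corresponding term has the factor zero.\<close>
    have "\<alpha> = ?\<alpha>" if "\<alpha> - single v 1 = \<beta>" "lookup \<alpha> v \<noteq> 0"
    proof (rule poly_mapping_eqI)
      fix u
      show "lookup \<alpha> u = lookup ?\<alpha> u"
        using that by (auto simp: lookup_add lookup_minus lookup_single when_def)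
    qed
    then consider "\<alpha> = ?\<alpha>" | "\<alpha> \<noteq> ?\<alpha>" "lookup \<alpha> v = 0" | "\<alpha> \<noteq> ?\<alpha>" "\<alpha> - single v 1 \<noteq> \<beta>" by blast
    then show "(if \<alpha> - single v 1 = \<beta> then real (lookup \<alpha> v) * lookup f \<alpha> else 0) =
        (if \<alpha> = ?\<alpha> then real (lookup \<alpha> v) * lookup f \<alpha> else 0)" by cases simp_all
  qed
  also have "\<dots> = real (lookup ?\<alpha> v) * lookup f ?\<alpha>" by (auto simp: in_keys_iff)
  finally show ?thesis by (simp add: lookup_add)
qed

lemma partial_deriv_bipoly:
  "partial_deriv 1 (bipoly (Suc d) c) = bipoly d (\<lambda>i. real (i + 1) * c (i + 1))"
  "partial_deriv 2 (bipoly (Suc d) c) = bipoly d (\<lambda>i. real (Suc d - i) * c i)"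
  by (rule poly_mapping_eqI; auto simp: lookup_partial_deriv lookup_bipoly lookup_add lookup_single)+

lemma exists_exponent:
  obtains \<alpha> :: "2 \<Rightarrow>\<^sub>0 nat" where "lookup \<alpha> 1 = m" "lookup \<alpha> 2 = n"
proof
  show "lookup (single (1::2) m + single 2 n) 1 = m" "lookup (single (1::2) m + single 2 n) 2 = n"
    by (auto simp: lookup_add lookup_single)
qed

lemma bipoly_nonneg_iff: "(\<forall>\<alpha>. lookup (bipoly d c) \<alpha> \<ge> 0) \<longleftrightarrow> (\<forall>i\<le>d. c i \<ge> 0)"
proof
  assume nn: "\<forall>\<alpha>. lookup (bipoly d c) \<alpha> \<ge> 0"
  show "\<forall>i\<le>d. c i \<ge> 0"
  proof (intro allI impI)
    fix i assume "i \<le> d"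
    obtain \<alpha> :: "2 \<Rightarrow>\<^sub>0 nat" where "lookup \<alpha> 1 = i" "lookup \<alpha> 2 = d - i" by (rule exists_exponent)
    then show "c i \<ge> 0" using nn[rule_format, of \<alpha>] \<open>i \<le> d\<close> by (simp add: lookup_bipoly)
  qed
qed (auto simp: lookup_bipoly)

lemma bipoly_eq_0_iff: "bipoly d c = 0 \<longleftrightarrow> (\<forall>i\<le>d. c i = 0)"
proof
  assume 0: "bipoly d c = 0"
  show "\<forall>i\<le>d. c i = 0"
  proof (intro allI impI)
    fix i assume "i \<le> d"
    obtain \<alpha> :: "2 \<Rightarrow>\<^sub>0 nat" where "lookup \<alpha> 1 = i" "lookup \<alpha> 2 = d - i" by (rule exists_exponent)
    then show "c i = 0" using arg_cong[OF 0, of "\<lambda>f. lookup f \<alpha>"] \<open>i \<le> d\<close> by (simp add: lookup_bipoly)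
  qed
next
  assume "\<forall>i\<le>d. c i = 0"
  then show "bipoly d c = 0" by (intro poly_mapping_eqI) (auto simp: lookup_bipoly)
qed

text \<open>In a fixed degree the first exponent determines the monomial, and the incoming variable
  of an exchange is forced. An exchange is thus one step of the first exponent towards the other
  monomial, and repeated steps fill the gap.\<close>

lemma M_convex_bipoly_iff:
  "M_convex (keys (bipoly d c)) \<longleftrightarrow>
    (\<forall>i j k. i \<le> j \<longrightarrow> j \<le> k \<longrightarrow> k \<le> d \<longrightarrow> c i \<noteq> 0 \<longrightarrow> c k \<noteq> 0 \<longrightarrow> c j \<noteq> 0)" (is "?M \<longleftrightarrow> ?I")
proof
  assume M: ?M
  show ?I
  proof (intro allI impI)
    fix i j k assume "i \<le> j" "j \<le> k" "k \<le> d" and i: "c i \<noteq> 0" and k: "c k \<noteq> 0"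
    have "c (k - r) \<noteq> 0" if "r \<le> k - i" for r
      using that
    proof (induction r)
      case (Suc r)
      obtain \<alpha> :: "2 \<Rightarrow>\<^sub>0 nat" where \<alpha>: "lookup \<alpha> 1 = k - r" "lookup \<alpha> 2 = d - (k - r)" by (rule exists_exponent)
      obtain \<beta> :: "2 \<Rightarrow>\<^sub>0 nat" where \<beta>: "lookup \<beta> 1 = i" "lookup \<beta> 2 = d - i" by (rule exists_exponent)
      have "\<alpha> \<in> keys (bipoly d c)" "\<beta> \<in> keys (bipoly d c)" "lookup \<alpha> 1 > lookup \<beta> 1"
        using Suc i \<alpha> \<beta> \<open>k \<le> d\<close> by (auto simp: in_keys_iff lookup_bipoly)
      then obtain l where l: "lookup \<alpha> l < lookup \<beta> l" "\<alpha> - single 1 1 + single l 1 \<in> keys (bipoly d c)"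
        using M unfolding M_convex_def by blast
      have "l = 1 \<or> l = 2" using UNIV_type_2 by auto
      then have "l = 2" using l(1) \<open>lookup \<alpha> 1 > lookup \<beta> 1\<close> by auto
      then have "c (lookup (\<alpha> - single 1 1 + single 2 1) 1) \<noteq> 0"
        using l(2) by (auto simp: in_keys_iff lookup_bipoly split: if_splits)
      then show ?case by (simp add: lookup_add lookup_minus lookup_single \<alpha>)
    qed (use k in simp)
    from this[of "k - j"] show "c j \<noteq> 0" using \<open>i \<le> j\<close> \<open>j \<le> k\<close> by simp
  qed
next
  assume I: ?I
  show ?M unfolding M_convex_def
  proof (intro ballI allI impI)
    fix \<alpha> \<beta> :: "2 \<Rightarrow>\<^sub>0 nat" and v :: 2
    assume "\<alpha> \<in> keys (bipoly d c)" "\<beta> \<in> keys (bipoly d c)" and v: "lookup \<beta> v < lookup \<alpha> v"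
    then have \<alpha>: "lookup \<alpha> 1 + lookup \<alpha> 2 = d" "c (lookup \<alpha> 1) \<noteq> 0"
      and \<beta>: "lookup \<beta> 1 + lookup \<beta> 2 = d" "c (lookup \<beta> 1) \<noteq> 0"
      by (auto simp: in_keys_iff lookup_bipoly split: if_splits)
    have v12: "v = 1 \<or> v = 2" using UNIV_type_2 by auto
    define u :: 2 where "u = (if v = 1 then 2 else 1)"
    let ?\<gamma> = "\<alpha> - single v 1 + single u 1"
    have "lookup \<alpha> u < lookup \<beta> u" using v v12 \<alpha> \<beta> by (auto simp: u_def)
    moreover have "lookup ?\<gamma> 1 + lookup ?\<gamma> 2 = d"
      using v v12 \<alpha> by (auto simp: u_def lookup_add lookup_minus lookup_single)
    moreover have "c (lookup ?\<gamma> 1) \<noteq> 0"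
    proof (cases "v = 1")
      case True
      then have "lookup ?\<gamma> 1 = lookup \<alpha> 1 - 1" by (simp add: u_def lookup_add lookup_minus lookup_single)
      moreover have "lookup \<beta> 1 \<le> lookup \<alpha> 1 - 1" "lookup \<alpha> 1 - 1 \<le> lookup \<alpha> 1" "lookup \<alpha> 1 \<le> d" using v True \<alpha> by auto
      ultimately show ?thesis using I \<alpha>(2) \<beta>(2) by metis
    next
      case False
      then have "v = 2" using v12 by simp
      then have "lookup ?\<gamma> 1 = lookup \<alpha> 1 + 1" by (simp add: u_def lookup_add lookup_minus lookup_single)
      moreover have "lookup \<alpha> 1 \<le> lookup \<alpha> 1 + 1" "lookup \<alpha> 1 + 1 \<le> lookup \<beta> 1" "lookup \<beta> 1 \<le> d"
        using v \<open>v = 2\<close> \<alpha> \<beta> by auto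
      ultimately show ?thesis using I \<alpha>(2) \<beta>(2) by metis
    qed
    ultimately show "\<exists>j. lookup \<alpha> j < lookup \<beta> j \<and> \<alpha> - single v 1 + single j 1 \<in> keys (bipoly d c)"
      by (intro exI[of _ u]) (simp add: in_keys_iff lookup_bipoly)
  qed
qed

lemma stable_linear:
  assumes "c 0 \<ge> 0" "c 1 \<ge> 0" "c 0 \<noteq> 0 \<or> c 1 \<noteq> 0" "Im x > 0" "Im y > 0"
  shows "bieval 1 c x y \<noteq> 0"
proof -
  have "Im (bieval 1 c x y) = c 0 * Im y + c 1 * Im x" by (simp add: bieval_def)
  moreover have "c 0 * Im y + c 1 * Im x > 0"
  proof (cases "c 0 = 0")
    case True
    then show ?thesis using assms by simp
  next
    case False
    then have "c 0 * Im y > 0" "c 1 * Im x \<ge> 0" using assms by simp_all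
    then show ?thesis by linarith
  qed
  ultimately show ?thesis by auto
qed

lemma bieval_2: "bieval 2 c x y = of_real (c 0) * y\<^sup>2 + of_real (c 1) * (x * y) + of_real (c 2) * x\<^sup>2"
  by (simp add: bieval_def numeral_2_eq_2 algebra_simps)

text \<open>If the discriminant is nonnegative, the form factors into \<open>x + r * y\<close> and
  \<open>x + t * y\<close> with \<open>r, t \<ge> 0\<close>, which have positive imaginary part.
  Otherwise the equation for \<open>x / y\<close> has a root \<open>\<zeta>\<close> in the upper
  half-plane, and it remains to realise this ratio inside the half-plane.\<close>

lemma stable_quadratic_iff:
  assumes nn: "c 0 \<ge> 0" "c 1 \<ge> 0" "c 2 \<ge> 0" and nz: "\<not> (c 0 = 0 \<and> c 1 = 0 \<and> c 2 = 0)"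
  shows "(\<forall>x y. Im x > 0 \<longrightarrow> Im y > 0 \<longrightarrow> bieval 2 c x y \<noteq> 0) \<longleftrightarrow> 4 * c 0 * c 2 \<le> (c 1)\<^sup>2"
proof
  assume st: "\<forall>x y. Im x > 0 \<longrightarrow> Im y > 0 \<longrightarrow> bieval 2 c x y \<noteq> 0"
  show "4 * c 0 * c 2 \<le> (c 1)\<^sup>2"
  proof (rule ccontr)
    assume "\<not> ?thesis"
    then have neg: "4 * c 0 * c 2 - (c 1)\<^sup>2 > 0" by simp
    then have c2: "c 2 > 0" using nn by (cases "c 2 = 0") auto
    define s where "s = sqrt (4 * c 0 * c 2 - (c 1)\<^sup>2)"
    have s: "s > 0" "s\<^sup>2 = 4 * c 0 * c 2 - (c 1)\<^sup>2" using neg by (simp_all add: s_def)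
    define \<zeta> where "\<zeta> = Complex (- c 1 / (2 * c 2)) (s / (2 * c 2))"
    have root: "of_real (c 0) + of_real (c 1) * \<zeta> + of_real (c 2) * \<zeta>\<^sup>2 = 0"
    proof (rule complex_eqI)
      show "Re (of_real (c 0) + of_real (c 1) * \<zeta> + of_real (c 2) * \<zeta>\<^sup>2) = Re 0"
      proof -
        have "Re (of_real (c 0) + of_real (c 1) * \<zeta> + of_real (c 2) * \<zeta>\<^sup>2) = c 0 - ((c 1)\<^sup>2 + s\<^sup>2) / (4 * c 2)"
          using c2 by (simp add: \<zeta>_def power2_eq_square field_simps)
        also have "\<dots> = 0" using c2 s(2) by simp
        finally show ?thesis by simp
      qed
      show "Im (of_real (c 0) + of_real (c 1) * \<zeta> + of_real (c 2) * \<zeta>\<^sup>2) = Im 0"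
        using c2 by (simp add: \<zeta>_def power2_eq_square field_simps)
    qed
    have im: "Im \<zeta> > 0" using s c2 by (simp add: \<zeta>_def)
    \<comment> \<open>\<open>y\<close> lies so close to the real axis that
      \<open>\<zeta> * y\<close> keeps at least half of the imaginary part of
      \<open>\<zeta>\<close>.\<close>
    define \<delta> where "\<delta> = Im \<zeta> / (2 * (1 + \<bar>Re \<zeta>\<bar>))"
    have \<delta>: "\<delta> > 0" using im by (simp add: \<delta>_def add_pos_nonneg)
    define y where "y = Complex 1 \<delta>"
    have "\<delta> * \<bar>Re \<zeta>\<bar> \<le> \<delta> * (1 + \<bar>Re \<zeta>\<bar>)" using \<delta> by simp
    also have "\<dots> = Im \<zeta> / 2"
    proof -
      have "1 + \<bar>Re \<zeta>\<bar> \<noteq> 0" using abs_ge_zero[of "Re \<zeta>"] by linarith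
      then show ?thesis unfolding \<delta>_def by (simp add: field_simps)
    qed
    finally have "\<bar>\<delta> * Re \<zeta>\<bar> \<le> Im \<zeta> / 2" using \<delta> by (simp add: abs_mult)
    then have "- (Im \<zeta> / 2) \<le> \<delta> * Re \<zeta>" by linarith
    moreover have "Im (\<zeta> * y) = Im \<zeta> + \<delta> * Re \<zeta>" by (simp add: y_def)
    ultimately have "Im (\<zeta> * y) > 0" using im by linarith
    moreover have "Im y > 0" using \<delta> by (simp add: y_def)
    moreover have "bieval 2 c (\<zeta> * y) y = y\<^sup>2 * (of_real (c 0) + of_real (c 1) * \<zeta> + of_real (c 2) * \<zeta>\<^sup>2)"
      unfolding bieval_2 by (simp add: power2_eq_square algebra_simps)
    ultimately show False using st root by auto
  qed
next
  assume disc: "4 * c 0 * c 2 \<le> (c 1)\<^sup>2"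
  show "\<forall>x y. Im x > 0 \<longrightarrow> Im y > 0 \<longrightarrow> bieval 2 c x y \<noteq> 0"
  proof (intro allI impI)
    fix x y :: complex assume xy: "Im x > 0" "Im y > 0"
    show "bieval 2 c x y \<noteq> 0"
    proof (cases "c 2 = 0")
      case True
      have "bieval 2 c x y = y * bieval 1 c x y"
        unfolding bieval_2 using True by (simp add: bieval_def power2_eq_square algebra_simps)
      moreover have "bieval 1 c x y \<noteq> 0" using stable_linear nn nz True xy by blast
      ultimately show ?thesis using xy by auto
    next
      case False
      then have c2: "c 2 > 0" using nn by simp
      define s where "s = sqrt ((c 1)\<^sup>2 - 4 * c 0 * c 2)"
      have s: "s \<ge> 0" "s\<^sup>2 = (c 1)\<^sup>2 - 4 * c 0 * c 2" using disc by (simp_all add: s_def)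
      have "s \<le> c 1" using nn c2 s by (intro power2_le_imp_le[of s "c 1"]) auto
      define r where "r = (c 1 - s) / (2 * c 2)"
      define t where "t = (c 1 + s) / (2 * c 2)"
      have rt: "r \<ge> 0" "t \<ge> 0" using \<open>s \<le> c 1\<close> s nn c2 by (simp_all add: r_def t_def)
      have "c 2 * (r + t) = c 1" using c2 by (simp add: r_def t_def field_simps)
      moreover have "c 2 * (r * t) = c 0"
      proof -
        have "r * t = ((c 1)\<^sup>2 - s\<^sup>2) / (4 * (c 2)\<^sup>2)"
          by (simp add: r_def t_def power2_eq_square algebra_simps diff_divide_distrib add_divide_distrib)
        also have "\<dots> = c 0 / c 2" unfolding s(2) using c2 by (simp add: power2_eq_square)
        finally show ?thesis using c2 by simp
      qed
      ultimately have c01: "c 1 = c 2 * (r + t)" "c 0 = c 2 * (r * t)" by simp_all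
      have fac: "bieval 2 c x y = of_real (c 2) * ((x + of_real r * y) * (x + of_real t * y))"
        unfolding bieval_2 c01 by (simp add: power2_eq_square algebra_simps)
      have "Im (x + of_real k * y) > 0" if "k \<ge> 0" for k using xy that by (simp add: add_pos_nonneg)
      then have "x + of_real r * y \<noteq> 0" "x + of_real t * y \<noteq> 0" using rt by (metis less_irrefl zero_complex.simps(2))+
      then show ?thesis unfolding fac using c2 by simp
    qed
  qed
qed

text \<open>On normalised coefficients the two partial derivatives act, up to the factor
  \<open>d + 1\<close>, as a shift (here) and as a truncation
  (\<open>normalized_deriv_y\<close>).\<close>

lemma normalized_deriv_x:
  "real (i + 1) * c (i + 1) / real (d choose i) = real (Suc d) * (c (i + 1) / real (Suc d choose (i + 1)))"
proof (cases "i \<le> d")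
  case True
  have "real (Suc i) * real (Suc d choose Suc i) = real (Suc d) * real (d choose i)"
    using Suc_times_binomial_eq[of d i] by (metis mult.commute of_nat_mult)
  moreover have "real (d choose i) \<noteq> 0" "real (Suc d choose Suc i) \<noteq> 0" using True by (simp_all del: binomial_Suc_Suc)
  ultimately show ?thesis by (simp add: field_simps del: binomial_Suc_Suc of_nat_Suc)
qed (simp add: binomial_eq_0)

lemma normalized_deriv_y:
  assumes "i \<le> d"
  shows "real (Suc d - i) * c i / real (d choose i) = real (Suc d) * (c i / real (Suc d choose i))"
proof -
  have "real (Suc d - i) * real (Suc d choose i) = real (Suc d) * real (d choose i)"
    using binomial_absorb_comp[of "Suc d" i] by (metis diff_Suc_1 of_nat_mult)
  moreover have "real (d choose i) \<noteq> 0" "real (Suc d choose i) \<noteq> 0" using assms by simp_all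
  ultimately show ?thesis by (simp add: field_simps del: of_nat_Suc)
qed

text \<open>Up to degree two, stability is matched with the discriminant. Above that, the
  derivatives see the normalised sequence without its first and without its last term; together
  these contain every consecutive triple, and M-convexity of the support excludes internal
  zeros.\<close>

lemma lorentzian_bipoly_iff:
  "lorentzian d (bipoly d c) \<longleftrightarrow> log_concave_upto d (\<lambda>i. c i / real (d choose i))"
proof (induction d arbitrary: c)
  case 0
  have "bipoly 0 c = 0 \<or> stable_poly (bipoly 0 c)"
    unfolding bipoly_eq_0_iff stable_bipoly by (auto simp: bieval_def)
  moreover have "log_concave_upto 0 (\<lambda>i. c i / real (0 choose i)) \<longleftrightarrow> c 0 \<ge> 0"
  proof -
    have "c i / real (0 choose i) = (if i = 0 then c 0 else 0)" for i by (cases i) auto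
    then show ?thesis unfolding log_concave_upto_def by (auto split: if_splits)
  qed
  ultimately show ?case
    by (subst lorentzian.simps) (auto simp: homogeneous_bipoly bipoly_nonneg_iff)
next
  case (Suc d)
  let ?t = "\<lambda>i. c i / real (Suc d choose i)"
  have t0: "?t i \<noteq> 0 \<longleftrightarrow> c i \<noteq> 0 \<and> i \<le> Suc d" for i by (auto simp: binomial_eq_0_iff not_less)
  have tnn: "(\<forall>i. ?t i \<ge> 0) \<longleftrightarrow> (\<forall>i\<le>Suc d. c i \<ge> 0)"
  proof -
    have "?t i \<ge> 0 \<longleftrightarrow> i \<le> Suc d \<longrightarrow> c i \<ge> 0" for i
    proof (cases "i \<le> Suc d")
      case True
      then have "real (Suc d choose i) > 0" by (simp del: binomial_Suc_Suc)
      then show ?thesis using True by (simp add: zero_le_divide_iff del: binomial_Suc_Suc)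
    qed (simp add: binomial_eq_0)
    then show ?thesis by blast
  qed
  define nn where "nn \<longleftrightarrow> (\<forall>i\<le>Suc d. c i \<ge> 0)"
  define lc where "lc \<longleftrightarrow> (\<forall>i. ?t i * ?t (i + 2) \<le> (?t (i + 1))\<^sup>2)"
  define int where "int \<longleftrightarrow> (\<forall>i j k. i \<le> j \<longrightarrow> j \<le> k \<longrightarrow> k \<le> Suc d \<longrightarrow> c i \<noteq> 0 \<longrightarrow> c k \<noteq> 0 \<longrightarrow> c j \<noteq> 0)"
  have "(\<forall>i j k. i \<le> j \<longrightarrow> j \<le> k \<longrightarrow> ?t i \<noteq> 0 \<longrightarrow> ?t k \<noteq> 0 \<longrightarrow> ?t j \<noteq> 0) \<longleftrightarrow> int"
    unfolding t0 int_def by (meson le_trans)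
  moreover have "\<forall>i. i > Suc d \<longrightarrow> ?t i = 0" using t0 by (meson not_le)
  ultimately have lhs: "log_concave_upto (Suc d) ?t \<longleftrightarrow> nn \<and> lc \<and> int"
    unfolding log_concave_upto_def tnn nn_def[symmetric] lc_def[symmetric] by blast
  have rhs: "lorentzian (Suc d) (bipoly (Suc d) c) \<longleftrightarrow> nn \<and> (if Suc d \<le> 2
      then (\<forall>i\<le>Suc d. c i = 0) \<or> (\<forall>x y. Im x > 0 \<longrightarrow> Im y > 0 \<longrightarrow> bieval (Suc d) c x y \<noteq> 0)
      else int \<and> (\<forall>v. lorentzian d (partial_deriv v (bipoly (Suc d) c))))"
    by (subst lorentzian.simps)
      (simp add: homogeneous_bipoly bipoly_nonneg_iff bipoly_eq_0_iff stable_bipoly M_convex_bipoly_iff nn_def int_def)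
  consider "d = 0" | "d = 1" | "d \<ge> 2" by linarith
  then show ?case
  proof cases
    case 1
    have lc unfolding lc_def
    proof
      fix i have "?t (i + 2) = 0" using t0[of "i + 2"] 1 by simp
      then show "?t i * ?t (i + 2) \<le> (?t (i + 1))\<^sup>2" by (simp only: mult_zero_right zero_le_power2)
    qed
    moreover have int unfolding int_def
    proof (intro allI impI)
      fix i j k assume "i \<le> j" "j \<le> k" "k \<le> Suc d" "c i \<noteq> 0" "c k \<noteq> 0"
      moreover from this have "j = i \<or> j = k" using 1 by linarith
      ultimately show "c j \<noteq> 0" by auto
    qed
    moreover have "(\<forall>i\<le>1. c i = 0) \<or> (\<forall>x y. Im x > 0 \<longrightarrow> Im y > 0 \<longrightarrow> bieval 1 c x y \<noteq> 0)" if nn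
    proof (cases "c 0 = 0 \<and> c 1 = 0")
      case True
      then show ?thesis by (auto simp: le_Suc_eq)
    next
      case False
      then show ?thesis using that 1 stable_linear[of c] by (auto simp: nn_def)
    qed
    ultimately show ?thesis unfolding lhs rhs using 1 by auto
  next
    case 2
    have lc2: "lc \<longleftrightarrow> 4 * c 0 * c 2 \<le> (c 1)\<^sup>2"
    proof -
      have "?t (i + 2) = 0" if "i > 0" for i using t0[of "i + 2"] 2 that by simp
      then have "lc \<longleftrightarrow> ?t 0 * ?t 2 \<le> (?t 1)\<^sup>2" unfolding lc_def
        by (metis add_0 gr0I mult_zero_right zero_le_power2)
      also have "\<dots> \<longleftrightarrow> c 0 * c 2 \<le> (c 1 / 2)\<^sup>2" using 2 by (simp add: numeral_2_eq_2)
      also have "\<dots> \<longleftrightarrow> 4 * c 0 * c 2 \<le> (c 1)\<^sup>2" by (simp add: power_divide field_simps)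
      finally show ?thesis .
    qed
    \<comment> \<open>In degree two the absence of gaps comes from the discriminant: a gap would
      mean \<open>c 1 = 0\<close> with \<open>c 0\<close> and \<open>c 2\<close> positive.\<close>
    have int2: int if nn "4 * c 0 * c 2 \<le> (c 1)\<^sup>2" unfolding int_def
    proof (intro allI impI notI)
      fix i j k assume *: "i \<le> j" "j \<le> k" "k \<le> Suc d" "c i \<noteq> 0" "c k \<noteq> 0" "c j = 0"
      then have "i \<noteq> j" "j \<noteq> k" by auto
      then have "i = 0" "j = 1" "k = 2" using *(1-3) 2 by linarith+
      then have "c 0 > 0" "c 2 > 0" "c 1 = 0" using * that(1) 2 by (auto simp: nn_def less_le)
      then have "4 * c 0 * c 2 > 0" "(c 1)\<^sup>2 = 0" by auto
      then show False using that(2) by linarith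
    qed
    have "(\<forall>i\<le>2. c i = 0) \<or> (\<forall>x y. Im x > 0 \<longrightarrow> Im y > 0 \<longrightarrow> bieval 2 c x y \<noteq> 0) \<longleftrightarrow> 4 * c 0 * c 2 \<le> (c 1)\<^sup>2"
      if nn
    proof (cases "c 0 = 0 \<and> c 1 = 0 \<and> c 2 = 0")
      case True
      then have "\<forall>i\<le>2. c i = 0" by (metis le_Suc_eq le_zero_eq numeral_2_eq_2 One_nat_def)
      then show ?thesis using True by simp
    next
      case False
      have "\<not> (\<forall>i\<le>2. c i = 0)"
      proof
        assume "\<forall>i\<le>2. c i = 0"
        then have "c 0 = 0" "c 1 = 0" "c 2 = 0" by simp_all
        then show False using False by simp
      qed
      moreover have "c 0 \<ge> 0" "c 1 \<ge> 0" "c 2 \<ge> 0" using that 2 by (auto simp: nn_def)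
      ultimately show ?thesis using stable_quadratic_iff[of c] False by blast
    qed
    moreover have "Suc d = 2" using 2 by simp
    ultimately show ?thesis unfolding lhs rhs lc2 using int2 by (simp only: order_refl if_True) blast
  next
    case 3
    have ex1: "(\<forall>v. lorentzian d (partial_deriv v (bipoly (Suc d) c))) \<longleftrightarrow>
        lorentzian d (partial_deriv 1 (bipoly (Suc d) c)) \<and> lorentzian d (partial_deriv 2 (bipoly (Suc d) c))"
      using UNIV_type_2 by (metis UNIV_I insertE singletonD)
    define s where "s = real (Suc d)"
    have s: "s > 0" by (simp add: s_def)
    have dx: "lorentzian d (partial_deriv 1 (bipoly (Suc d) c)) \<longleftrightarrow> log_concave_upto d (\<lambda>i. s * ?t (i + 1))"
      unfolding partial_deriv_bipoly Suc.IH normalized_deriv_x s_def ..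
    have dy: "lorentzian d (partial_deriv 2 (bipoly (Suc d) c)) \<longleftrightarrow>
        log_concave_upto d (\<lambda>i. if i \<le> d then s * ?t i else 0)"
    proof -
      have "(\<lambda>i. real (Suc d - i) * c i / real (d choose i)) = (\<lambda>i. if i \<le> d then s * ?t i else 0)"
        using normalized_deriv_y[of _ d c] by (auto simp: s_def binomial_eq_0)
      then show ?thesis unfolding partial_deriv_bipoly Suc.IH by simp
    qed
    have sq: "s * x * (s * y) \<le> (s * z)\<^sup>2 \<longleftrightarrow> x * y \<le> z\<^sup>2" for x y z
    proof -
      have "s * x * (s * y) = s\<^sup>2 * (x * y)" "(s * z)\<^sup>2 = s\<^sup>2 * z\<^sup>2" by (simp_all add: power2_eq_square mult_ac)
      moreover have "s\<^sup>2 > 0" using s by simp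
      ultimately show ?thesis by (simp only: mult_le_cancel_left_pos)
    qed
    have "lc" if "log_concave_upto d (\<lambda>i. s * ?t (i + 1))" "log_concave_upto d (\<lambda>i. if i \<le> d then s * ?t i else 0)"
      unfolding lc_def
    proof
      \<comment> \<open>The triple at 0 comes from the derivative in the second variable, all later
        ones from the derivative in the first.\<close>
      fix i show "?t i * ?t (i + 2) \<le> (?t (i + 1))\<^sup>2"
      proof (cases i)
        case 0
        have "(if 0 \<le> d then s * ?t 0 else 0) * (if 0 + 2 \<le> d then s * ?t (0 + 2) else 0) \<le>
            (if 0 + 1 \<le> d then s * ?t (0 + 1) else 0)\<^sup>2"
          using that(2) unfolding log_concave_upto_def by blast
        then have "s * ?t 0 * (s * ?t (0 + 2)) \<le> (s * ?t (0 + 1))\<^sup>2" using 3 by (simp del: binomial_Suc_Suc)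
        then show ?thesis unfolding sq 0 .
      next
        case (Suc r)
        have "s * ?t (r + 1) * (s * ?t (r + 2 + 1)) \<le> (s * ?t (r + 1 + 1))\<^sup>2"
          using that(1) unfolding log_concave_upto_def by blast
        then have "?t (r + 1) * ?t (r + 2 + 1) \<le> (?t (r + 1 + 1))\<^sup>2" unfolding sq .
        then show ?thesis by (simp add: Suc del: binomial_Suc_Suc)
      qed
    qed
    moreover have "log_concave_upto d (\<lambda>i. s * ?t (i + 1))" if "log_concave_upto (Suc d) ?t"
      unfolding log_concave_upto_def
    proof (intro conjI allI impI)
      fix i j k
      have "?t (i + 1) \<ge> 0" using that unfolding log_concave_upto_def by blast
      then show "s * ?t (i + 1) \<ge> 0" using s by (intro mult_nonneg_nonneg) auto
      show "d < i \<Longrightarrow> s * ?t (i + 1) = 0" by (simp add: binomial_eq_0 del: binomial_Suc_Suc)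
      have "?t (i + 1) * ?t (i + 1 + 2) \<le> (?t (i + 1 + 1))\<^sup>2" using that unfolding log_concave_upto_def by blast
      then show "s * ?t (i + 1) * (s * ?t (i + 2 + 1)) \<le> (s * ?t (i + 1 + 1))\<^sup>2"
        unfolding sq by (simp add: add.commute del: binomial_Suc_Suc)
      assume *: "i \<le> j" "j \<le> k" "s * ?t (i + 1) \<noteq> 0" "s * ?t (k + 1) \<noteq> 0"
      then have "i + 1 \<le> j + 1" "j + 1 \<le> k + 1" "?t (i + 1) \<noteq> 0" "?t (k + 1) \<noteq> 0"
        by (simp_all del: binomial_Suc_Suc)
      then have "?t (j + 1) \<noteq> 0" using that unfolding log_concave_upto_def by blast
      then show "s * ?t (j + 1) \<noteq> 0" using s by simp
    qed
    moreover have "log_concave_upto d (\<lambda>i. if i \<le> d then s * ?t i else 0)" if "log_concave_upto (Suc d) ?t"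
      unfolding log_concave_upto_def
    proof (intro conjI allI impI)
      fix i j k
      have nnt: "?t i \<ge> 0" for i using that unfolding log_concave_upto_def by blast
      then have "s * ?t i \<ge> 0" using s by (intro mult_nonneg_nonneg) auto
      then show "(if i \<le> d then s * ?t i else 0) \<ge> 0" by (simp only: order_refl split: if_split) simp
      show "d < i \<Longrightarrow> (if i \<le> d then s * ?t i else 0) = 0" by simp
      show "(if i \<le> d then s * ?t i else 0) * (if i + 2 \<le> d then s * ?t (i + 2) else 0) \<le>
          (if i + 1 \<le> d then s * ?t (i + 1) else 0)\<^sup>2"
      proof (cases "i + 2 \<le> d")
        case True
        have "?t i * ?t (i + 2) \<le> (?t (i + 1))\<^sup>2" using that unfolding log_concave_upto_def by blast
        then have "s * ?t i * (s * ?t (i + 2)) \<le> (s * ?t (i + 1))\<^sup>2" unfolding sq .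
        then show ?thesis using True by (simp del: binomial_Suc_Suc)
      qed simp
      assume *: "i \<le> j" "j \<le> k" "(if i \<le> d then s * ?t i else 0) \<noteq> 0" "(if k \<le> d then s * ?t k else 0) \<noteq> 0"
      then have "?t i \<noteq> 0" "?t k \<noteq> 0" "k \<le> d" by (auto split: if_splits)
      then have "?t j \<noteq> 0" using that * unfolding log_concave_upto_def by blast
      then show "(if j \<le> d then s * ?t j else 0) \<noteq> 0" using s * \<open>k \<le> d\<close> by simp
    qed
    ultimately show ?thesis using 3 unfolding rhs ex1 dx dy lhs by auto
  qed
qed

section \<open>Support and log-concavity of the product coefficients\<close>

lemma support_window:
  fixes f :: "nat \<Rightarrow> real"
  assumes f: "\<And>i j k. i \<le> j \<Longrightarrow> j \<le> k \<Longrightarrow> f i \<noteq> 0 \<Longrightarrow> f k \<noteq> 0 \<Longrightarrow> f j \<noteq> 0"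
    and i: "f i \<noteq> 0" "i \<le> k" and j: "f j \<noteq> 0" "k \<le> m + j"
  shows "\<exists>l. f l \<noteq> 0 \<and> l \<le> k \<and> k \<le> m + l"
proof -
  \<comment> \<open>Either \<open>i\<close> or \<open>j\<close> lies in the window from
    \<open>k - m\<close> to \<open>k\<close>, or \<open>k\<close> lies between them and hence in the
    support itself.\<close>
  consider "k \<le> m + i" | "j \<le> k" | "i \<le> k" "k \<le> j" using i j by linarith
  then show ?thesis
  proof cases
    case 3
    then have "f k \<noteq> 0" using f i j by blast
    then show ?thesis by auto
  qed (use i j in auto)
qed

lemma bullet_sum_nonneg:
  assumes "\<And>i. p i \<ge> 0" "\<And>j. q j \<ge> 0"
  shows "bullet_sum a b p q k \<ge> 0"
  unfolding bullet_sum_def using assms by (intro sum_nonneg mult_nonneg_nonneg) auto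

text \<open>All terms are nonnegative, so none cancel, and \<open>bullet_coeff\<close> is nonzero
  under one condition on \<open>i\<close> and one on \<open>j\<close>. The two conditions separate,
  so the supports of \<open>p\<close> and \<open>q\<close> can be treated independently.\<close>

lemma bullet_sum_nonzero_iff:
  assumes p: "\<And>i. p i \<ge> 0" and q: "\<And>j. q j \<ge> 0"
  shows "bullet_sum a b p q k \<noteq> 0 \<longleftrightarrow>
    (\<exists>i\<le>a. p i \<noteq> 0 \<and> i \<le> k \<and> k \<le> b + i) \<and> (\<exists>j\<le>b. q j \<noteq> 0 \<and> j \<le> k \<and> k \<le> a + j)"
proof -
  have coeff: "bullet_coeff a b i j k \<noteq> 0 \<longleftrightarrow> i \<le> k \<and> k \<le> b + i \<and> j \<le> k \<and> k \<le> a + j" if "i \<le> a" "j \<le> b" for i j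
    using that by (auto simp: bullet_coeff_def binomial_eq_0_iff)
  have "bullet_sum a b p q k \<noteq> 0 \<longleftrightarrow> (\<exists>i\<le>a. \<exists>j\<le>b. p i * q j * real (bullet_coeff a b i j k) \<noteq> 0)"
  proof -
    have nn: "p i * q j * real (bullet_coeff a b i j k) \<ge> 0" for i j using p q by simp
    show ?thesis unfolding bullet_sum_def
      by (subst sum_nonneg_eq_0_iff) (auto simp: nn sum_nonneg sum_nonneg_eq_0_iff)
  qed
  also have "\<dots> \<longleftrightarrow> (\<exists>i\<le>a. \<exists>j\<le>b. p i \<noteq> 0 \<and> q j \<noteq> 0 \<and> bullet_coeff a b i j k \<noteq> 0)" by simp
  finally show ?thesis using coeff by blast
qed

lemma log_concave_bullet_sum:
  assumes p: "log_concave_upto a (\<lambda>i. p i / real (a choose i))"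
    and q: "log_concave_upto b (\<lambda>j. q j / real (b choose j))"
  shows "log_concave_upto (a + b) (\<lambda>k. bullet_sum a b p q k / real (a + b choose k))"
proof -
  let ?p = "\<lambda>i. p i / real (a choose i)" and ?q = "\<lambda>j. q j / real (b choose j)"
  \<comment> \<open>Multiplying back keeps \<open>p\<close> up to \<open>a\<close> but makes it zero
    beyond, since the binomial vanishes there. Signs and supports are thereby controlled at every
    index.\<close>
  let ?P = "\<lambda>i. real (a choose i) * ?p i" and ?Q = "\<lambda>j. real (b choose j) * ?q j"
  let ?c = "bullet_sum a b ?P ?Q"
  have eq: "bullet_sum a b p q = ?c" by (auto simp: bullet_sum_def fun_eq_iff intro!: sum.cong)
  have nn: "?P i \<ge> 0" "?Q i \<ge> 0" for i
    using p q unfolding log_concave_upto_def by (meson mult_nonneg_nonneg of_nat_0_le_iff)+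
  have P0: "?P i \<noteq> 0 \<longleftrightarrow> ?p i \<noteq> 0" and Q0: "?Q i \<noteq> 0 \<longleftrightarrow> ?q i \<noteq> 0" for i by auto
  have Pint: "?P j \<noteq> 0" if "i \<le> j" "j \<le> k" "?P i \<noteq> 0" "?P k \<noteq> 0" for i j k
    using that p unfolding P0 log_concave_upto_def by blast
  have Qint: "?Q j \<noteq> 0" if "i \<le> j" "j \<le> k" "?Q i \<noteq> 0" "?Q k \<noteq> 0" for i j k
    using that q unfolding Q0 log_concave_upto_def by blast
  have Ple: "i \<le> a" if "?P i \<noteq> 0" for i using that by (cases "i \<le> a") (simp_all add: binomial_eq_0)
  have Qle: "i \<le> b" if "?Q i \<noteq> 0" for i using that by (cases "i \<le> b") (simp_all add: binomial_eq_0)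
  have cnn: "?c k \<ge> 0" for k
    by (rule bullet_sum_nonneg[of ?P ?Q, OF nn])
  have int: "?c j \<noteq> 0" if ij: "i \<le> j" "j \<le> k" and ci: "?c i \<noteq> 0" and ck: "?c k \<noteq> 0" for i j k
  proof -
    obtain r s where rs: "?P r \<noteq> 0" "r \<le> i" "?Q s \<noteq> 0" "s \<le> i"
      using ci unfolding bullet_sum_nonzero_iff[of ?P ?Q, OF nn] by blast
    obtain r' s' where rs': "?P r' \<noteq> 0" "k \<le> b + r'" "?Q s' \<noteq> 0" "k \<le> a + s'"
      using ck unfolding bullet_sum_nonzero_iff[of ?P ?Q, OF nn] by blast
    have le: "r \<le> j" "j \<le> b + r'" "s \<le> j" "j \<le> a + s'" using rs rs' ij by linarith+
    have "\<exists>l. ?P l \<noteq> 0 \<and> l \<le> j \<and> j \<le> b + l"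
      by (rule support_window[of ?P, OF Pint rs(1) le(1) rs'(1) le(2)])
    moreover have "\<exists>l. ?Q l \<noteq> 0 \<and> l \<le> j \<and> j \<le> a + l"
      by (rule support_window[of ?Q, OF Qint rs(3) le(3) rs'(3) le(4)])
    ultimately show ?thesis unfolding bullet_sum_nonzero_iff[of ?P ?Q, OF nn] using Ple Qle by blast
  qed
  show ?thesis unfolding eq log_concave_upto_def
  proof (intro conjI allI impI)
    fix i j k
    show "?c i / real (a + b choose i) \<ge> 0" using cnn by simp
    show "a + b < i \<Longrightarrow> ?c i / real (a + b choose i) = 0" by (simp add: binomial_eq_0)
    show "?c i / real (a + b choose i) * (?c (i + 2) / real (a + b choose (i + 2))) \<le>
        (?c (i + 1) / real (a + b choose (i + 1)))\<^sup>2"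
    proof (cases "i + 2 \<le> a + b")
      case True
      then show ?thesis by (rule bullet_sum_log_concave[OF p q])
    next
      case False
      then have "real (a + b choose (i + 2)) = 0" by (simp add: binomial_eq_0)
      then show ?thesis by (simp only: div_by_0 mult_zero_right zero_le_power2)
    qed
    assume *: "i \<le> j" "j \<le> k" "?c i / real (a + b choose i) \<noteq> 0" "?c k / real (a + b choose k) \<noteq> 0"
    then have "?c i \<noteq> 0" "?c k \<noteq> 0" "k \<le> a + b" by (auto simp: binomial_eq_0_iff)
    then have "?c j \<noteq> 0" "j \<le> a + b" using int[OF *(1,2)] *(2) by auto
    then show "?c j / real (a + b choose j) \<noteq> 0" by simp
  qed
qed

theorem theorem2p6:
  fixes p q :: "2 rmpoly" and a b :: nat
  assumes "homogeneous a p" and "homogeneous b q"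
  shows "(lorentzian a p \<and> lorentzian b q \<longrightarrow> lorentzian (a + b) (bullet a b p q)) \<and>
         (stable_poly p \<and> stable_poly q \<longrightarrow>
            homogeneous (a + b) (bullet a b p q) \<and> stable_poly (bullet a b p q))"
proof -
  obtain c c' where p: "p = bipoly a c" and q: "q = bipoly b c'"
    using bipoly_bicoeff[OF assms(1)] bipoly_bicoeff[OF assms(2)] by metis
  show ?thesis
    unfolding p q bullet_bipoly lorentzian_bipoly_iff stable_bipoly
    using log_concave_bullet_sum homogeneous_bipoly stable_bullet_sum by blast
qed

end
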